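(* Let $\gamma$ be a future-directed causal curve in $M$. Then every $\bar P\in\bar M$ of the form $\bar P=(I^-[\gamma],P^* )$ is a future endpoint of $\gamma$ in $(\bar M,\bar{\mathcal T}_{alt})$: every $\bar{\mathcal T}_{alt}$-open set containing $\bar P$ contains $\Phi$ of some final (future) segment of $\gamma$.
   Context: Let $M$ be a strongly causal spacetime (a time-oriented Lorentzian manifold in which every point has a neighbourhood that no non-spacelike curve enters more than once). $I^\pm(p)$ denotes the chronological future/past of $p\in M$, $I^\pm(S)=\bigcup_{s\in S}I^\pm(s)$, and for a curve $\gamma$ we write $I^\pm[\gamma]=I^\pm(\gamma)$; for a causal curve $\gamma$, $I^-[\gamma]$ is an IP. A past-set is a set $I^-(S)$ with $S\subset M$. An IP is a nonempty past-set that is not the union of two proper subsets which are past-sets. IFs are defined dually. For an IP $P$, $f(P)=I^+(\{x:P\subset I^-(x)\})$. For an IF $P^*$, $p(P^* )=I^-(\{x:P^*\subset I^+(x)\})$. $R_{pf}$ is the set of pairs $(P,Q^* )$ (with $P$ an IP and $Q^*$ an IF) such that both of the following hold: - $Q^*$ is a maximal IF (under inclusion) contained in $f(P)$; - $P$ is a maximal IP contained in $p(Q^* )$. $\bar M$ is the set of pairs $\bar P=(P,P^* )$ such that one of the following holds: - $(P,P^* )\in R_{pf}$; - $P=\emptyset$ and $P^*$ is an IF occurring in no pair of $R_{pf}$; - $P^*=\emptyset$ and $P$ is an IP occurring in no pair of $R_{pf}$. $\Phi(p)=(I^-(p),I^+(p))$ is an injection $M\to\bar M$. Limits of sets: for past-sets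 $P_n$ and $Q$, $Q=\lim P_n$ means both of the following: - (i) each $x\in Q$ lies in $P_n$ for all sufficiently large $n$; - (ii) for each $x\in M$ with $I^-(x)\not\subset Q$, one has $I^-(x)\not\subset P_n$ for all sufficiently large $n$. Limits of future-sets are defined dually. For $\bar S\subset\bar M$ define: - $L^+_{IF}(\bar S)=\{\bar Q:Q^*\ne\emptyset,\ Q^*\subset\bigcup_{\bar R\in\bar S}R^*\}$; - $L^-_{IP}(\bar S)=\{\bar Q:Q\ne\emptyset,\ Q\subset\bigcup_{\bar R\in\bar S}R\}$; - $Cl_+(\bar S)=\bar S\cup\{\bar Q:Q\ne\emptyset,\ Q=\lim R_n\text{ for some sequence }\bar R_n\in\bar S\}$; - $Cl_-(\bar S)=\bar S\cup\{\bar Q:Q^*\neq\emptyset,\ Q^*=\lim R_n^*\text{ for some sequence }\bar R_n\in\bar S\}$; - $L^+_{alt}(\bar S)=Cl_+[L^+_{IF}(\bar S)]$; - $L^-_{alt}(\bar S)=Cl_-[L^-_{IP}(\bar S)]$; - $L_{alt}(\bar S_1,\bar S_2)=Cl_+[L^-_{IP}(\bar S_1)\cap L^+_{IF}(\bar S_2)]\cup Cl_-[L^-_{IP}(\bar S_1)\cap L^+_{IF}(\bar S_2)]$. $\bar{\mathcal T}_{alt}$ is the coarsest topology on $\bar M$ in which $\bar M\setminus L^+_{alt}(\bar S)$, $\bar M\setminus L^-_{alt}(\bar S)$ and $\bar M\setminus L_{alt}(\bar S_1,\bar S_2)$ are open for all $\bar S,\bar S_1,\bar S_2\subset\bar M$.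 *)

theory Defs
  imports "HOL-Analysis.Analysis"
begin

type_synonym ('a, 'v) chart = "'a set \<times> ('a \<Rightarrow> 'v)"

fun Ck_on :: "nat \<Rightarrow> 'v::euclidean_space set \<Rightarrow> ('v \<Rightarrow> 'w::real_normed_vector) \<Rightarrow> bool" where
  "Ck_on 0 S f = continuous_on S f"
| "Ck_on (Suc k) S f =
     (continuous_on S f \<and> (\<forall>x\<in>S. f differentiable (at x)) \<and>
      (\<forall>b\<in>Basis. Ck_on k S (\<lambda>x. frechet_derivative f (at x) b)))"

definition smooth_on :: "'v::euclidean_space set \<Rightarrow> ('v \<Rightarrow> 'w::real_normed_vector) \<Rightarrow> bool" where
  "smooth_on S f \<longleftrightarrow> (\<forall>k. Ck_on k S f)"

definition is_chart :: "('a::topological_space, 'v::euclidean_space) chart \<Rightarrow> bool" where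
  "is_chart c \<longleftrightarrow> open (fst c) \<and> open (snd c ` fst c) \<and>
     (\<exists>\<psi>. homeomorphism (fst c) (snd c ` fst c) (snd c) \<psi>)"

definition transition :: "('a, 'v) chart \<Rightarrow> ('a, 'v) chart \<Rightarrow> 'v \<Rightarrow> 'v" where
  "transition c1 c2 = (\<lambda>x. snd c2 (inv_into (fst c1) (snd c1) x))"

definition overlap :: "('a, 'v) chart \<Rightarrow> ('a, 'v) chart \<Rightarrow> 'v set" where
  "overlap c1 c2 = snd c1 ` (fst c1 \<inter> fst c2)"

definition smooth_atlas :: "('a::topological_space, 'v::euclidean_space) chart set \<Rightarrow> bool" where
  "smooth_atlas A \<longleftrightarrow> (\<forall>c\<in>A. is_chart c) \<and> (\<Union>c\<in>A. fst c) = UNIV \<and>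
     (\<forall>c1\<in>A. \<forall>c2\<in>A. smooth_on (overlap c1 c2) (transition c1 c2))"

definition lorentzian_form :: "('v::euclidean_space \<Rightarrow> 'v \<Rightarrow> real) \<Rightarrow> bool" where
  "lorentzian_form B \<longleftrightarrow> bilinear B \<and> (\<forall>u v. B u v = B v u) \<and>
     (\<exists>e. B e e < 0 \<and> (\<forall>w. w \<noteq> 0 \<and> B e w = 0 \<longrightarrow> B w w > 0))"

text \<open>A time-oriented Lorentzian manifold: smooth atlas, metric given in chart coordinates
  (metric X c x u v = g(u,v) at the point with coordinates x in chart c), and a continuous
  timelike vector field (torient) fixing the time orientation, both transforming correctly
  under changes of chart.\<close>
record ('a, 'v) spacetime_data =
  atlas   :: "('a, 'v) chart set"
  metric  :: "('a, 'v) chart \<Rightarrow> 'v \<Rightarrow> 'v \<Rightarrow> 'v \<Rightarrow> real"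
  torient :: "('a, 'v) chart \<Rightarrow> 'v \<Rightarrow> 'v"

definition spacetime ::
  "('a::{t2_space, second_countable_topology}, 'v::euclidean_space) spacetime_data \<Rightarrow> bool" where
  "spacetime X \<longleftrightarrow> DIM('v) \<ge> 2 \<and> smooth_atlas (atlas X) \<and>
    (\<forall>c\<in>atlas X.
       (\<forall>x\<in>snd c ` fst c. lorentzian_form (metric X c x)) \<and>
       (\<forall>b1\<in>Basis. \<forall>b2\<in>Basis. smooth_on (snd c ` fst c) (\<lambda>x. metric X c x b1 b2)) \<and>
       continuous_on (snd c ` fst c) (torient X c) \<and>
       (\<forall>x\<in>snd c ` fst c. metric X c x (torient X c x) (torient X c x) < 0)) \<and>
    (\<forall>c1\<in>atlas X. \<forall>c2\<in>atlas X. \<forall>x\<in>overlap c1 c2.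
       (\<forall>u v. metric X c1 x u v =
              metric X c2 (transition c1 c2 x)
                 (frechet_derivative (transition c1 c2) (at x) u)
                 (frechet_derivative (transition c1 c2) (at x) v)) \<and>
       torient X c2 (transition c1 c2 x) =
         frechet_derivative (transition c1 c2) (at x) (torient X c1 x))"

definition fd_causal_vec :: "('a, 'v::euclidean_space) spacetime_data \<Rightarrow> ('a, 'v) chart \<Rightarrow> 'v \<Rightarrow> 'v \<Rightarrow> bool" where
  "fd_causal_vec X c x v \<longleftrightarrow> v \<noteq> 0 \<and> metric X c x v v \<le> 0 \<and> metric X c x v (torient X c x) < 0"

definition fd_timelike_vec :: "('a, 'v::euclidean_space) spacetime_data \<Rightarrow> ('a, 'v) chart \<Rightarrow> 'v \<Rightarrow> 'v \<Rightarrow> bool" where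
  "fd_timelike_vec X c x v \<longleftrightarrow> metric X c x v v < 0 \<and> metric X c x v (torient X c x) < 0"

definition fd_curve ::
  "('a::topological_space, 'v::euclidean_space) spacetime_data \<Rightarrow>
   (('a, 'v) chart \<Rightarrow> 'v \<Rightarrow> 'v \<Rightarrow> bool) \<Rightarrow> (real \<Rightarrow> 'a) \<Rightarrow> real set \<Rightarrow> bool" where
  "fd_curve X Q \<gamma> I \<longleftrightarrow> is_interval I \<and> (\<exists>a\<in>I. \<exists>b\<in>I. a < b) \<and> continuous_on I \<gamma> \<and>
     (\<forall>t\<in>I. \<exists>c\<in>atlas X. \<exists>\<epsilon>>0.
        \<gamma> ` (I \<inter> {t-\<epsilon>..t+\<epsilon>}) \<subseteq> fst c \<and>
        (snd c \<circ> \<gamma>) piecewise_C1_differentiable_on (I \<inter> {t-\<epsilon>..t+\<epsilon>}) \<and>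
        (\<forall>s\<in>I \<inter> {t-\<epsilon>..t+\<epsilon>}.
           ((\<exists>s'\<in>I. s < s') \<longrightarrow>
              (\<exists>v. ((snd c \<circ> \<gamma>) has_vector_derivative v) (at s within (I \<inter> {t-\<epsilon>..t+\<epsilon>} \<inter> {s..}))
                   \<and> Q c (snd c (\<gamma> s)) v)) \<and>
           ((\<exists>s'\<in>I. s' < s) \<longrightarrow>
              (\<exists>v. ((snd c \<circ> \<gamma>) has_vector_derivative v) (at s within (I \<inter> {t-\<epsilon>..t+\<epsilon>} \<inter> {..s}))
                   \<and> Q c (snd c (\<gamma> s)) v))))"

definition fd_causal_curve where
  "fd_causal_curve X \<gamma> I \<longleftrightarrow> fd_curve X (fd_causal_vec X) \<gamma> I"

definition fd_timelike_curve where
  "fd_timelike_curve X \<gamma> I \<longleftrightarrow> fd_curve X (fd_timelike_vec X) \<gamma> I"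

definition Ifut :: "('a::topological_space, 'v::euclidean_space) spacetime_data \<Rightarrow> 'a \<Rightarrow> 'a set" where
  "Ifut X p = {q. \<exists>\<gamma> a b. a < b \<and> fd_timelike_curve X \<gamma> {a..b} \<and> \<gamma> a = p \<and> \<gamma> b = q}"

definition Ipast :: "('a::topological_space, 'v::euclidean_space) spacetime_data \<Rightarrow> 'a \<Rightarrow> 'a set" where
  "Ipast X p = {q. \<exists>\<gamma> a b. a < b \<and> fd_timelike_curve X \<gamma> {a..b} \<and> \<gamma> a = q \<and> \<gamma> b = p}"

definition IfutS where "IfutS X S = (\<Union>s\<in>S. Ifut X s)"
definition IpastS where "IpastS X S = (\<Union>s\<in>S. Ipast X s)"

text \<open>Strong causality: every neighbourhood U of p contains a neighbourhood V of p which no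
  causal curve enters more than once (the set of parameters mapped into V is an interval).\<close>
definition strongly_causal where
  "strongly_causal X \<longleftrightarrow> (\<forall>p U. open U \<and> p \<in> U \<longrightarrow>
     (\<exists>V. open V \<and> p \<in> V \<and> V \<subseteq> U \<and>
        (\<forall>\<gamma> I. fd_causal_curve X \<gamma> I \<longrightarrow> is_interval {t\<in>I. \<gamma> t \<in> V})))"

definition past_set where "past_set X P \<longleftrightarrow> (\<exists>S. P = IpastS X S)"
definition future_set where "future_set X F \<longleftrightarrow> (\<exists>S. F = IfutS X S)"

definition IP where
  "IP X P \<longleftrightarrow> P \<noteq> {} \<and> past_set X P \<and>
     \<not> (\<exists>A B. past_set X A \<and> past_set X B \<and> A \<subset> P \<and> B \<subset> P \<and> P = A \<union> B)"

definition IF where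
  "IF X F \<longleftrightarrow> F \<noteq> {} \<and> future_set X F \<and>
     \<not> (\<exists>A B. future_set X A \<and> future_set X B \<and> A \<subset> F \<and> B \<subset> F \<and> F = A \<union> B)"

definition fut_of where "fut_of X P = IfutS X {x. P \<subseteq> Ipast X x}"
definition past_of where "past_of X F = IpastS X {x. F \<subseteq> Ifut X x}"

definition Rpf where
  "Rpf X = {(P, Q). IP X P \<and> IF X Q \<and>
     Q \<subseteq> fut_of X P \<and> (\<forall>Q'. IF X Q' \<and> Q' \<subseteq> fut_of X P \<and> Q \<subseteq> Q' \<longrightarrow> Q' = Q) \<and>
     P \<subseteq> past_of X Q \<and> (\<forall>P'. IP X P' \<and> P' \<subseteq> past_of X Q \<and> P \<subseteq> P' \<longrightarrow> P' = P)}"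

definition Mbar where
  "Mbar X = Rpf X \<union>
     {(P, F). P = {} \<and> IF X F \<and> (\<forall>R. (R, F) \<notin> Rpf X)} \<union>
     {(P, F). F = {} \<and> IP X P \<and> (\<forall>R. (P, R) \<notin> Rpf X)}"

definition Phi where "Phi X p = (Ipast X p, Ifut X p)"

definition lim_past where
  "lim_past X Q P \<longleftrightarrow> (\<forall>x\<in>Q. eventually (\<lambda>n. x \<in> P n) sequentially) \<and>
     (\<forall>x. \<not> Ipast X x \<subseteq> Q \<longrightarrow> eventually (\<lambda>n. \<not> Ipast X x \<subseteq> P n) sequentially)"

definition lim_fut where
  "lim_fut X Q P \<longleftrightarrow> (\<forall>x\<in>Q. eventually (\<lambda>n. x \<in> P n) sequentially) \<and>
     (\<forall>x. \<not> Ifut X x \<subseteq> Q \<longrightarrow> eventually (\<lambda>n. \<not> Ifut X x \<subseteq> P n) sequentially)"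

definition L_IF where
  "L_IF X S = {Q \<in> Mbar X. snd Q \<noteq> {} \<and> snd Q \<subseteq> (\<Union>R\<in>S. snd R)}"
definition L_IP where
  "L_IP X S = {Q \<in> Mbar X. fst Q \<noteq> {} \<and> fst Q \<subseteq> (\<Union>R\<in>S. fst R)}"

definition Cl_plus where
  "Cl_plus X S = S \<union> {Q \<in> Mbar X. fst Q \<noteq> {} \<and>
     (\<exists>R. (\<forall>n. R n \<in> S) \<and> lim_past X (fst Q) (\<lambda>n. fst (R n)))}"
definition Cl_minus where
  "Cl_minus X S = S \<union> {Q \<in> Mbar X. snd Q \<noteq> {} \<and>
     (\<exists>R. (\<forall>n. R n \<in> S) \<and> lim_fut X (snd Q) (\<lambda>n. snd (R n)))}"

definition L_plus_alt where "L_plus_alt X S = Cl_plus X (L_IF X S)"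
definition L_minus_alt where "L_minus_alt X S = Cl_minus X (L_IP X S)"
definition L_alt where
  "L_alt X S1 S2 = Cl_plus X (L_IP X S1 \<inter> L_IF X S2) \<union> Cl_minus X (L_IP X S1 \<inter> L_IF X S2)"

definition T_alt where
  "T_alt X = topology_generated_by
     ({Mbar X - L_plus_alt X S | S. S \<subseteq> Mbar X} \<union>
      {Mbar X - L_minus_alt X S | S. S \<subseteq> Mbar X} \<union>
      {Mbar X - L_alt X S1 S2 | S1 S2. S1 \<subseteq> Mbar X \<and> S2 \<subseteq> Mbar X})"

end

theory Submission
  imports Defs
begin

text \<open>
  The topology is generated by complements of closed sets, so it suffices to show: if the images of
  arbitrarily late points of the curve lie in one of these closed sets, so does the endpoint. For
  the closures with respect to past-sets this is a diagonal argument, because the pasts of points on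
  the curve increase to their union. For the closures with respect to future-sets the point is that
  convergence of the future components of a sequence of pairs to the future of a point p forces the
  past components to cover the past of p: otherwise, in a small causally convex neighbourhood,
  maximality of the future components produces points on its boundary which cluster at some z, and
  z lies almost on a closed causal curve through p.

  The only facts from Lorentzian geometry used are openness of chronological futures and two
  consequences of a local push-forward along a timelike direction: causal curves do not lose
  chronological futures, and limits of points in the past of r are locally below r.
\<close>

section \<open>Lorentzian forms\<close>

text \<open>The data are asymmetric: the past component of the endpoint is prescribed, while its
  future component may be anything \<open>Mbar\<close> permits, the empty set included. Limits of
  future components can therefore not be carried over to the endpoint. What can be carried over is
  an inclusion of pasts, since it survives the union over the curve; hence closures with respect to
  future-sets are translated, at each point of the curve, into covers of the past of that point.
  This translation is not formal. The two components of a pair are linked only by mutual maximality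
  in \<open>Rpf\<close>, which concerns single pairs and says nothing about limits. For
  \<open>L_alt\<close> the translation does more: if the image of a point lies in the future
  closure, it already lies in the set being closed, so the past closure alone decides. The past
  closure adds limits of sequences only once, so that its stability along the curve needs an
  argument; it rests on a countable dense set of test points.\<close>

lemma lorentz_cauchy_schwarz:
  assumes bl: "bilinear B" and sym: "\<And>u v. B u v = B v u"
    and pos: "\<And>w. w \<noteq> 0 \<Longrightarrow> B e w = 0 \<Longrightarrow> B w w > (0::real)"
    and w: "B e w = 0" and w': "B e w' = 0"
  shows "(B w w')\<^sup>2 \<le> B w w * B w' w'"
proof (cases "w' = 0")
  case True
  then show ?thesis using bl by (simp add: bilinear_rzero)
next
  case False
  then have p: "B w' w' > 0" using pos w' by simp
  \<comment> \<open>The part of \<open>w\<close> orthogonal to \<open>w'\<close>, multiplied by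
    \<open>B w' w'\<close> to avoid a division; positivity of its square is the Gram determinant
    inequality.\<close>
  define z where "z = B w' w' *\<^sub>R w - B w w' *\<^sub>R w'"
  have ez: "B e z = 0"
    unfolding z_def using w w' bl by (simp add: bilinear_rsub bilinear_rmul)
  have "B z z \<ge> 0" using pos[of z] ez bl by (cases "z = 0") (auto simp: bilinear_rzero)
  moreover have "B z z = B w' w' * (B w w * B w' w' - (B w w')\<^sup>2)"
    unfolding z_def using bl sym[of w' w]
    by (simp add: bilinear_rsub bilinear_rmul bilinear_lsub bilinear_lmul algebra_simps power2_eq_square)
  ultimately show ?thesis using p by (simp add: zero_le_mult_iff)
qed

text \<open>Both vectors are split into a multiple of \<open>e\<close> and a part orthogonal to it.
  Cauchy-Schwarz bounds the product of the orthogonal parts strictly by the product of the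
  \<open>e\<close>-parts, so the latter fixes the sign of \<open>B u v\<close>. The product form
  compares time cones without declaring either half of the cone of \<open>e\<close> to be the
  future.\<close>

lemma lorentz_product_sign:
  assumes bl: "bilinear B" and sym: "\<And>u v. B u v = B v u" and e: "B e e < (0::real)"
    and pos: "\<And>w. w \<noteq> 0 \<Longrightarrow> B e w = 0 \<Longrightarrow> B w w > 0"
    and u: "B u u < 0" and v: "B v v \<le> 0" "v \<noteq> 0"
  shows "B u v * (B u e * B v e) < 0"
proof -
  define E a b where "E = - B e e" and "a = B u e" and "b = B v e"
  \<comment> \<open>The projections orthogonal to \<open>e\<close>; the sign is a plus because
    \<open>B e e = - E\<close>.\<close>
  define wu wv where "wu = u + (a / E) *\<^sub>R e" and "wv = v + (b / E) *\<^sub>R e"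
  have E: "E > 0" "B e e = - E" using e by (auto simp: E_def)
  have exp: "B (x + s *\<^sub>R e) (y + t *\<^sub>R e) = B x y + t * B x e + s * B y e - s * t * E" for x y s t
    using bl E(2) sym[of e y]
    by (simp add: bilinear_radd bilinear_rmul bilinear_ladd bilinear_lmul algebra_simps)
  have uu: "B wu wu = B u u + a\<^sup>2 / E" and vv: "B wv wv = B v v + b\<^sup>2 / E"
    and uv: "B wu wv = B u v + a * b / E"
    unfolding wu_def wv_def exp using E by (auto simp: a_def b_def field_simps power2_eq_square)
  have eu: "B e wu = 0" and ev: "B e wv = 0"
    unfolding wu_def wv_def using bl E sym[of e u] sym[of e v]
    by (auto simp: bilinear_radd bilinear_rmul a_def b_def)
  have nonneg: "B wu wu \<ge> 0" using pos[OF _ eu] bl by (cases "wu = 0") (auto simp: bilinear_rzero)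
  have b: "b \<noteq> 0"
  proof
    assume "b = 0"
    then have "B v v > 0" using ev v by (intro pos) (auto simp: wv_def)
    then show False using v by simp
  qed
  have a: "a\<^sup>2 / E > 0" using uu nonneg u by simp
  then have a0: "a \<noteq> 0" by auto
  have "(B wu wv)\<^sup>2 \<le> B wu wu * B wv wv"
    by (rule lorentz_cauchy_schwarz[OF bl sym pos eu ev])
  also have "\<dots> \<le> B wu wu * (b\<^sup>2 / E)" using nonneg vv v by (intro mult_left_mono) auto
  also have "\<dots> < (a\<^sup>2 / E) * (b\<^sup>2 / E)" using uu u b E by (intro mult_strict_right_mono) auto
  also have "\<dots> = (\<bar>a * b\<bar> / E)\<^sup>2" by (simp add: power2_eq_square)
  finally have "\<bar>B wu wv\<bar> < \<bar>\<bar>a * b\<bar> / E\<bar>" by (simp add: power2_less_imp_less abs_square_less_1 power2_strict_mono abs_le_square_iff[symmetric] not_le[symmetric])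
  then have lt: "\<bar>B wu wv\<bar> < \<bar>a * b\<bar> / E" using E by simp
  have "B wu wv * (a * b) \<le> \<bar>B wu wv\<bar> * \<bar>a * b\<bar>" by (metis abs_ge_self abs_mult)
  also have "\<dots> < \<bar>a * b\<bar> / E * \<bar>a * b\<bar>" using lt a0 b by (intro mult_strict_right_mono) auto
  finally have "B wu wv * (a * b) < (a * b) * (a * b) / E" by simp
  then show ?thesis unfolding a_def[symmetric] b_def[symmetric] using uv by (simp add: algebra_simps)
qed

lemma lorentz_causal_timelike_nonzero:
  assumes "lorentzian_form B" "B t t < 0" "B v v \<le> 0" "v \<noteq> 0"
  shows "B v t \<noteq> 0"
proof -
  from assms(1) obtain e where "bilinear B" "\<And>u v. B u v = B v u" "B e e < 0"
    "\<And>w. w \<noteq> 0 \<Longrightarrow> B e w = 0 \<Longrightarrow> B w w > 0"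
    by (auto simp: lorentzian_form_def)
  from lorentz_product_sign[OF this assms(2-4)] \<open>\<And>u v. B u v = B v u\<close>[of t v] show ?thesis by auto
qed

text \<open>The witness \<open>e\<close> of the signature need not be future-directed. It serves as
  an intermediary: comparing \<open>u\<close> and \<open>v\<close> with \<open>t\<close> shows that
  their products with \<open>e\<close> have equal signs, and this fixes the sign of
  \<open>B v u\<close>.\<close>

lemma lorentz_same_cone:
  assumes B: "lorentzian_form B" and t: "B t t < 0" and u: "B u u < 0" and v: "B v v \<le> 0" "v \<noteq> 0"
    and ut: "B u t < 0" and vt: "B v t < 0"
  shows "B v u < 0"
proof -
  from B obtain e where bl: "bilinear B" and sym: "\<And>u v. B u v = B v u" and e: "B e e < 0"
    and pos: "\<And>w. w \<noteq> 0 \<Longrightarrow> B e w = 0 \<Longrightarrow> B w w > 0"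
    by (auto simp: lorentzian_form_def)
  have sgn: "B u v * (B u e * B v e) < 0" if "B u u < 0" "B v v \<le> 0" "v \<noteq> 0" for u v
    by (rule lorentz_product_sign[OF bl sym e _ that]) (rule pos)
  have u0: "u \<noteq> 0" using u bl by (auto simp: bilinear_rzero)
  have "B t e * B u e > 0" using sgn[OF t _ u0] u ut sym[of t u] by (auto simp: mult_less_0_iff)
  moreover have "B t e * B v e > 0" using sgn[OF t v] vt sym[of t v] by (auto simp: mult_less_0_iff)
  ultimately have "B u e * B v e > 0" by (auto simp: zero_less_mult_iff)
  then show ?thesis using sgn[OF u v] sym[of v u] by (smt (verit) mult_nonneg_nonneg)
qed

section \<open>Curves in a chart\<close>

text \<open>One window of \<open>fd_curve\<close>, with the one-sided conditions referring to
  neighbours in \<open>J\<close> itself instead of the whole parameter interval. In this form the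
  condition can be restricted, glued and mapped without regard to the rest of the curve.\<close>

definition piece :: "('v \<Rightarrow> 'v \<Rightarrow> bool) \<Rightarrow> ('a, 'v::euclidean_space) chart \<Rightarrow> (real \<Rightarrow> 'a) \<Rightarrow> real set \<Rightarrow> bool" where
  "piece Q c \<gamma> J \<longleftrightarrow> \<gamma> ` J \<subseteq> fst c \<and> (snd c \<circ> \<gamma>) piecewise_C1_differentiable_on J \<and>
     (\<forall>s\<in>J. ((\<exists>s'\<in>J. s < s') \<longrightarrow>
              (\<exists>v. ((snd c \<circ> \<gamma>) has_vector_derivative v) (at s within (J \<inter> {s..})) \<and> Q (snd c (\<gamma> s)) v)) \<and>
            ((\<exists>s'\<in>J. s' < s) \<longrightarrow>
              (\<exists>v. ((snd c \<circ> \<gamma>) has_vector_derivative v) (at s within (J \<inter> {..s})) \<and> Q (snd c (\<gamma> s)) v)))"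

lemma piece_subset:
  assumes "piece Q c \<gamma> J" "J' \<subseteq> J"
  shows "piece Q c \<gamma> J'"
  unfolding piece_def
proof (intro conjI ballI impI)
  show "\<gamma> ` J' \<subseteq> fst c" using assms by (auto simp: piece_def)
  show "(snd c \<circ> \<gamma>) piecewise_C1_differentiable_on J'"
    using assms piecewise_C1_differentiable_on_subset by (auto simp: piece_def)
next
  fix s assume "s \<in> J'" "\<exists>s'\<in>J'. s < s'"
  then obtain v where "((snd c \<circ> \<gamma>) has_vector_derivative v) (at s within (J \<inter> {s..}))" "Q (snd c (\<gamma> s)) v"
    using assms unfolding piece_def by blast
  then show "\<exists>v. ((snd c \<circ> \<gamma>) has_vector_derivative v) (at s within (J' \<inter> {s..})) \<and> Q (snd c (\<gamma> s)) v"
    using assms(2) by (meson Int_mono has_vector_derivative_within_subset order_refl)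
next
  fix s assume "s \<in> J'" "\<exists>s'\<in>J'. s' < s"
  then obtain v where "((snd c \<circ> \<gamma>) has_vector_derivative v) (at s within (J \<inter> {..s}))" "Q (snd c (\<gamma> s)) v"
    using assms unfolding piece_def by blast
  then show "\<exists>v. ((snd c \<circ> \<gamma>) has_vector_derivative v) (at s within (J' \<inter> {..s})) \<and> Q (snd c (\<gamma> s)) v"
    using assms(2) by (meson Int_mono has_vector_derivative_within_subset order_refl)
qed

lemma piece_left_derivative:
  assumes "piece Q c \<gamma> J" "s \<in> J" "s' \<in> J" "s' < s"
  shows "\<exists>v. ((snd c \<circ> \<gamma>) has_vector_derivative v) (at s within (J \<inter> {..s})) \<and> Q (snd c (\<gamma> s)) v"
  using assms unfolding piece_def by blast

text \<open>At an edge of the window that is not an end of the whole interval, the one-sided derivative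
  required by fd_curve is taken within a singleton, so only the existence of an admissible vector is
  at stake; the derivative from the other side provides it.\<close>
lemma fd_curve_iff_piece:
  "fd_curve X Q \<gamma> I \<longleftrightarrow> is_interval I \<and> (\<exists>a\<in>I. \<exists>b\<in>I. a < b) \<and> continuous_on I \<gamma> \<and>
     (\<forall>t\<in>I. \<exists>c\<in>atlas X. \<exists>\<epsilon>>0. piece (Q c) c \<gamma> (I \<inter> {t-\<epsilon>..t+\<epsilon>}))"
  (is "?L \<longleftrightarrow> ?R")
proof
  assume ?L
  show ?R
  proof (intro conjI ballI)
    fix t assume "t \<in> I"
    then obtain c \<epsilon> where c: "c \<in> atlas X" "\<epsilon> > 0"
      and *: "\<gamma> ` (I \<inter> {t-\<epsilon>..t+\<epsilon>}) \<subseteq> fst c"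
        "(snd c \<circ> \<gamma>) piecewise_C1_differentiable_on (I \<inter> {t-\<epsilon>..t+\<epsilon>})"
      and r: "\<And>s. s \<in> I \<inter> {t-\<epsilon>..t+\<epsilon>} \<Longrightarrow> \<exists>s'\<in>I. s < s' \<Longrightarrow>
              (\<exists>v. ((snd c \<circ> \<gamma>) has_vector_derivative v) (at s within (I \<inter> {t-\<epsilon>..t+\<epsilon>} \<inter> {s..}))
                   \<and> Q c (snd c (\<gamma> s)) v)"
      and l: "\<And>s. s \<in> I \<inter> {t-\<epsilon>..t+\<epsilon>} \<Longrightarrow> \<exists>s'\<in>I. s' < s \<Longrightarrow>
              (\<exists>v. ((snd c \<circ> \<gamma>) has_vector_derivative v) (at s within (I \<inter> {t-\<epsilon>..t+\<epsilon>} \<inter> {..s}))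
                   \<and> Q c (snd c (\<gamma> s)) v)"
      using \<open>?L\<close> unfolding fd_curve_def by (elim conjE ballE[of _ _ t]) auto
    have "piece (Q c) c \<gamma> (I \<inter> {t-\<epsilon>..t+\<epsilon>})"
      unfolding piece_def using * by (intro conjI ballI impI l r) auto
    with c show "\<exists>c\<in>atlas X. \<exists>\<epsilon>>0. piece (Q c) c \<gamma> (I \<inter> {t-\<epsilon>..t+\<epsilon>})" by blast
  qed (use \<open>?L\<close> in \<open>auto simp: fd_curve_def\<close>)
next
  assume R: ?R
  then have int: "is_interval I" and ne: "\<exists>a\<in>I. \<exists>b\<in>I. a < b" by auto
  show ?L unfolding fd_curve_def
  proof (intro conjI ballI)
    fix t assume t: "t \<in> I"
    with R obtain c \<epsilon> where c: "c \<in> atlas X" "\<epsilon> > 0" "piece (Q c) c \<gamma> (I \<inter> {t-\<epsilon>..t+\<epsilon>})" by blast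
    define J where "J = I \<inter> {t-\<epsilon>..t+\<epsilon>}"
    have P: "piece (Q c) c \<gamma> J" using c by (simp add: J_def)
    \<comment> \<open>A second parameter, clamped to the window. It guarantees that each point of
      the window has a neighbour on at least one side, from which an admissible vector can be
      borrowed.\<close>
    obtain t' where t': "t' \<in> J" "t' \<noteq> t"
    proof -
      from ne obtain r where r: "r \<in> I" "r \<noteq> t" by (metis less_irrefl)
      define t' where "t' = (if r < t then max r (t - \<epsilon>) else min r (t + \<epsilon>))"
      have "t' \<in> I" using int t r unfolding is_interval_1 t'_def
        by (smt (verit) c(2) max_def min_def)
      then show ?thesis using that[of t'] r c(2) by (auto simp: J_def t'_def split: if_splits)
    qed
    have tJ: "t \<in> J" using t c(2) by (simp add: J_def)
    have two: "(\<exists>s'\<in>J. s < s') \<or> (\<exists>s'\<in>J. s' < s)" for s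
      using t' tJ by (metis linorder_neqE_linordered_idom)
    have ex: "\<exists>v. Q c (snd c (\<gamma> s)) v" if "s \<in> J" for s
      using P two[of s] that unfolding piece_def by blast
    have triv: "((snd c \<circ> \<gamma>) has_vector_derivative v) (at s within K)" if "K \<subseteq> {s}" for s v K
    proof -
      have "at s within K = bot" using that
        by (metis Diff_eq_empty_iff at_within_empty at_within_def Diff_insert_absorb insert_absorb subset_singletonD empty_Diff Diff_cancel)
      then show ?thesis by (simp add: has_vector_derivative_def has_derivative_def bounded_linear_scaleR_left)
    qed
    have right: "\<exists>v. ((snd c \<circ> \<gamma>) has_vector_derivative v) (at s within (J \<inter> {s..})) \<and> Q c (snd c (\<gamma> s)) v"
      if "s \<in> J" for s
    proof (cases "\<exists>s'\<in>J. s < s'")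
      case True then show ?thesis using P that unfolding piece_def by blast
    next
      case False
      then have "J \<inter> {s..} \<subseteq> {s}" by force
      then show ?thesis using ex[OF that] triv by blast
    qed
    have left: "\<exists>v. ((snd c \<circ> \<gamma>) has_vector_derivative v) (at s within (J \<inter> {..s})) \<and> Q c (snd c (\<gamma> s)) v"
      if "s \<in> J" for s
    proof (cases "\<exists>s'\<in>J. s' < s")
      case True then show ?thesis using P that unfolding piece_def by blast
    next
      case False
      then have "J \<inter> {..s} \<subseteq> {s}" by force
      then show ?thesis using ex[OF that] triv by blast
    qed
    show "\<exists>c\<in>atlas X. \<exists>\<epsilon>>0.
        \<gamma> ` (I \<inter> {t-\<epsilon>..t+\<epsilon>}) \<subseteq> fst c \<and>
        (snd c \<circ> \<gamma>) piecewise_C1_differentiable_on (I \<inter> {t-\<epsilon>..t+\<epsilon>}) \<and>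
        (\<forall>s\<in>I \<inter> {t-\<epsilon>..t+\<epsilon>}.
           ((\<exists>s'\<in>I. s < s') \<longrightarrow>
              (\<exists>v. ((snd c \<circ> \<gamma>) has_vector_derivative v) (at s within (I \<inter> {t-\<epsilon>..t+\<epsilon>} \<inter> {s..}))
                   \<and> Q c (snd c (\<gamma> s)) v)) \<and>
           ((\<exists>s'\<in>I. s' < s) \<longrightarrow>
              (\<exists>v. ((snd c \<circ> \<gamma>) has_vector_derivative v) (at s within (I \<inter> {t-\<epsilon>..t+\<epsilon>} \<inter> {..s}))
                   \<and> Q c (snd c (\<gamma> s)) v)))"
      using c(1,2) P left right unfolding J_def piece_def
      by (intro bexI[of _ c] exI[of _ \<epsilon>] conjI ballI impI) auto
  qed (use R in auto)
qed

text \<open>Agreement on a closed interval says nothing about two-sided derivatives at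
  \<open>l\<close> and \<open>r\<close>, so the two end points are moved into the finite exceptional
  set.\<close>

lemma piecewise_C1_cong_closed:
  fixes f g :: "real \<Rightarrow> 'b::real_normed_vector"
  assumes f: "f piecewise_C1_differentiable_on {l..r}" and eq: "\<And>x. x \<in> {l..r} \<Longrightarrow> g x = f x"
  shows "g piecewise_C1_differentiable_on {l..r}"
proof -
  from f obtain S where S: "finite S" "f C1_differentiable_on ({l..r} - S)" and cf: "continuous_on {l..r} f"
    by (auto simp: piecewise_C1_differentiable_on_def)
  from S(2) obtain D where D: "\<And>x. x \<in> {l..r} - S \<Longrightarrow> (f has_vector_derivative D x) (at x)"
    and cD: "continuous_on ({l..r} - S) D"
    unfolding C1_differentiable_on_def by blast
  have "(g has_vector_derivative D x) (at x)" if "x \<in> {l..r} - (S \<union> {l, r})" for x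
    by (rule has_vector_derivative_transform_within_open[OF D[of x], of "{l<..<r}"]) (use that eq in auto)
  moreover have "continuous_on ({l..r} - (S \<union> {l, r})) D" by (rule continuous_on_subset[OF cD]) auto
  ultimately have "g C1_differentiable_on ({l..r} - (S \<union> {l, r}))"
    unfolding C1_differentiable_on_def by blast
  moreover have "continuous_on {l..r} g" by (rule continuous_on_eq[OF cf]) (simp add: eq)
  ultimately show ?thesis using S(1) unfolding piecewise_C1_differentiable_on_def
    by (intro conjI exI[of _ "S \<union> {l, r}"]) auto
qed

lemma piece_cong:
  assumes P: "piece Q c \<gamma> {l..r}" and eq: "\<And>x. x \<in> {l..r} \<Longrightarrow> \<gamma>' x = \<gamma> x"
  shows "piece Q c \<gamma>' {l..r}"
proof -
  have pc: "(snd c \<circ> \<gamma>') piecewise_C1_differentiable_on {l..r}"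
    by (rule piecewise_C1_cong_closed[of "snd c \<circ> \<gamma>"]) (use P eq in \<open>auto simp: piece_def\<close>)
  have T: "((snd c \<circ> \<gamma>') has_vector_derivative v) (at s within K)"
    if "((snd c \<circ> \<gamma>) has_vector_derivative v) (at s within K)" "s \<in> K" "K \<subseteq> {l..r}" for s K v
    by (rule has_vector_derivative_transform[OF _ _ that(1)]) (use that eq in auto)
  then have R: "((snd c \<circ> \<gamma>') has_vector_derivative v) (at s within ({l..r} \<inter> {s..}))"
    if "((snd c \<circ> \<gamma>) has_vector_derivative v) (at s within ({l..r} \<inter> {s..}))" "s \<in> {l..r}" for s v
    using that by auto
  have L: "((snd c \<circ> \<gamma>') has_vector_derivative v) (at s within ({l..r} \<inter> {..s}))"
    if "((snd c \<circ> \<gamma>) has_vector_derivative v) (at s within ({l..r} \<inter> {..s}))" "s \<in> {l..r}" for s v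
    using T[OF that(1)] that by auto
  have "\<gamma>' ` {l..r} \<subseteq> fst c" using P eq by (auto simp: piece_def)
  with pc show ?thesis using P R L eq unfolding piece_def
    by (intro conjI ballI impI) (metis, metis, metis, metis)
qed

text \<open>A corner is possible at \<open>b\<close>, which therefore becomes exceptional. What
  remains falls into two relatively open sides, and continuity of the derivative can be checked on
  each side separately.\<close>

lemma piecewise_C1_join:
  fixes f :: "real \<Rightarrow> 'b::real_normed_vector"
  assumes 1: "f piecewise_C1_differentiable_on {l..b}" and 2: "f piecewise_C1_differentiable_on {b..r}"
    and lr: "l \<le> b" "b \<le> r"
  shows "f piecewise_C1_differentiable_on {l..r}"
proof -
  from 1 obtain S where S: "finite S" "f C1_differentiable_on ({l..b} - S)" and c1: "continuous_on {l..b} f"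
    by (auto simp: piecewise_C1_differentiable_on_def)
  from 2 obtain T where T: "finite T" "f C1_differentiable_on ({b..r} - T)" and c2: "continuous_on {b..r} f"
    by (auto simp: piecewise_C1_differentiable_on_def)
  define A B where "A = {l..<b} - (S \<union> T)" and "B = {b<..r} - (S \<union> T)"
  have AB: "{l..r} - (S \<union> T \<union> {b}) = A \<union> B" using lr by (auto simp: A_def B_def)
  have fA: "f C1_differentiable_on A" by (rule C1_differentiable_on_subset[OF S(2)]) (auto simp: A_def)
  have fB: "f C1_differentiable_on B" by (rule C1_differentiable_on_subset[OF T(2)]) (auto simp: B_def)
  have oA: "openin (top_of_set (A \<union> B)) A"
    unfolding openin_open by (intro exI[of _ "{..<b}"]) (auto simp: A_def B_def)
  have oB: "openin (top_of_set (A \<union> B)) B"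
    unfolding openin_open by (intro exI[of _ "{b<..}"]) (auto simp: A_def B_def)
  have "continuous_on (A \<union> B) (\<lambda>x. vector_derivative f (at x))"
    by (rule continuous_on_Un_local_open[OF oA oB]) (use fA fB in \<open>auto simp: C1_differentiable_on_eq\<close>)
  then have "f C1_differentiable_on ({l..r} - (S \<union> T \<union> {b}))"
    unfolding AB using fA fB by (auto simp: C1_differentiable_on_eq)
  moreover have "continuous_on {l..r} f"
    using continuous_on_closed_Un[of "{l..b}" "{b..r}" f] c1 c2 lr by (simp add: ivl_disj_un_two_touch)
  ultimately show ?thesis using S T unfolding piecewise_C1_differentiable_on_def
    by (intro conjI exI[of _ "S \<union> T \<union> {b}"]) auto
qed

text \<open>The corner at \<open>b\<close> is harmless because only one-sided derivatives are asked
  for: at \<open>b\<close> the left one comes from the first piece and the right one from the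
  second. Elsewhere the other piece does not affect the filter.\<close>

lemma piece_join:
  assumes 1: "piece Q c \<gamma> {l..b}" and 2: "piece Q c \<gamma> {b..r}" and lr: "l < b" "b < r"
  shows "piece Q c \<gamma> {l..r}"
proof -
  have right1: "at s within ({l..r} \<inter> {s..}) = at s within ({l..b} \<inter> {s..})" if "l \<le> s" "s < b" for s
    by (rule at_within_nhd[of _ "{..<b}"]) (use that lr in auto)
  have right2: "{l..r} \<inter> {s..} = {b..r} \<inter> {s..}" if "b \<le> s" for s using that lr by auto
  have left1: "{l..r} \<inter> {..s} = {l..b} \<inter> {..s}" if "s \<le> b" for s using that lr by auto
  have left2: "at s within ({l..r} \<inter> {..s}) = at s within ({b..r} \<inter> {..s})" if "s \<le> r" "b < s" for s
    by (rule at_within_nhd[of _ "{b<..}"]) (use that lr in auto)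
  show ?thesis unfolding piece_def
  proof (intro conjI ballI impI)
    show "\<gamma> ` {l..r} \<subseteq> fst c" using 1 2 unfolding piece_def image_subset_iff
      by (metis atLeastAtMost_iff linorder_le_cases)
    show "(snd c \<circ> \<gamma>) piecewise_C1_differentiable_on {l..r}"
      using 1 2 lr by (auto simp: piece_def intro: piecewise_C1_join)
  next
    fix s assume s: "s \<in> {l..r}" "\<exists>s'\<in>{l..r}. s < s'"
    show "\<exists>v. ((snd c \<circ> \<gamma>) has_vector_derivative v) (at s within ({l..r} \<inter> {s..})) \<and> Q (snd c (\<gamma> s)) v"
    proof (cases "s < b")
      case True then show ?thesis using right1[of s] s 1 lr unfolding piece_def
        by (metis atLeastAtMost_iff less_eq_real_def)
    next
      case False
      then have "s \<in> {b..r}" "\<exists>s'\<in>{b..r}. s < s'" using s by auto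
      then show ?thesis using right2[of s] 2 False unfolding piece_def by (metis not_le)
    qed
  next
    fix s assume s: "s \<in> {l..r}" "\<exists>s'\<in>{l..r}. s' < s"
    show "\<exists>v. ((snd c \<circ> \<gamma>) has_vector_derivative v) (at s within ({l..r} \<inter> {..s})) \<and> Q (snd c (\<gamma> s)) v"
    proof (cases "s > b")
      case True then show ?thesis using left2[of s] s 2 lr unfolding piece_def
        by (metis atLeastAtMost_iff less_eq_real_def)
    next
      case False
      then have "s \<in> {l..b}" "\<exists>s'\<in>{l..b}. s' < s" using s by auto
      then show ?thesis using left1[of s] 1 False unfolding piece_def by (metis not_le)
    qed
  qed
qed

text \<open>Serves two purposes: with a transition map for \<open>\<Psi>\<close> it changes charts,
  and with the displacement constructed below it turns causal pieces into timelike ones.\<close>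

lemma piece_map:
  fixes \<Psi> :: "'v::euclidean_space \<Rightarrow> 'v"
  assumes P: "piece Q c \<gamma> {l..r}"
    and im: "\<And>s. s \<in> {l..r} \<Longrightarrow> snd c (\<gamma> s) \<in> U"
    and D: "\<And>x. x \<in> U \<Longrightarrow> (\<Psi> has_derivative \<Psi>' x) (at x)"
    and cont: "\<And>v. v \<in> Basis \<Longrightarrow> continuous_on U (\<lambda>x. \<Psi>' x v)"
    and dom: "\<And>s. s \<in> {l..r} \<Longrightarrow> \<gamma>' s \<in> fst c'"
    and eq: "\<And>s. s \<in> {l..r} \<Longrightarrow> snd c' (\<gamma>' s) = \<Psi> (snd c (\<gamma> s))"
    and Q: "\<And>s v. s \<in> {l..r} \<Longrightarrow> Q (snd c (\<gamma> s)) v \<Longrightarrow> Q' (\<Psi> (snd c (\<gamma> s))) (\<Psi>' (snd c (\<gamma> s)) v)"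
  shows "piece Q' c' \<gamma>' {l..r}"
proof -
  define f where "f = snd c \<circ> \<gamma>"
  have fU: "f s \<in> U" if "s \<in> {l..r}" for s using im that by (simp add: f_def)
  have chain: "((snd c' \<circ> \<gamma>') has_vector_derivative \<Psi>' (f s) v) (at s within K)"
    if "(f has_vector_derivative v) (at s within K)" "s \<in> K" "K \<subseteq> {l..r}" for s v K
  proof -
    have "((\<Psi> \<circ> f) has_vector_derivative \<Psi>' (f s) v) (at s within K)"
      using vector_derivative_diff_chain_within[OF that(1) has_derivative_at_withinI[OF D[OF fU]]] that by blast
    then show ?thesis
      by (rule has_vector_derivative_transform[rotated 2]) (use that eq in \<open>auto simp: f_def\<close>)
  qed
  have pf: "f piecewise_C1_differentiable_on {l..r}" using P by (simp add: piece_def f_def)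
  then obtain S where S: "finite S" "f C1_differentiable_on ({l..r} - S)" and cf: "continuous_on {l..r} f"
    by (auto simp: piecewise_C1_differentiable_on_def)
  from S(2) obtain d where d: "\<And>x. x \<in> {l..r} - S \<Longrightarrow> (f has_vector_derivative d x) (at x)"
    and cd: "continuous_on ({l..r} - S) d"
    unfolding C1_differentiable_on_def by blast
  \<comment> \<open>Continuity of the derivative is available in basis directions only; linearity
    extends it to the moving direction \<open>d s\<close>.\<close>
  have lin: "\<Psi>' x v = (\<Sum>b\<in>Basis. (v \<bullet> b) *\<^sub>R \<Psi>' x b)" if "x \<in> U" for x v
  proof -
    have "linear (\<Psi>' x)" using D[OF that] by (simp add: has_derivative_linear)
    then have "\<Psi>' x (\<Sum>b\<in>Basis. (v \<bullet> b) *\<^sub>R b) = (\<Sum>b\<in>Basis. (v \<bullet> b) *\<^sub>R \<Psi>' x b)"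
      by (simp add: linear_sum linear_scale)
    then show ?thesis by (simp add: euclidean_representation)
  qed
  have "continuous_on ({l..r} - S) (\<lambda>s. \<Sum>b\<in>Basis. (d s \<bullet> b) *\<^sub>R \<Psi>' (f s) b)"
    by (intro continuous_intros cd continuous_on_compose2[OF cont])
       (use fU in \<open>auto intro: continuous_on_subset[OF cf]\<close>)
  then have "continuous_on ({l..r} - S) (\<lambda>s. \<Psi>' (f s) (d s))"
    by (rule continuous_on_eq) (use lin fU in auto)
  moreover have "((\<Psi> \<circ> f) has_vector_derivative \<Psi>' (f s) (d s)) (at s)" if "s \<in> {l..r} - S" for s
    using vector_derivative_diff_chain_within[OF d[OF that], of \<Psi> "\<Psi>' (f s)"] D[OF fU[of s]] that
    by (auto intro: has_derivative_at_withinI)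
  ultimately have "(\<Psi> \<circ> f) C1_differentiable_on ({l..r} - S)"
    unfolding C1_differentiable_on_def by (intro exI[of _ "\<lambda>s. \<Psi>' (f s) (d s)"]) auto
  moreover have "continuous_on {l..r} (\<Psi> \<circ> f)"
  proof -
    have "continuous_on U \<Psi>" using D by (meson has_derivative_continuous continuous_at_imp_continuous_on)
    then show ?thesis
      by (intro continuous_on_compose cf) (rule continuous_on_subset, use fU in auto)
  qed
  ultimately have "(\<Psi> \<circ> f) piecewise_C1_differentiable_on {l..r}"
    using S(1) by (auto simp: piecewise_C1_differentiable_on_def)
  then have pc: "(snd c' \<circ> \<gamma>') piecewise_C1_differentiable_on {l..r}"
    by (rule piecewise_C1_cong_closed) (use eq in \<open>auto simp: f_def\<close>)
  show ?thesis unfolding piece_def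
  proof (intro conjI ballI impI)
    fix s assume s: "s \<in> {l..r}" "\<exists>s'\<in>{l..r}. s < s'"
    then obtain v where v: "(f has_vector_derivative v) (at s within ({l..r} \<inter> {s..}))" "Q (snd c (\<gamma> s)) v"
      using P unfolding piece_def f_def by blast
    have "((snd c' \<circ> \<gamma>') has_vector_derivative \<Psi>' (f s) v) (at s within ({l..r} \<inter> {s..}))"
      by (rule chain[OF v(1)]) (use s in auto)
    then show "\<exists>v. ((snd c' \<circ> \<gamma>') has_vector_derivative v) (at s within ({l..r} \<inter> {s..})) \<and> Q' (snd c' (\<gamma>' s)) v"
      using Q[OF s(1) v(2)] eq[OF s(1)] by (auto simp: f_def)
  next
    fix s assume s: "s \<in> {l..r}" "\<exists>s'\<in>{l..r}. s' < s"
    then obtain v where v: "(f has_vector_derivative v) (at s within ({l..r} \<inter> {..s}))" "Q (snd c (\<gamma> s)) v"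
      using P unfolding piece_def f_def by blast
    have "((snd c' \<circ> \<gamma>') has_vector_derivative \<Psi>' (f s) v) (at s within ({l..r} \<inter> {..s}))"
      by (rule chain[OF v(1)]) (use s in auto)
    then show "\<exists>v. ((snd c' \<circ> \<gamma>') has_vector_derivative v) (at s within ({l..r} \<inter> {..s})) \<and> Q' (snd c' (\<gamma>' s)) v"
      using Q[OF s(1) v(2)] eq[OF s(1)] by (auto simp: f_def)
  qed (use dom pc in auto)
qed

text \<open>Translation and reversal are treated together. For \<open>m = -1\<close> right
  derivatives of the new curve are left derivatives of the old one with the opposite sign, which is
  why the tangent condition is transported by \<open>m *\<^sub>R v\<close>.\<close>

lemma piece_reparam:
  fixes m k :: real
  assumes P: "piece Q c \<gamma> J" and m: "m = 1 \<or> m = -1"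
    and Q: "\<And>x v. x \<in> snd c ` fst c \<Longrightarrow> Q x v \<Longrightarrow> Q' x (m *\<^sub>R v)"
  shows "piece Q' c (\<lambda>x. \<gamma> (m * x + k)) {x. m * x + k \<in> J}"
proof -
  let ?\<phi> = "\<lambda>x. m * x + k"
  let ?J = "{x. m * x + k \<in> J}"
  have im: "?\<phi> ` ?J = J"
  proof -
    have "y \<in> ?\<phi> ` ?J" if "y \<in> J" for y
      using that m by (intro image_eqI[of _ _ "m * (y - k)"]) auto
    then show ?thesis by auto
  qed
  have chain: "((snd c \<circ> (\<lambda>x. \<gamma> (?\<phi> x))) has_vector_derivative m *\<^sub>R v) (at s within K')"
    if "((snd c \<circ> \<gamma>) has_vector_derivative v) (at (?\<phi> s) within K)" "?\<phi> ` K' \<subseteq> K" for s v K K'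
  proof -
    have "(?\<phi> has_vector_derivative m) (at s within K')"
      by (auto intro!: derivative_eq_intros)
    from vector_diff_chain_within[OF this has_vector_derivative_within_subset[OF that]]
    show ?thesis by (simp add: o_def)
  qed
  have pc: "(snd c \<circ> (\<lambda>x. \<gamma> (?\<phi> x))) piecewise_C1_differentiable_on ?J"
    using piecewise_C1_differentiable_affine[of "snd c \<circ> \<gamma>" m k ?J] P m im
    by (auto simp: piece_def o_def)
  have R: "((snd c \<circ> (\<lambda>x. \<gamma> (?\<phi> x))) has_vector_derivative m *\<^sub>R v) (at s within (?J \<inter> {s..}))"
    if "((snd c \<circ> \<gamma>) has_vector_derivative v) (at (?\<phi> s) within (J \<inter> (if m = 1 then {?\<phi> s..} else {..?\<phi> s})))" for s v
    by (rule chain[OF that]) (use m in auto)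
  have L: "((snd c \<circ> (\<lambda>x. \<gamma> (?\<phi> x))) has_vector_derivative m *\<^sub>R v) (at s within (?J \<inter> {..s}))"
    if "((snd c \<circ> \<gamma>) has_vector_derivative v) (at (?\<phi> s) within (J \<inter> (if m = 1 then {..?\<phi> s} else {?\<phi> s..})))" for s v
    by (rule chain[OF that]) (use m in auto)
  have dom: "\<gamma> ` J \<subseteq> fst c" using P by (simp add: piece_def)
  have Q': "Q' (snd c (\<gamma> (?\<phi> s))) (m *\<^sub>R v)" if "Q (snd c (\<gamma> (?\<phi> s))) v" "s \<in> ?J" for s v
    using Q[OF _ that(1)] that(2) dom by auto
  have r: "\<exists>v. ((snd c \<circ> \<gamma>) has_vector_derivative v) (at u within (J \<inter> {u..})) \<and> Q (snd c (\<gamma> u)) v"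
    if "u \<in> J" "u' \<in> J" "u < u'" for u u' using P that unfolding piece_def by blast
  have l: "\<exists>v. ((snd c \<circ> \<gamma>) has_vector_derivative v) (at u within (J \<inter> {..u})) \<and> Q (snd c (\<gamma> u)) v"
    if "u \<in> J" "u' \<in> J" "u' < u" for u u' using P that unfolding piece_def by blast
  show ?thesis unfolding piece_def
  proof (intro conjI ballI impI)
    fix s assume s: "s \<in> ?J" "\<exists>s'\<in>?J. s < s'"
    then obtain s' where s': "?\<phi> s' \<in> J" "s < s'" by auto
    obtain v where "((snd c \<circ> \<gamma>) has_vector_derivative v) (at (?\<phi> s) within (J \<inter> (if m = 1 then {?\<phi> s..} else {..?\<phi> s})))"
      "Q (snd c (\<gamma> (?\<phi> s))) v"
      using r[of "?\<phi> s" "?\<phi> s'"] l[of "?\<phi> s" "?\<phi> s'"] s s' m by auto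
    then show "\<exists>v. ((snd c \<circ> (\<lambda>x. \<gamma> (?\<phi> x))) has_vector_derivative v) (at s within (?J \<inter> {s..}))
        \<and> Q' (snd c (\<gamma> (?\<phi> s))) v" using R Q' s(1) by blast
  next
    fix s assume s: "s \<in> ?J" "\<exists>s'\<in>?J. s' < s"
    then obtain s' where s': "?\<phi> s' \<in> J" "s' < s" by auto
    obtain v where "((snd c \<circ> \<gamma>) has_vector_derivative v) (at (?\<phi> s) within (J \<inter> (if m = 1 then {..?\<phi> s} else {?\<phi> s..})))"
      "Q (snd c (\<gamma> (?\<phi> s))) v"
      using r[of "?\<phi> s" "?\<phi> s'"] l[of "?\<phi> s" "?\<phi> s'"] s s' m by auto
    then show "\<exists>v. ((snd c \<circ> (\<lambda>x. \<gamma> (?\<phi> x))) has_vector_derivative v) (at s within (?J \<inter> {..s}))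
        \<and> Q' (snd c (\<gamma> (?\<phi> s))) v" using L Q' s(1) by blast
  qed (use dom pc in auto)
qed

text \<open>Only the atlas is kept fixed, so the same statement yields shifts inside one spacetime
  (for concatenation) and curves of the spacetime with reversed time orientation.\<close>

lemma fd_curve_reparam:
  fixes m k :: real
  assumes C: "fd_curve X Q \<gamma> I" and m: "m = 1 \<or> m = -1" and at: "atlas X' = atlas X"
    and Q: "\<And>c x v. c \<in> atlas X \<Longrightarrow> x \<in> snd c ` fst c \<Longrightarrow> Q c x v \<Longrightarrow> Q' c x (m *\<^sub>R v)"
  shows "fd_curve X' Q' (\<lambda>x. \<gamma> (m * x + k)) {x. m * x + k \<in> I}"
  unfolding fd_curve_iff_piece
proof (intro conjI ballI)
  note C' = C[unfolded fd_curve_iff_piece]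
  have int: "x \<in> I" if "a \<in> I" "b \<in> I" "a \<le> x" "x \<le> b" for a b x
    using C' that unfolding is_interval_1 by blast
  have "m * x + k \<in> I" if "m * a + k \<in> I" "m * b + k \<in> I" "a \<le> x" "x \<le> b" for a b x
    using m int[of "m * a + k" "m * b + k" "m * x + k"] int[of "m * b + k" "m * a + k" "m * x + k"] that
    by auto
  then show "is_interval {x. m * x + k \<in> I}" unfolding is_interval_1 by blast
  obtain a b where ab: "a \<in> I" "b \<in> I" "a < b" using C' by auto
  show "\<exists>a\<in>{x. m * x + k \<in> I}. \<exists>b\<in>{x. m * x + k \<in> I}. a < b"
    using m
  proof
    assume "m = 1" then show ?thesis using ab by (intro bexI[of _ "a - k"] bexI[of _ "b - k"]) auto
  next
    assume "m = -1" then show ?thesis using ab by (intro bexI[of _ "k - b"] bexI[of _ "k - a"]) auto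
  qed
  show "continuous_on {x. m * x + k \<in> I} (\<lambda>x. \<gamma> (m * x + k))"
    by (rule continuous_on_compose2[of I \<gamma>]) (use C' in \<open>auto intro!: continuous_intros\<close>)
next
  fix t assume t: "t \<in> {x. m * x + k \<in> I}"
  then obtain c \<epsilon> where c: "c \<in> atlas X" "\<epsilon> > 0"
    "piece (Q c) c \<gamma> (I \<inter> {m * t + k - \<epsilon>..m * t + k + \<epsilon>})"
    using C unfolding fd_curve_iff_piece by blast
  have "{x. m * x + k \<in> I \<inter> {m * t + k - \<epsilon>..m * t + k + \<epsilon>}} = {x. m * x + k \<in> I} \<inter> {t-\<epsilon>..t+\<epsilon>}"
    using m by auto
  with piece_reparam[OF c(3) m, of "Q' c" k] Q[OF c(1)]
  have "piece (Q' c) c (\<lambda>x. \<gamma> (m * x + k)) ({x. m * x + k \<in> I} \<inter> {t-\<epsilon>..t+\<epsilon>})" by simp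
  then show "\<exists>c\<in>atlas X'. \<exists>\<epsilon>>0. piece (Q' c) c (\<lambda>x. \<gamma> (m * x + k)) ({x. m * x + k \<in> I} \<inter> {t-\<epsilon>..t+\<epsilon>})"
    using c at by auto
qed

lemma fd_curve_mono:
  assumes "fd_curve X Q \<gamma> I"
    and "\<And>c x v. c \<in> atlas X \<Longrightarrow> x \<in> snd c ` fst c \<Longrightarrow> Q c x v \<Longrightarrow> Q' c x v"
  shows "fd_curve X Q' \<gamma> I"
proof -
  have "fd_curve X Q' (\<lambda>x. \<gamma> (1 * x + 0)) {x. 1 * x + 0 \<in> I}"
  proof (rule fd_curve_reparam[OF assms(1)])
    fix c x v assume "c \<in> atlas X" "x \<in> snd c ` fst c" "Q c x v"
    then have "Q' c x v" by (rule assms(2))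
    then show "Q' c x (1 *\<^sub>R v)" by (simp only: scaleR_one)
  qed simp_all
  then show ?thesis by simp
qed

lemma fd_curveD:
  assumes "fd_curve X Q \<gamma> I"
  shows "is_interval I" "\<exists>a\<in>I. \<exists>b\<in>I. a < b" "continuous_on I \<gamma>"
proof -
  note C = assms[unfolded fd_curve_def]
  show "is_interval I" "\<exists>a\<in>I. \<exists>b\<in>I. a < b" "continuous_on I \<gamma>"
    by (rule C[THEN conjunct1] C[THEN conjunct2, THEN conjunct1]
        C[THEN conjunct2, THEN conjunct2, THEN conjunct1])+
qed

lemma fd_curve_restrict:
  assumes C: "fd_curve X Q \<gamma> I" and "a \<in> I" "b \<in> I" "a < b"
  shows "fd_curve X Q \<gamma> {a..b}"
proof -
  note int = fd_curveD(1)[OF C] and cont = fd_curveD(3)[OF C]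
  have sub: "{a..b} \<subseteq> I" using mem_is_interval_1_I[OF int assms(2,3)] by auto
  show ?thesis unfolding fd_curve_iff_piece
  proof (intro conjI ballI)
    show "continuous_on {a..b} \<gamma>" using cont sub by (rule continuous_on_subset)
    show "\<exists>u\<in>{a..b}. \<exists>v\<in>{a..b}. u < v"
      using assms by (intro bexI[of _ a] bexI[of _ b]) auto
  next
    fix t assume "t \<in> {a..b}"
    then obtain c \<epsilon> where c: "c \<in> atlas X" "\<epsilon> > 0" "piece (Q c) c \<gamma> (I \<inter> {t-\<epsilon>..t+\<epsilon>})"
      using C sub unfolding fd_curve_iff_piece by blast
    have "piece (Q c) c \<gamma> ({a..b} \<inter> {t-\<epsilon>..t+\<epsilon>})" by (rule piece_subset[OF c(3)]) (use sub in auto)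
    then show "\<exists>c\<in>atlas X. \<exists>\<epsilon>>0. piece (Q c) c \<gamma> ({a..b} \<inter> {t-\<epsilon>..t+\<epsilon>})" using c by auto
  qed (simp add: is_interval_cc)
qed

lemma fd_curve_cong:
  assumes C: "fd_curve X Q \<gamma> {a..b}" and eq: "\<And>t. t \<in> {a..b} \<Longrightarrow> \<gamma>' t = \<gamma> t"
  shows "fd_curve X Q \<gamma>' {a..b}"
  unfolding fd_curve_iff_piece
proof (intro conjI ballI)
  show "continuous_on {a..b} \<gamma>'" using fd_curveD(3)[OF C] by (rule continuous_on_eq) (simp add: eq)
  show "\<exists>u\<in>{a..b}. \<exists>v\<in>{a..b}. u < v" by (rule fd_curveD(2)[OF C])
  fix t assume "t \<in> {a..b}"
  then obtain c \<epsilon> where c: "c \<in> atlas X" "\<epsilon> > 0" "piece (Q c) c \<gamma> ({a..b} \<inter> {t-\<epsilon>..t+\<epsilon>})"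
    using C unfolding fd_curve_iff_piece by blast
  have "piece (Q c) c \<gamma>' ({a..b} \<inter> {t-\<epsilon>..t+\<epsilon>})"
    using c(3) eq unfolding Int_atLeastAtMost by (auto intro: piece_cong)
  then show "\<exists>c\<in>atlas X. \<exists>\<epsilon>>0. piece (Q c) c \<gamma>' ({a..b} \<inter> {t-\<epsilon>..t+\<epsilon>})" using c by auto
qed (simp add: is_interval_cc)

section \<open>Change of charts and concatenation\<close>

lemma chart_facts:
  assumes "is_chart c"
  shows "open (fst c)" "open (snd c ` fst c)" "inj_on (snd c) (fst c)" "continuous_on (fst c) (snd c)"
    "continuous_on (snd c ` fst c) (inv_into (fst c) (snd c))"
    "\<And>T. open T \<Longrightarrow> T \<subseteq> fst c \<Longrightarrow> open (snd c ` T)"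
proof -
  obtain \<psi> where h: "homeomorphism (fst c) (snd c ` fst c) (snd c) \<psi>" and o: "open (fst c)" "open (snd c ` fst c)"
    using assms by (auto simp: is_chart_def)
  show "open (fst c)" "open (snd c ` fst c)" by fact+
  show inj: "inj_on (snd c) (fst c)" using h by (metis homeomorphism_def inj_on_inverseI)
  show "continuous_on (fst c) (snd c)" using h by (simp add: homeomorphism_def)
  have "continuous_on (snd c ` fst c) \<psi>" using h by (simp add: homeomorphism_def)
  then show "continuous_on (snd c ` fst c) (inv_into (fst c) (snd c))"
    by (rule continuous_on_eq) (use h inj in \<open>auto simp: homeomorphism_def\<close>)
  show "open (snd c ` T)" if "open T" "T \<subseteq> fst c" for T
    using homeomorphism_imp_open_map[OF h open_subset[OF that(2,1)]] o(2) by (rule openin_open_trans)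
qed

lemma spacetimeD:
  assumes "spacetime X" "c \<in> atlas X"
  shows "is_chart c" "\<And>x. x \<in> snd c ` fst c \<Longrightarrow> lorentzian_form (metric X c x)"
    "\<And>b1 b2. b1 \<in> Basis \<Longrightarrow> b2 \<in> Basis \<Longrightarrow> smooth_on (snd c ` fst c) (\<lambda>x. metric X c x b1 b2)"
    "continuous_on (snd c ` fst c) (torient X c)"
    "\<And>x. x \<in> snd c ` fst c \<Longrightarrow> metric X c x (torient X c x) (torient X c x) < 0"
  using assms by (auto simp: spacetime_def smooth_atlas_def)

lemma spacetime_cover:
  assumes "spacetime X" obtains c where "c \<in> atlas X" "p \<in> fst c"
proof -
  have "p \<in> (\<Union>c\<in>atlas X. fst c)" using assms unfolding spacetime_def smooth_atlas_def by simp
  then show ?thesis using that by blast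
qed

lemma spacetime_transition:
  assumes "spacetime X" "c1 \<in> atlas X" "c2 \<in> atlas X"
  shows "\<And>x. x \<in> overlap c1 c2 \<Longrightarrow>
      (transition c1 c2 has_derivative frechet_derivative (transition c1 c2) (at x)) (at x)"
    "\<And>v. v \<in> Basis \<Longrightarrow> continuous_on (overlap c1 c2) (\<lambda>x. frechet_derivative (transition c1 c2) (at x) v)"
    "\<And>x u v. x \<in> overlap c1 c2 \<Longrightarrow> metric X c1 x u v = metric X c2 (transition c1 c2 x)
                 (frechet_derivative (transition c1 c2) (at x) u)
                 (frechet_derivative (transition c1 c2) (at x) v)"
    "\<And>x. x \<in> overlap c1 c2 \<Longrightarrow> torient X c2 (transition c1 c2 x) =
         frechet_derivative (transition c1 c2) (at x) (torient X c1 x)"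
    "\<And>y. y \<in> fst c1 \<inter> fst c2 \<Longrightarrow> transition c1 c2 (snd c1 y) = snd c2 y"
    "\<And>x. x \<in> overlap c1 c2 \<Longrightarrow> transition c1 c2 x \<in> snd c2 ` fst c2"
proof -
  have "smooth_on (overlap c1 c2) (transition c1 c2)"
    using assms by (auto simp: spacetime_def smooth_atlas_def)
  then have "Ck_on (Suc 0) (overlap c1 c2) (transition c1 c2)" by (auto simp only: smooth_on_def)
  then show "\<And>x. x \<in> overlap c1 c2 \<Longrightarrow>
      (transition c1 c2 has_derivative frechet_derivative (transition c1 c2) (at x)) (at x)"
    "\<And>v. v \<in> Basis \<Longrightarrow> continuous_on (overlap c1 c2) (\<lambda>x. frechet_derivative (transition c1 c2) (at x) v)"
    by (auto simp: frechet_derivative_works[symmetric])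
  show 1: "transition c1 c2 (snd c1 y) = snd c2 y" if "y \<in> fst c1 \<inter> fst c2" for y
    using chart_facts(3)[OF spacetimeD(1)[OF assms(1,2)]] that by (simp add: transition_def)
  show "\<And>x. x \<in> overlap c1 c2 \<Longrightarrow> transition c1 c2 x \<in> snd c2 ` fst c2"
    using 1 by (auto simp: overlap_def)
  note T = assms(1)[unfolded spacetime_def, THEN conjunct2, THEN conjunct2, THEN conjunct2,
      THEN bspec, OF assms(2), THEN bspec, OF assms(3), THEN bspec]
  show "\<And>x u v. x \<in> overlap c1 c2 \<Longrightarrow> metric X c1 x u v = metric X c2 (transition c1 c2 x)
                 (frechet_derivative (transition c1 c2) (at x) u)
                 (frechet_derivative (transition c1 c2) (at x) v)"
    using T[THEN conjunct1] by blast
  show "\<And>x. x \<in> overlap c1 c2 \<Longrightarrow> torient X c2 (transition c1 c2 x) =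
         frechet_derivative (transition c1 c2) (at x) (torient X c1 x)"
    using T[THEN conjunct2] by blast
qed

definition chart_invariant :: "('a, 'v::euclidean_space) spacetime_data \<Rightarrow> (('a, 'v) chart \<Rightarrow> 'v \<Rightarrow> 'v \<Rightarrow> bool) \<Rightarrow> bool" where
  "chart_invariant X Q \<longleftrightarrow> (\<forall>c1\<in>atlas X. \<forall>c2\<in>atlas X. \<forall>x\<in>overlap c1 c2. \<forall>v.
     Q c1 x v \<longrightarrow> Q c2 (transition c1 c2 x) (frechet_derivative (transition c1 c2) (at x) v))"

lemma chart_invariant_timelike:
  assumes "spacetime X" shows "chart_invariant X (fd_timelike_vec X)"
  unfolding chart_invariant_def
proof (intro ballI allI impI)
  fix c1 c2 x v assume c: "c1 \<in> atlas X" "c2 \<in> atlas X" "x \<in> overlap c1 c2" "fd_timelike_vec X c1 x v"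
  note tr = spacetime_transition[OF assms c(1,2)]
  show "fd_timelike_vec X c2 (transition c1 c2 x) (frechet_derivative (transition c1 c2) (at x) v)"
    using c(4) by (simp add: fd_timelike_vec_def tr(4)[OF c(3)] tr(3)[OF c(3), symmetric])
qed

lemma chart_invariant_causal:
  assumes "spacetime X" shows "chart_invariant X (fd_causal_vec X)"
  unfolding chart_invariant_def
proof (intro ballI allI impI)
  fix c1 c2 x v assume c: "c1 \<in> atlas X" "c2 \<in> atlas X" "x \<in> overlap c1 c2" "fd_causal_vec X c1 x v"
  note tr = spacetime_transition[OF assms c(1,2)]
  let ?D = "frechet_derivative (transition c1 c2) (at x)"
  have "bilinear (metric X c2 (transition c1 c2 x))"
    using spacetimeD(2)[OF assms c(2) tr(6)[OF c(3)]] by (simp add: lorentzian_form_def)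
  \<comment> \<open>A negative product with the time orientation shows that the image of
    \<open>v\<close> does not vanish.\<close>
  moreover have "metric X c2 (transition c1 c2 x) (?D v) (?D (torient X c1 x)) < 0"
    using c(4) by (simp add: fd_causal_vec_def tr(3)[OF c(3), symmetric])
  ultimately have "?D v \<noteq> 0" by (auto simp: bilinear_lzero)
  then show "fd_causal_vec X c2 (transition c1 c2 x) (?D v)"
    using c(4) by (simp add: fd_causal_vec_def tr(4)[OF c(3)] tr(3)[OF c(3), symmetric])
qed

lemma timelike_imp_causal:
  assumes "spacetime X" "c \<in> atlas X" "x \<in> snd c ` fst c" "fd_timelike_vec X c x v"
  shows "fd_causal_vec X c x v"
proof -
  have "bilinear (metric X c x)" using spacetimeD(2)[OF assms(1-3)] by (simp add: lorentzian_form_def)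
  then show ?thesis using assms(4) by (auto simp: fd_causal_vec_def fd_timelike_vec_def bilinear_lzero)
qed

lemma fd_timelike_imp_causal_curve:
  "spacetime X \<Longrightarrow> fd_timelike_curve X \<gamma> I \<Longrightarrow> fd_causal_curve X \<gamma> I"
  unfolding fd_timelike_curve_def fd_causal_curve_def
  by (erule fd_curve_mono) (rule timelike_imp_causal)

text \<open>The definition of a curve offers some chart around each parameter. Two curves meeting at
  a point have to be read in a common chart, and the displacement lives in a given chart; invariance
  of the tangent condition allows the chart to be prescribed.\<close>

lemma fd_curve_in_chart:
  assumes X: "spacetime X" and Q: "chart_invariant X Q" and C: "fd_curve X Q \<gamma> {a..b}"
    and c: "c \<in> atlas X" and t: "t \<in> {a..b}" "\<gamma> t \<in> fst c"
  obtains \<delta> where "\<delta> > 0" "piece (Q c) c \<gamma> ({a..b} \<inter> {t-\<delta>..t+\<delta>})"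
proof -
  obtain c1 \<epsilon> where c1: "c1 \<in> atlas X" "\<epsilon> > 0" "piece (Q c1) c1 \<gamma> ({a..b} \<inter> {t-\<epsilon>..t+\<epsilon>})"
    using C t unfolding fd_curve_iff_piece by blast
  have "continuous_on {a..b} \<gamma>" by (rule fd_curveD(3)[OF C])
  then obtain A where A: "open A" "A \<inter> {a..b} = \<gamma> -` fst c \<inter> {a..b}"
    using chart_facts(1)[OF spacetimeD(1)[OF X c]] by (metis continuous_on_open_invariant)
  have "t \<in> A \<inter> {a..b}" unfolding A(2) using t by simp
  then have "t \<in> A" by simp
  then obtain e where e: "e > 0" "cball t e \<subseteq> A" using A(1) open_contains_cball by blast
  define \<delta> where "\<delta> = min e \<epsilon>"
  let ?J = "{a..b} \<inter> {t-\<delta>..t+\<delta>}"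
  have im: "\<gamma> s \<in> fst c" if "s \<in> ?J" for s
  proof -
    have "s \<in> cball t e" using that by (auto simp: \<delta>_def cball_def dist_real_def)
    then have "s \<in> A \<inter> {a..b}" using e(2) that by auto
    then show ?thesis unfolding A(2) by simp
  qed
  have P1: "piece (Q c1) c1 \<gamma> ?J" by (rule piece_subset[OF c1(3)]) (auto simp: \<delta>_def)
  then have im1: "\<gamma> s \<in> fst c1" if "s \<in> ?J" for s using that unfolding piece_def by blast
  note tr = spacetime_transition[OF X c1(1) c]
  have ov: "snd c1 (\<gamma> s) \<in> overlap c1 c" if "s \<in> ?J" for s
    unfolding overlap_def using im im1 that by blast
  have "piece (Q c) c \<gamma> {max a (t-\<delta>)..min b (t+\<delta>)}"
  proof (rule piece_map[where U = "overlap c1 c" and \<Psi> = "transition c1 c"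
        and \<Psi>' = "\<lambda>x. frechet_derivative (transition c1 c) (at x)"])
    show "piece (Q c1) c1 \<gamma> {max a (t-\<delta>)..min b (t+\<delta>)}" using P1 by (simp add: Int_atLeastAtMost)
    fix s assume "s \<in> {max a (t-\<delta>)..min b (t+\<delta>)}"
    then have s: "s \<in> ?J" by auto
    show "snd c1 (\<gamma> s) \<in> overlap c1 c" using ov s by simp
    show "\<gamma> s \<in> fst c" using im s by simp
    show "snd c (\<gamma> s) = transition c1 c (snd c1 (\<gamma> s))" using im[OF s] im1[OF s] tr(5) by simp
    show "\<And>v. Q c1 (snd c1 (\<gamma> s)) v \<Longrightarrow> Q c (transition c1 c (snd c1 (\<gamma> s)))
          (frechet_derivative (transition c1 c) (at (snd c1 (\<gamma> s))) v)"
      using Q ov[OF s] c1(1) c unfolding chart_invariant_def by blast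
  qed (use tr(1,2) in blast)+
  then have "piece (Q c) c \<gamma> ?J" by (simp add: Int_atLeastAtMost)
  then show ?thesis using that[of \<delta>] e c1(2) by (simp add: \<delta>_def)
qed

lemma fd_curve_join:
  assumes X: "spacetime X" and Q: "chart_invariant X Q"
    and 1: "fd_curve X Q \<gamma> {a..b}" and 2: "fd_curve X Q \<gamma> {b..d}"
  shows "fd_curve X Q \<gamma> {a..d}"
proof -
  have ab: "a < b" and bd: "b < d" using fd_curveD(2)[OF 1] fd_curveD(2)[OF 2] by force+
  note c12 = fd_curveD(3)[OF 1] fd_curveD(3)[OF 2]
  show ?thesis unfolding fd_curve_iff_piece
  proof (intro conjI ballI)
    show "continuous_on {a..d} \<gamma>"
      using continuous_on_closed_Un[of "{a..b}" "{b..d}" \<gamma>] c12 ab bd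
      by (simp add: ivl_disj_un_two_touch)
    show "\<exists>u\<in>{a..d}. \<exists>v\<in>{a..d}. u < v" using ab bd by (intro bexI[of _ a] bexI[of _ d]) auto
  next
    fix t assume t: "t \<in> {a..d}"
    consider "t < b" | "t > b" | "t = b" by linarith
    then show "\<exists>c\<in>atlas X. \<exists>\<epsilon>>0. piece (Q c) c \<gamma> ({a..d} \<inter> {t-\<epsilon>..t+\<epsilon>})"
    proof cases
      case 1
      then obtain c \<epsilon> where c: "c \<in> atlas X" "\<epsilon> > 0" "piece (Q c) c \<gamma> ({a..b} \<inter> {t-\<epsilon>..t+\<epsilon>})"
        using assms(3) t unfolding fd_curve_iff_piece by (meson atLeastAtMost_iff less_imp_le)
      define \<delta> where "\<delta> = min \<epsilon> (b - t)"
      have "piece (Q c) c \<gamma> ({a..d} \<inter> {t-\<delta>..t+\<delta>})"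
        by (rule piece_subset[OF c(3)]) (use bd in \<open>auto simp: \<delta>_def\<close>)
      then show ?thesis using c 1 by (intro bexI[of _ c] exI[of _ \<delta>]) (auto simp: \<delta>_def)
    next
      case 2
      then obtain c \<epsilon> where c: "c \<in> atlas X" "\<epsilon> > 0" "piece (Q c) c \<gamma> ({b..d} \<inter> {t-\<epsilon>..t+\<epsilon>})"
        using assms(4) t unfolding fd_curve_iff_piece by (meson atLeastAtMost_iff less_imp_le)
      define \<delta> where "\<delta> = min \<epsilon> (t - b)"
      have "piece (Q c) c \<gamma> ({a..d} \<inter> {t-\<delta>..t+\<delta>})"
        by (rule piece_subset[OF c(3)]) (use ab in \<open>auto simp: \<delta>_def\<close>)
      then show ?thesis using c 2 by (intro bexI[of _ c] exI[of _ \<delta>]) (auto simp: \<delta>_def)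
    next
      case 3
      \<comment> \<open>At the junction one chart is fixed in advance, and the two halves are both
        rewritten in it before they are glued.\<close>
      obtain c where c: "c \<in> atlas X" "\<gamma> b \<in> fst c" using spacetime_cover[OF X] .
      obtain \<delta>1 where d1: "\<delta>1 > 0" "piece (Q c) c \<gamma> ({a..b} \<inter> {b-\<delta>1..b+\<delta>1})"
        using fd_curve_in_chart[OF X Q 1 c(1) _ c(2)] ab by (auto simp del: Int_atLeastAtMost)
      obtain \<delta>2 where d2: "\<delta>2 > 0" "piece (Q c) c \<gamma> ({b..d} \<inter> {b-\<delta>2..b+\<delta>2})"
        using fd_curve_in_chart[OF X Q 2 c(1) _ c(2)] bd by (auto simp del: Int_atLeastAtMost)
      define \<delta> where "\<delta> = min (min \<delta>1 \<delta>2) (min (b - a) (d - b))"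
      have \<delta>: "\<delta> > 0" using d1 d2 ab bd by (simp add: \<delta>_def)
      have "piece (Q c) c \<gamma> {b-\<delta>..b+\<delta>}"
      proof (rule piece_join)
        show "piece (Q c) c \<gamma> {b-\<delta>..b}" by (rule piece_subset[OF d1(2)]) (use d1 in \<open>auto simp: \<delta>_def\<close>)
        show "piece (Q c) c \<gamma> {b..b+\<delta>}" by (rule piece_subset[OF d2(2)]) (use d2 in \<open>auto simp: \<delta>_def\<close>)
      qed (use \<delta> in auto)
      moreover have "{a..d} \<inter> {b-\<delta>..b+\<delta>} = {b-\<delta>..b+\<delta>}" by (auto simp: \<delta>_def)
      ultimately have "piece (Q c) c \<gamma> ({a..d} \<inter> {t-\<delta>..t+\<delta>})" unfolding 3 by (simp only:)
      then show ?thesis using c(1) \<delta> by blast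
    qed
  qed (simp add: is_interval_cc)
qed

text \<open>The parametrisation of the first curve is preserved, so the meeting point stays at
  parameter \<open>b\<close>, where causal convexity will be evaluated.\<close>

lemma fd_timelike_join:
  assumes X: "spacetime X" and 1: "fd_timelike_curve X \<gamma> {a..b}" and 2: "fd_timelike_curve X \<gamma>' {c..d}"
    and eq: "\<gamma> b = \<gamma>' c"
  obtains \<beta> e where "fd_timelike_curve X \<beta> {a..e}" "b < e" "\<And>t. t \<le> b \<Longrightarrow> \<beta> t = \<gamma> t" "\<beta> e = \<gamma>' d"
proof -
  define e where "e = d - c + b"
  define \<beta> where "\<beta> t = (if t \<le> b then \<gamma> t else \<gamma>' (1 * t + (c - b)))" for t
  have cd: "c < d" using fd_curveD(2)[OF 2[unfolded fd_timelike_curve_def]] by force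
  have "fd_curve X (fd_timelike_vec X) \<beta> {a..b}"
    by (rule fd_curve_cong[OF 1[unfolded fd_timelike_curve_def]]) (simp add: \<beta>_def)
  moreover have "fd_curve X (fd_timelike_vec X) (\<lambda>t. \<gamma>' (1 * t + (c - b))) {t. 1 * t + (c - b) \<in> {c..d}}"
    by (rule fd_curve_reparam[OF 2[unfolded fd_timelike_curve_def]]) simp_all
  moreover have "{t. 1 * t + (c - b) \<in> {c..d}} = {b..e}" by (auto simp: e_def)
  ultimately have "fd_curve X (fd_timelike_vec X) (\<lambda>t. \<gamma>' (1 * t + (c - b))) {b..e}" by metis
  then have "fd_curve X (fd_timelike_vec X) \<beta> {b..e}"
    by (rule fd_curve_cong) (use eq in \<open>auto simp: \<beta>_def\<close>)
  from fd_curve_join[OF X chart_invariant_timelike[OF X] \<open>fd_curve X (fd_timelike_vec X) \<beta> {a..b}\<close> this]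
  show ?thesis using cd by (intro that[of \<beta> e]) (auto simp: fd_timelike_curve_def \<beta>_def e_def)
qed

lemma Ifut_trans:
  assumes X: "spacetime X" and "y \<in> Ifut X x" "z \<in> Ifut X y"
  shows "z \<in> Ifut X x"
proof -
  obtain \<gamma> a b where 1: "fd_timelike_curve X \<gamma> {a..b}" "\<gamma> a = x" "\<gamma> b = y" "a < b"
    using assms(2) by (auto simp: Ifut_def)
  obtain \<gamma>' c d where 2: "fd_timelike_curve X \<gamma>' {c..d}" "\<gamma>' c = y" "\<gamma>' d = z"
    using assms(3) by (auto simp: Ifut_def)
  obtain \<beta> e where "fd_timelike_curve X \<beta> {a..e}" "b < e" "\<And>t. t \<le> b \<Longrightarrow> \<beta> t = \<gamma> t" "\<beta> e = \<gamma>' d"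
    using fd_timelike_join[OF X 1(1) 2(1)] 1 2 by metis
  then show ?thesis unfolding Ifut_def using 1 2
    by (intro CollectI exI[of _ \<beta>] exI[of _ a] exI[of _ e]) auto
qed

lemma Ipast_iff: "x \<in> Ipast X y \<longleftrightarrow> y \<in> Ifut X x"
  by (simp add: Ipast_def Ifut_def)

text \<open>Causal convexity in the two forms used later: for an entire curve, which keeps it inside
  the domain of a displacement, and for a single point chronologically between two others.\<close>

lemma strongly_causal_chron:
  assumes X: "spacetime X" and S: "strongly_causal X" and U: "open U" "p \<in> U"
  obtains V where "open V" "p \<in> V" "V \<subseteq> U"
    "\<And>\<gamma> a b t. fd_timelike_curve X \<gamma> {a..b} \<Longrightarrow> \<gamma> a \<in> V \<Longrightarrow> \<gamma> b \<in> V \<Longrightarrow> t \<in> {a..b} \<Longrightarrow> \<gamma> t \<in> V"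
    "\<And>x y z. x \<in> V \<Longrightarrow> z \<in> V \<Longrightarrow> y \<in> Ifut X x \<Longrightarrow> z \<in> Ifut X y \<Longrightarrow> y \<in> V"
proof -
  obtain V where V: "open V" "p \<in> V" "V \<subseteq> U"
    "\<And>\<gamma> I. fd_causal_curve X \<gamma> I \<Longrightarrow> is_interval {t\<in>I. \<gamma> t \<in> V}"
    using S U unfolding strongly_causal_def by meson
  have conv: "\<gamma> t \<in> V" if "fd_timelike_curve X \<gamma> {a..b}" "\<gamma> a \<in> V" "\<gamma> b \<in> V" "t \<in> {a..b}" for \<gamma> a b t
  proof -
    have "is_interval {t\<in>{a..b}. \<gamma> t \<in> V}" using V(4) fd_timelike_imp_causal_curve[OF X that(1)] .
    then have "t \<in> {t\<in>{a..b}. \<gamma> t \<in> V}"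
      by (rule mem_is_interval_1_I[of _ a b]) (use that in auto)
    then show ?thesis by simp
  qed
  have "y \<in> V" if H: "x \<in> V" "z \<in> V" "y \<in> Ifut X x" "z \<in> Ifut X y" for x y z
  proof -
    obtain \<gamma> a b where 1: "fd_timelike_curve X \<gamma> {a..b}" "\<gamma> a = x" "\<gamma> b = y" "a < b"
      using H(3) unfolding Ifut_def by blast
    obtain \<gamma>' c d where 2: "fd_timelike_curve X \<gamma>' {c..d}" "\<gamma>' c = y" "\<gamma>' d = z"
      using H(4) unfolding Ifut_def by blast
    obtain \<beta> e where "fd_timelike_curve X \<beta> {a..e}" "b < e" "\<And>t. t \<le> b \<Longrightarrow> \<beta> t = \<gamma> t" "\<beta> e = \<gamma>' d"
      using fd_timelike_join[OF X 1(1) 2(1)] 1 2 by metis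
    then show ?thesis using conv[of \<beta> a e b] 1 2 H by auto
  qed
  with V conv that show ?thesis by blast
qed

section \<open>Time reversal\<close>

text \<open>Reversing the time orientation turns every statement about futures into one about pasts.\<close>
definition time_reverse :: "('a, 'v::real_vector) spacetime_data \<Rightarrow> ('a, 'v) spacetime_data" where
  "time_reverse X = X\<lparr>torient := \<lambda>c x. - torient X c x\<rparr>"

lemma time_reverse_simps [simp]:
  "atlas (time_reverse X) = atlas X" "metric (time_reverse X) = metric X"
  "torient (time_reverse X) = (\<lambda>c x. - torient X c x)" "time_reverse (time_reverse X) = X"
  by (simp_all add: time_reverse_def)

lemma spacetime_time_reverse:
  fixes X :: "('a::{t2_space, second_countable_topology}, 'v::euclidean_space) spacetime_data"
  assumes "spacetime X" shows "spacetime (time_reverse X)"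
proof -
  have bl: "bilinear (metric X c x)" if "c \<in> atlas X" "x \<in> snd c ` fst c" for c x
    using spacetimeD(2)[OF assms that] by (simp add: lorentzian_form_def)
  note S = assms[unfolded spacetime_def]
  show ?thesis unfolding spacetime_def time_reverse_simps
  proof (intro conjI ballI allI)
    show "DIM('v) \<ge> 2" "smooth_atlas (atlas X)"
      by (rule S[THEN conjunct1], rule S[THEN conjunct2, THEN conjunct1])
  next
    fix c x assume c: "c \<in> atlas X" and x: "x \<in> snd c ` fst c"
    show "lorentzian_form (metric X c x)" by (rule spacetimeD(2)[OF assms c x])
    show "metric X c x (- torient X c x) (- torient X c x) < 0"
      using spacetimeD(5)[OF assms c x] bl[OF c x] by (simp add: bilinear_lneg bilinear_rneg)
  next
    fix c and b1 b2 :: 'v assume c: "c \<in> atlas X" and b: "b1 \<in> Basis" "b2 \<in> Basis"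
    show "smooth_on (snd c ` fst c) (\<lambda>x. metric X c x b1 b2)" by (rule spacetimeD(3)[OF assms c b])
  next
    fix c assume c: "c \<in> atlas X"
    show "continuous_on (snd c ` fst c) (\<lambda>x. - torient X c x)"
      by (rule continuous_on_minus[OF spacetimeD(4)[OF assms c]])
  next
    fix c1 c2 x assume c: "c1 \<in> atlas X" "c2 \<in> atlas X" and x: "x \<in> overlap c1 c2"
    note tr = spacetime_transition[OF assms c]
    show "metric X c1 x u v = metric X c2 (transition c1 c2 x)
         (frechet_derivative (transition c1 c2) (at x) u) (frechet_derivative (transition c1 c2) (at x) v)" for u v
      by (rule tr(3)[OF x])
    show "- torient X c2 (transition c1 c2 x) = frechet_derivative (transition c1 c2) (at x) (- torient X c1 x)"
      using tr(4)[OF x] has_derivative_linear[OF tr(1)[OF x]] by (simp add: linear_neg)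
  qed
qed

lemma time_reverse_vec:
  assumes "spacetime X" "c \<in> atlas X" "x \<in> snd c ` fst c"
  shows "fd_timelike_vec X c x v \<Longrightarrow> fd_timelike_vec (time_reverse X) c x (- v)"
    "fd_causal_vec X c x v \<Longrightarrow> fd_causal_vec (time_reverse X) c x (- v)"
proof -
  have "bilinear (metric X c x)" using spacetimeD(2)[OF assms] by (simp add: lorentzian_form_def)
  then show "fd_timelike_vec X c x v \<Longrightarrow> fd_timelike_vec (time_reverse X) c x (- v)"
    "fd_causal_vec X c x v \<Longrightarrow> fd_causal_vec (time_reverse X) c x (- v)"
    by (simp_all add: fd_timelike_vec_def fd_causal_vec_def bilinear_lneg bilinear_rneg)
qed

lemma time_reverse_curve:
  assumes "spacetime X"
  shows "fd_timelike_curve X \<gamma> I \<Longrightarrow> fd_timelike_curve (time_reverse X) (\<lambda>t. \<gamma> (- t)) {t. - t \<in> I}"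
    "fd_causal_curve X \<gamma> I \<Longrightarrow> fd_causal_curve (time_reverse X) (\<lambda>t. \<gamma> (- t)) {t. - t \<in> I}"
proof -
  have "fd_curve (time_reverse X) Q' (\<lambda>t. \<gamma> (-1 * t + 0)) {t. -1 * t + 0 \<in> I}"
    if "fd_curve X Q \<gamma> I"
      and "\<And>c x v. c \<in> atlas X \<Longrightarrow> x \<in> snd c ` fst c \<Longrightarrow> Q c x v \<Longrightarrow> Q' c x (-1 *\<^sub>R v)" for Q Q'
    using that(2) by (intro fd_curve_reparam[OF that(1)]) simp_all
  note * = this[simplified]
  show "fd_timelike_curve X \<gamma> I \<Longrightarrow> fd_timelike_curve (time_reverse X) (\<lambda>t. \<gamma> (- t)) {t. - t \<in> I}"
    unfolding fd_timelike_curve_def by (rule *[where Q = "fd_timelike_vec X"]) (use time_reverse_vec(1)[OF assms] in auto)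
  show "fd_causal_curve X \<gamma> I \<Longrightarrow> fd_causal_curve (time_reverse X) (\<lambda>t. \<gamma> (- t)) {t. - t \<in> I}"
    unfolding fd_causal_curve_def by (rule *[where Q = "fd_causal_vec X"]) (use time_reverse_vec(2)[OF assms] in auto)
qed

lemma Ifut_time_reverse_subset:
  assumes "spacetime X" shows "Ipast X p \<subseteq> Ifut (time_reverse X) p"
proof
  fix q assume "q \<in> Ipast X p"
  then obtain \<gamma> a b where g: "a < b" "fd_timelike_curve X \<gamma> {a..b}" "\<gamma> a = q" "\<gamma> b = p"
    by (auto simp: Ipast_def)
  have "{t. - t \<in> {a..b}} = {-b..-a}" by auto
  with time_reverse_curve(1)[OF assms g(2)]
  have "fd_timelike_curve (time_reverse X) (\<lambda>t. \<gamma> (- t)) {-b..-a}" by simp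
  then show "q \<in> Ifut (time_reverse X) p"
    unfolding Ifut_def using g
    by (intro CollectI exI[of _ "\<lambda>t. \<gamma> (- t)"] exI[of _ "-b"] exI[of _ "-a"]) simp
qed

lemma Ifut_time_reverse:
  assumes "spacetime X" shows "Ifut (time_reverse X) = Ipast X" "Ipast (time_reverse X) = Ifut X"
proof -
  \<comment> \<open>Reversal is an involution, so applying the inclusion to the reversed spacetime
    gives the converse.\<close>
  have "q \<in> Ifut (time_reverse X) p \<longleftrightarrow> q \<in> Ipast X p" for p q
    using Ifut_time_reverse_subset[OF assms, of p]
      Ifut_time_reverse_subset[OF spacetime_time_reverse[OF assms], of q] by (auto simp: Ipast_iff)
  then show "Ifut (time_reverse X) = Ipast X" "Ipast (time_reverse X) = Ifut X"
    by (auto simp: fun_eq_iff Ipast_iff set_eq_iff)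
qed

lemma strongly_causal_time_reverse:
  fixes X :: "('a::{t2_space, second_countable_topology}, 'v::euclidean_space) spacetime_data"
  assumes X: "spacetime X" and S: "strongly_causal X"
  shows "strongly_causal (time_reverse X)"
  unfolding strongly_causal_def
proof (intro allI impI, elim conjE)
  fix p and U :: "'a set" assume "open U" "p \<in> U"
  then obtain V where V: "open V" "p \<in> V" "V \<subseteq> U"
    "\<And>\<gamma> I. fd_causal_curve X \<gamma> I \<Longrightarrow> is_interval {t\<in>I. \<gamma> t \<in> V}"
    using S unfolding strongly_causal_def by meson
  have "is_interval {t\<in>I. \<gamma> t \<in> V}" if "fd_causal_curve (time_reverse X) \<gamma> I" for \<gamma> I
  proof -
    have "fd_causal_curve X (\<lambda>t. \<gamma> (- t)) {t. - t \<in> I}"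
      using time_reverse_curve(2)[OF spacetime_time_reverse[OF X] that] by simp
    note int = V(4)[OF this]
    have "x \<in> I \<and> \<gamma> x \<in> V" if "a \<in> I" "\<gamma> a \<in> V" "b \<in> I" "\<gamma> b \<in> V" "a \<le> x" "x \<le> b" for a b x
      using mem_is_interval_1_I[OF int, of "- b" "- a" "- x"] that by simp
    then show ?thesis unfolding is_interval_1 by blast
  qed
  with V show "\<exists>V. open V \<and> p \<in> V \<and> V \<subseteq> U \<and>
        (\<forall>\<gamma> I. fd_causal_curve (time_reverse X) \<gamma> I \<longrightarrow> is_interval {t\<in>I. \<gamma> t \<in> V})" by blast
qed

section \<open>Chronological futures are open\<close>

text \<open>Regularity of the metric is assumed for its coefficients on the basis; this expansion
  transfers continuity and Lipschitz bounds to arbitrary arguments.\<close>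

lemma bilinear_Basis_sum:
  fixes B :: "'v::euclidean_space \<Rightarrow> 'v \<Rightarrow> real"
  assumes "bilinear B"
  shows "B u v = (\<Sum>(i,j)\<in>Basis \<times> Basis. (u \<bullet> i) * (v \<bullet> j) * B i j)"
proof -
  have "B (\<Sum>i\<in>Basis. (u \<bullet> i) *\<^sub>R i) (\<Sum>j\<in>Basis. (v \<bullet> j) *\<^sub>R j) =
      (\<Sum>(i,j)\<in>Basis \<times> Basis. B ((u \<bullet> i) *\<^sub>R i) ((v \<bullet> j) *\<^sub>R j))"
    by (rule bilinear_sum[OF assms])
  then show ?thesis
    using assms by (simp add: euclidean_representation bilinear_lmul bilinear_rmul mult.assoc)
qed

lemma metric_bilinear:
  assumes "spacetime X" "c \<in> atlas X" "x \<in> snd c ` fst c"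
  shows "bilinear (metric X c x)" "metric X c x u v = metric X c x v u"
  using spacetimeD(2)[OF assms] by (auto simp: lorentzian_form_def)

lemma metric_C1:
  assumes "spacetime X" "c \<in> atlas X" "i \<in> Basis" "j \<in> Basis"
  shows "Ck_on (Suc 0) (snd c ` fst c) (\<lambda>x. metric X c x i j)"
  using spacetimeD(3)[OF assms] unfolding smooth_on_def by blast

lemma continuous_on_metric:
  assumes X: "spacetime X" and c: "c \<in> atlas X"
    and f: "continuous_on S f" and u: "continuous_on S u" and v: "continuous_on S v"
    and im: "\<And>s. s \<in> S \<Longrightarrow> f s \<in> snd c ` fst c"
  shows "continuous_on S (\<lambda>s. metric X c (f s) (u s) (v s))"
proof -
  have "continuous_on S (\<lambda>s. metric X c (f s) i j)" if "i \<in> Basis" "j \<in> Basis" for i j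
  proof -
    have "continuous_on (snd c ` fst c) (\<lambda>x. metric X c x i j)" using metric_C1[OF X c that] by simp
    from continuous_on_compose2[OF this f] im show ?thesis by blast
  qed
  then have "continuous_on S (\<lambda>s. \<Sum>(i,j)\<in>Basis \<times> Basis. (u s \<bullet> i) * (v s \<bullet> j) * metric X c (f s) i j)"
    using u v by (auto intro!: continuous_intros simp: case_prod_unfold)
  then show ?thesis
    by (rule continuous_on_eq) (simp add: bilinear_Basis_sum[OF metric_bilinear(1)[OF X c im], symmetric])
qed

lemma open_timelike:
  assumes X: "spacetime X" and c: "c \<in> atlas X"
  shows "open {(x, v). x \<in> snd c ` fst c \<and> fd_timelike_vec X c x v}"
proof -
  let ?O = "snd c ` fst c"
  have o: "open (?O \<times> (UNIV :: 'b set))" using chart_facts(2)[OF spacetimeD(1)[OF X c]] by (simp add: open_Times)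
  have T: "continuous_on (?O \<times> (UNIV :: 'b set)) (\<lambda>z. torient X c (fst z))"
    by (rule continuous_on_compose2[OF spacetimeD(4)[OF X c] continuous_on_fst[OF continuous_on_id]]) auto
  have 1: "continuous_on (?O \<times> UNIV) (\<lambda>z. metric X c (fst z) (snd z) (snd z))"
    by (rule continuous_on_metric[OF X c]) (auto intro!: continuous_intros)
  have 2: "continuous_on (?O \<times> UNIV) (\<lambda>z. metric X c (fst z) (snd z) (torient X c (fst z)))"
    by (rule continuous_on_metric[OF X c _ _ T]) (auto intro!: continuous_intros)
  have "{(x, v). x \<in> ?O \<and> fd_timelike_vec X c x v} =
     (?O \<times> UNIV \<inter> (\<lambda>z. metric X c (fst z) (snd z) (snd z)) -` {..<0}) \<inter>
     (?O \<times> UNIV \<inter> (\<lambda>z. metric X c (fst z) (snd z) (torient X c (fst z))) -` {..<0})"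
    by (auto simp: fd_timelike_vec_def)
  also have "open \<dots>" by (intro open_Int continuous_open_preimage 1 2 o open_lessThan)
  finally show ?thesis .
qed

text \<open>Openness holds jointly in base point and vector. One radius for both means that
  coordinate segments in the ball with direction near \<open>v\<close> are timelike
  throughout.\<close>

lemma timelike_nhd:
  assumes X: "spacetime X" and c: "c \<in> atlas X" and x: "x \<in> snd c ` fst c" and v: "fd_timelike_vec X c x v"
  obtains \<rho> where "\<rho> > 0" "ball x \<rho> \<subseteq> snd c ` fst c"
    "\<And>y w. y \<in> ball x \<rho> \<Longrightarrow> w \<in> ball v \<rho> \<Longrightarrow> fd_timelike_vec X c y w"
proof -
  have "(x, v) \<in> {(x, v). x \<in> snd c ` fst c \<and> fd_timelike_vec X c x v}" using x v by simp
  then obtain A B where AB: "open A" "open B" "(x, v) \<in> A \<times> B"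
    "A \<times> B \<subseteq> {(x, v). x \<in> snd c ` fst c \<and> fd_timelike_vec X c x v}"
    by (rule open_prod_elim[OF open_timelike[OF X c]])
  obtain r1 where r1: "r1 > 0" "ball x r1 \<subseteq> A" using AB open_contains_ball by blast
  obtain r2 where r2: "r2 > 0" "ball v r2 \<subseteq> B" using AB open_contains_ball by blast
  have *: "y \<in> snd c ` fst c \<and> fd_timelike_vec X c y w" if "y \<in> ball x (min r1 r2)" "w \<in> ball v (min r1 r2)" for y w
  proof -
    have "(y, w) \<in> A \<times> B" using that r1 r2 by auto
    then show ?thesis using AB(4) by blast
  qed
  show ?thesis
  proof (rule that[of "min r1 r2"])
    have "v \<in> ball v (min r1 r2)" using r1 r2 by simp
    with * show "ball x (min r1 r2) \<subseteq> snd c ` fst c" by blast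
    show "min r1 r2 > 0" using r1 r2 by simp
    show "fd_timelike_vec X c y w" if "y \<in> ball x (min r1 r2)" "w \<in> ball v (min r1 r2)" for y w
      using *[OF that] by blast
  qed
qed

lemma timelike_scale:
  assumes X: "spacetime X" "c \<in> atlas X" "x \<in> snd c ` fst c" and v: "fd_timelike_vec X c x v" and h: "h > 0"
  shows "fd_timelike_vec X c x (h *\<^sub>R v)"
  using v h metric_bilinear(1)[OF X]
  by (simp add: fd_timelike_vec_def bilinear_lmul bilinear_rmul mult_pos_neg)

abbreviation unchart :: "('a, 'v) chart \<Rightarrow> 'v \<Rightarrow> 'a" where
  "unchart c \<equiv> inv_into (fst c) (snd c)"

lemma unchart:
  assumes "is_chart c"
  shows "x \<in> fst c \<Longrightarrow> unchart c (snd c x) = x"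
    "y \<in> snd c ` fst c \<Longrightarrow> unchart c y \<in> fst c" "y \<in> snd c ` fst c \<Longrightarrow> snd c (unchart c y) = y"
  using chart_facts(3)[OF assms] by (simp_all add: inv_into_into f_inv_into_f)

text \<open>The basic construction of timelike curves: a coordinate segment whose constant direction
  is timelike over a convex set containing it.\<close>

lemma line_timelike:
  assumes X: "spacetime X" and c: "c \<in> atlas X" and h: "h > 0"
    and B: "convex B" "B \<subseteq> snd c ` fst c" "x \<in> B" "x + h *\<^sub>R v \<in> B"
    and v: "\<And>y. y \<in> B \<Longrightarrow> fd_timelike_vec X c y v"
  shows "unchart c (x + h *\<^sub>R v) \<in> Ifut X (unchart c x)"
proof -
  note ch = spacetimeD(1)[OF X c]
  define w where "w = h *\<^sub>R v"
  define \<gamma> where "\<gamma> s = unchart c (x + s *\<^sub>R w)" for s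
  have inB: "x + s *\<^sub>R w \<in> B" if "s \<in> {0..1}" for s
  proof -
    have "(1 - s) *\<^sub>R x + s *\<^sub>R (x + w) \<in> B"
      using B that unfolding w_def by (intro convexD) auto
    then show ?thesis by (simp add: algebra_simps)
  qed
  have im: "\<gamma> s \<in> fst c" and sn: "snd c (\<gamma> s) = x + s *\<^sub>R w" if "s \<in> {0..1}" for s
    using inB[OF that] B(2) unchart[OF ch] by (auto simp: \<gamma>_def subset_iff)
  have D: "((\<lambda>s. x + s *\<^sub>R w) has_vector_derivative w) (at s within K)" for s K
    by (auto intro!: derivative_eq_intros)
  have D': "((snd c \<circ> \<gamma>) has_vector_derivative w) (at s within K)" if "s \<in> K" "K \<subseteq> {0..1}" for s K
    by (rule has_vector_derivative_transform[OF that(1) _ D]) (use that(2) sn in auto)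
  have T: "fd_timelike_vec X c (snd c (\<gamma> s)) w" if "s \<in> {0..1}" for s
    unfolding sn[OF that] w_def
    using timelike_scale[OF X c _ v h] inB[OF that] B(2) by (auto simp: w_def)
  have "(\<lambda>s. x + s *\<^sub>R w) C1_differentiable_on {0..1}"
    unfolding C1_differentiable_on_def by (intro exI[of _ "\<lambda>_. w"] conjI ballI D continuous_on_const)
  then have "(\<lambda>s. x + s *\<^sub>R w) piecewise_C1_differentiable_on {0..1}"
    by (rule C1_differentiable_imp_piecewise)
  then have pc: "(snd c \<circ> \<gamma>) piecewise_C1_differentiable_on {0..1}"
    by (rule piecewise_C1_cong_closed) (simp add: sn)
  have P: "piece (fd_timelike_vec X c) c \<gamma> {0..1}"
    unfolding piece_def
  proof (intro conjI ballI impI pc)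
    show "\<gamma> ` {0..1} \<subseteq> fst c" using im by blast
    fix s :: real assume s: "s \<in> {0..1}"
    show "\<exists>v. (snd c \<circ> \<gamma> has_vector_derivative v) (at s within {0..1} \<inter> {s..}) \<and> fd_timelike_vec X c (snd c (\<gamma> s)) v"
      using D'[of s "{0..1} \<inter> {s..}"] T[OF s] s by blast
    show "\<exists>v. (snd c \<circ> \<gamma> has_vector_derivative v) (at s within {0..1} \<inter> {..s}) \<and> fd_timelike_vec X c (snd c (\<gamma> s)) v"
      using D'[of s "{0..1} \<inter> {..s}"] T[OF s] s by blast
  qed
  have "fd_curve X (fd_timelike_vec X) \<gamma> {0..1}"
    unfolding fd_curve_iff_piece
  proof (intro conjI ballI)
    show "\<exists>a\<in>{0..1::real}. \<exists>b\<in>{0..1}. a < b" by (intro bexI[of _ 0] bexI[of _ 1]) auto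
    show "continuous_on {0..1} \<gamma>" unfolding \<gamma>_def
      by (rule continuous_on_compose2[OF chart_facts(5)[OF ch]])
        (use inB B(2) in \<open>auto intro!: continuous_intros\<close>)
    fix t :: real assume "t \<in> {0..1}"
    show "\<exists>c\<in>atlas X. \<exists>\<epsilon>>0. piece (fd_timelike_vec X c) c \<gamma> ({0..1} \<inter> {t-\<epsilon>..t+\<epsilon>})"
      using piece_subset[OF P Int_lower1] c zero_less_one by blast
  qed (simp add: is_interval_cc)
  moreover have "\<gamma> 0 = unchart c x" "\<gamma> 1 = unchart c (x + h *\<^sub>R v)" by (simp_all add: \<gamma>_def w_def)
  ultimately show ?thesis unfolding Ifut_def fd_timelike_curve_def
    using zero_less_one by blast
qed

lemma open_chart_preimage:
  assumes "is_chart c" "open A"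
  shows "open {q \<in> fst c. snd c q \<in> A}"
proof -
  have "open (fst c \<inter> snd c -` A)"
    by (rule continuous_open_preimage[OF chart_facts(4,1)[OF assms(1)] assms(2)])
  moreover have "fst c \<inter> snd c -` A = {q \<in> fst c. snd c q \<in> A}" by blast
  ultimately show ?thesis by metis
qed

text \<open>The curve is cut shortly before its end, and the cut point is joined by a coordinate
  segment to an arbitrary point near \<open>q\<close>. The direction of that segment is close to the
  terminal left velocity \<open>v\<close>, hence timelike.\<close>

lemma open_Ifut:
  assumes X: "spacetime X" shows "open (Ifut X p)"
proof (rule Topological_Spaces.openI)
  fix q assume "q \<in> Ifut X p"
  then obtain \<gamma> a b where g: "a < b" "fd_timelike_curve X \<gamma> {a..b}" "\<gamma> a = p" "\<gamma> b = q"
    unfolding Ifut_def by blast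
  note C = g(2)[unfolded fd_timelike_curve_def]
  obtain c where c: "c \<in> atlas X" "\<gamma> b \<in> fst c" using spacetime_cover[OF X] .
  note ch = spacetimeD(1)[OF X c(1)]
  obtain \<delta> where d: "\<delta> > 0" and P: "piece (fd_timelike_vec X c) c \<gamma> ({a..b} \<inter> {b-\<delta>..b+\<delta>})"
    using fd_curve_in_chart[OF X chart_invariant_timelike[OF X] C c(1) _ c(2)] g(1) by (metis atLeastAtMost_iff less_imp_le order_refl)
  define J where "J = {a..b} \<inter> {b-\<delta>..b+\<delta>}"
  define f where "f = snd c \<circ> \<gamma>"
  define y0 where "y0 = f b"
  have "b \<in> J" "max a (b - \<delta>) \<in> J" "max a (b - \<delta>) < b" using g(1) d by (auto simp: J_def)
  then obtain v where v: "(f has_vector_derivative v) (at b within (J \<inter> {..b}))" "fd_timelike_vec X c y0 v"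
    using piece_left_derivative[OF P[folded J_def]] unfolding f_def y0_def comp_apply by blast
  have y0: "y0 \<in> snd c ` fst c" using c by (simp add: y0_def f_def)
  obtain \<rho> where \<rho>: "\<rho> > 0" "ball y0 \<rho> \<subseteq> snd c ` fst c"
    "\<And>y w. y \<in> ball y0 \<rho> \<Longrightarrow> w \<in> ball v \<rho> \<Longrightarrow> fd_timelike_vec X c y w"
    by (rule timelike_nhd[OF X c(1) y0 v(2)]) (rule that)
  have "\<exists>d>0. \<forall>y\<in>J \<inter> {..b}. norm (y - b) < d \<longrightarrow> norm (f y - f b - (y - b) *\<^sub>R v) \<le> (\<rho> / 2) * norm (y - b)"
    using v(1) \<rho>(1) unfolding has_vector_derivative_def has_derivative_within_alt by (meson half_gt_zero)
  then obtain d' where d': "d' > 0"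
    "\<And>y. y \<in> J \<Longrightarrow> y \<le> b \<Longrightarrow> \<bar>y - b\<bar> < d' \<Longrightarrow> norm (f y - f b - (y - b) *\<^sub>R v) \<le> (\<rho> / 2) * \<bar>y - b\<bar>"
    by auto
  \<comment> \<open>The amount cut off. \<open>d' / 2\<close> puts the cut point where the
    difference quotient has error at most \<open>\<rho> / 2\<close>, \<open>\<delta>\<close> and
    \<open>(b - a) / 2\<close> keep it in the window and after \<open>a\<close>, and the last entry
    keeps \<open>f s\<close> within distance \<open>\<rho>\<close> of \<open>y0\<close>.\<close>
  define \<mu> where "\<mu> = min (min (d' / 2) \<delta>) (min ((b - a) / 2) (\<rho> / (2 * (norm v + \<rho>))))"
  define s where "s = b - \<mu>"
  have nv: "norm v + \<rho> > 0" using \<rho>(1) by (simp add: add_nonneg_pos)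
  have \<mu>: "\<mu> > 0" using d d' g(1) \<rho>(1) nv by (simp add: \<mu>_def)
  have \<mu>2: "\<mu> < d'" "\<mu> \<le> \<delta>" "\<mu> \<le> (b - a) / 2" "\<mu> \<le> \<rho> / (2 * (norm v + \<rho>))"
    using d'(1) unfolding \<mu>_def by linarith+
  have "\<mu> * (2 * (norm v + \<rho>)) \<le> \<rho>" using \<mu>2(4) nv by (simp add: pos_le_divide_eq)
  then have \<mu>3: "\<mu> * norm v + \<mu> * \<rho> < \<rho>" using \<rho>(1) by (simp add: algebra_simps)
  have s: "s \<in> J" "s < b" "a < s" using \<mu> \<mu>2 g(1) unfolding s_def J_def by auto
  have est: "norm (f s - y0 + \<mu> *\<^sub>R v) \<le> (\<rho> / 2) * \<mu>"
    using d'(2)[of s] s \<mu> \<mu>2(1) by (simp add: s_def y0_def)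
  have fs: "f s \<in> ball y0 \<rho>"
  proof -
    have "norm (f s - y0) \<le> norm (f s - y0 + \<mu> *\<^sub>R v) + norm (\<mu> *\<^sub>R v)"
      by (metis add_diff_cancel_right' norm_triangle_ineq4)
    also have "\<dots> \<le> (\<rho> / 2) * \<mu> + \<mu> * norm v" using est \<mu> by simp
    also have "\<dots> < \<rho>"
    proof -
      have "\<rho> / 2 * \<mu> = \<mu> * \<rho> / 2" "\<mu> * \<rho> > 0" using \<mu> \<rho>(1) by simp_all
      then show ?thesis using \<mu>3 by linarith
    qed
    finally show ?thesis by (simp add: dist_norm norm_minus_commute)
  qed
  have gs: "\<gamma> s \<in> fst c" using P s(1) unfolding piece_def J_def by blast
  have "fd_timelike_curve X \<gamma> {a..s}"
    unfolding fd_timelike_curve_def by (rule fd_curve_restrict[OF C]) (use s in auto)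
  then have ps: "\<gamma> s \<in> Ifut X p" unfolding Ifut_def using g(3) s(3) by blast
  \<comment> \<open>The error \<open>\<mu> * \<rho> / 2\<close> of the target point is the other
    half of the budget: divided by \<open>\<mu>\<close> it adds to the \<open>\<rho> / 2\<close>
    from the difference quotient, and the direction \<open>w\<close> stays in
    \<open>ball v \<rho>\<close>.\<close>
  define N where "N = {q \<in> fst c. snd c q \<in> ball y0 (min \<rho> (\<mu> * \<rho> / 2))}"
  have "open N" unfolding N_def by (rule open_chart_preimage[OF ch open_ball])
  moreover have "q \<in> N" using c g \<rho>(1) \<mu> by (simp add: N_def y0_def f_def)
  moreover have "N \<subseteq> Ifut X p"
  proof
    fix q' assume "q' \<in> N"
    then have q': "q' \<in> fst c" "norm (y0 - snd c q') < \<rho>" "norm (y0 - snd c q') < \<mu> * \<rho> / 2"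
      by (auto simp: N_def dist_norm)
    define w where "w = (1 / \<mu>) *\<^sub>R (snd c q' - f s)"
    have fw: "f s + \<mu> *\<^sub>R w = snd c q'" using \<mu> by (simp add: w_def)
    have "norm (v - w) * \<mu> = norm (\<mu> *\<^sub>R (v - w))" using \<mu> by simp
    also have "\<mu> *\<^sub>R (v - w) = (f s - y0 + \<mu> *\<^sub>R v) + (y0 - snd c q')"
      using fw by (simp add: algebra_simps)
    also have "norm \<dots> \<le> norm (f s - y0 + \<mu> *\<^sub>R v) + norm (y0 - snd c q')" by (rule norm_triangle_ineq)
    also have "\<dots> < \<rho> * \<mu>" using est q'(3) mult.commute[of \<mu> \<rho>] by linarith
    finally have "w \<in> ball v \<rho>" using \<mu> by (simp add: dist_norm)
    from \<rho>(3)[OF _ this]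
    have "unchart c (f s + \<mu> *\<^sub>R w) \<in> Ifut X (unchart c (f s))"
    proof (rule line_timelike[OF X c(1) \<mu> convex_ball \<rho>(2) fs, rotated])
      show "f s + \<mu> *\<^sub>R w \<in> ball y0 \<rho>" unfolding fw using q'(2) by (simp add: dist_norm)
    qed
    then have "q' \<in> Ifut X (\<gamma> s)" using unchart(1)[OF ch] q'(1) gs unfolding fw by (simp add: f_def)
    then show "q' \<in> Ifut X p" by (rule Ifut_trans[OF X ps])
  qed
  ultimately show "\<exists>T. open T \<and> q \<in> T \<and> T \<subseteq> Ifut X p" by blast
qed

lemma fd_timelike_torient:
  assumes "spacetime X" "c \<in> atlas X" "x \<in> snd c ` fst c"
  shows "fd_timelike_vec X c x (torient X c x)"
  using spacetimeD(5)[OF assms] by (simp add: fd_timelike_vec_def)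

text \<open>A short coordinate segment along the time orientation does it. Thus every point is a
  limit of points of its own future, and \<open>U = UNIV\<close> gives nonemptiness.\<close>

lemma Ifut_near:
  assumes X: "spacetime X" and U: "open U" "p \<in> U"
  shows "Ifut X p \<inter> U \<noteq> {}"
proof -
  obtain c where c: "c \<in> atlas X" "p \<in> fst c" using spacetime_cover[OF X] .
  note ch = spacetimeD(1)[OF X c(1)]
  let ?x = "snd c p"
  have x: "?x \<in> snd c ` fst c" using c by blast
  let ?T = "torient X c ?x"
  obtain \<rho> where \<rho>: "\<rho> > 0" "ball ?x \<rho> \<subseteq> snd c ` fst c"
    "\<And>y w. y \<in> ball ?x \<rho> \<Longrightarrow> w \<in> ball ?T \<rho> \<Longrightarrow> fd_timelike_vec X c y w"
    by (rule timelike_nhd[OF X c(1) x fd_timelike_torient[OF X c(1) x]]) (rule that)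
  have "open (snd c ` (U \<inter> fst c))" using chart_facts(1,6)[OF ch] U by auto
  moreover have "?x \<in> snd c ` (U \<inter> fst c)" using U c by blast
  ultimately obtain r where r: "r > 0" "ball ?x r \<subseteq> snd c ` (U \<inter> fst c)"
    using open_contains_ball by blast
  \<comment> \<open>Makes the segment at most half as long as either radius.\<close>
  define h where "h = min \<rho> r / (2 * (norm ?T + 1))"
  have h: "h > 0" using \<rho> r by (simp add: h_def add_nonneg_pos)
  have "h * norm ?T \<le> h * (2 * (norm ?T + 1)) / 2" using h by simp
  also have "h * (2 * (norm ?T + 1)) = min \<rho> r"
  proof -
    have "2 * (norm ?T + 1) \<noteq> 0" by (smt (verit) norm_ge_zero)
    then show ?thesis by (simp add: h_def)
  qed
  finally have hn: "h * norm ?T < \<rho>" "h * norm ?T < r" using \<rho> r by auto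
  have "unchart c (?x + h *\<^sub>R ?T) \<in> Ifut X (unchart c ?x)"
  proof (rule line_timelike[OF X c(1) h convex_ball \<rho>(2)])
    show "?x \<in> ball ?x \<rho>" "?x + h *\<^sub>R ?T \<in> ball ?x \<rho>" using \<rho>(1) h hn by (simp_all add: dist_norm)
    show "fd_timelike_vec X c y ?T" if "y \<in> ball ?x \<rho>" for y by (rule \<rho>(3)[OF that]) (simp add: \<rho>(1))
  qed
  moreover have "unchart c (?x + h *\<^sub>R ?T) \<in> U"
  proof -
    have "?x + h *\<^sub>R ?T \<in> ball ?x r" using hn h by (simp add: dist_norm)
    then obtain z where "z \<in> U" "z \<in> fst c" "?x + h *\<^sub>R ?T = snd c z" using r by blast
    then show ?thesis using unchart(1)[OF ch] by simp
  qed
  ultimately show ?thesis using unchart(1)[OF ch c(2)] by auto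
qed

lemma open_Ipast: "spacetime X \<Longrightarrow> open (Ipast X p)"
  using open_Ifut[OF spacetime_time_reverse, of X p] by (simp add: Ifut_time_reverse)

lemma Ipast_near: "spacetime X \<Longrightarrow> open U \<Longrightarrow> p \<in> U \<Longrightarrow> Ipast X p \<inter> U \<noteq> {}"
  using Ifut_near[OF spacetime_time_reverse, of X U p] by (simp add: Ifut_time_reverse)

section \<open>Displacing causal vectors\<close>

lemma C1_lipschitz_cball:
  fixes f :: "'v::euclidean_space \<Rightarrow> real"
  assumes f: "Ck_on (Suc 0) S f" and sub: "cball x0 r \<subseteq> S"
  shows "\<exists>L\<ge>0. \<forall>x\<in>cball x0 r. \<forall>y\<in>cball x0 r. \<bar>f y - f x\<bar> \<le> L * norm (y - x)"
proof -
  define f' where "f' x = frechet_derivative f (at x)" for x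
  have D: "(f has_derivative f' x) (at x)" if "x \<in> S" for x
    using f that by (simp add: f'_def frechet_derivative_works[symmetric])
  have c: "continuous_on S (\<lambda>x. f' x b)" if "b \<in> Basis" for b
    using f that by (simp add: f'_def)
  have "\<exists>M\<ge>0. \<forall>x\<in>cball x0 r. \<bar>f' x b\<bar> \<le> M" if "b \<in> Basis" for b
  proof -
    have "compact ((\<lambda>x. f' x b) ` cball x0 r)"
      by (rule compact_continuous_image[OF continuous_on_subset[OF c[OF that] sub] compact_cball])
    then have "bounded ((\<lambda>x. f' x b) ` cball x0 r)" by (rule compact_imp_bounded)
    then obtain M where M: "\<And>x. x \<in> cball x0 r \<Longrightarrow> \<bar>f' x b\<bar> \<le> M"
      unfolding bounded_iff real_norm_def by blast
    show ?thesis by (intro exI[of _ "\<bar>M\<bar>"] conjI ballI abs_ge_zero order_trans[OF M abs_ge_self])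
  qed
  then have "\<forall>b\<in>Basis. \<exists>M. M \<ge> 0 \<and> (\<forall>x\<in>cball x0 r. \<bar>f' x b\<bar> \<le> M)" by blast
  then obtain M where M: "\<And>b. b \<in> Basis \<Longrightarrow> M b \<ge> 0"
    "\<And>b x. b \<in> Basis \<Longrightarrow> x \<in> cball x0 r \<Longrightarrow> \<bar>f' x b\<bar> \<le> M b"
    by (metis (no_types, lifting))
  \<comment> \<open>Bounds for the partial derivatives add up to a bound for the operator
    norm.\<close>
  define L where "L = (\<Sum>b\<in>Basis. M b)"
  have L: "L \<ge> 0" unfolding L_def using M(1) by (rule sum_nonneg)
  have on: "onorm (f' x) \<le> L" if x: "x \<in> cball x0 r" for x
  proof (rule onorm_bound[OF L])
    fix v
    have lin: "linear (f' x)" using D x sub has_derivative_linear by blast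
    have "f' x v = f' x (\<Sum>b\<in>Basis. (v \<bullet> b) *\<^sub>R b)" by (simp add: euclidean_representation)
    also have "\<dots> = (\<Sum>b\<in>Basis. (v \<bullet> b) * f' x b)" using lin by (simp add: linear_sum linear_scale)
    finally have "norm (f' x v) \<le> (\<Sum>b\<in>Basis. norm ((v \<bullet> b) * f' x b))" by (simp only: norm_sum)
    also have "\<dots> \<le> (\<Sum>b\<in>Basis. norm v * M b)"
    proof (rule sum_mono)
      fix b :: 'v assume b: "b \<in> Basis"
      show "norm ((v \<bullet> b) * f' x b) \<le> norm v * M b"
        unfolding real_norm_def abs_mult
        using Basis_le_norm[OF b, of v] M(2)[OF b x] by (intro mult_mono) auto
    qed
    also have "\<dots> = L * norm v" unfolding L_def sum_distrib_right by (rule sum.cong) (rule refl, rule mult.commute)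
    finally show "norm (f' x v) \<le> L * norm v" .
  qed
  have "\<bar>f y - f x\<bar> \<le> L * norm (y - x)" if "x \<in> cball x0 r" "y \<in> cball x0 r" for x y
  proof -
    have "norm (f y - f x) \<le> L * norm (y - x)"
    proof (rule differentiable_bound[OF convex_cball, of x0 r f f'])
      show "(f has_derivative f' z) (at z within cball x0 r)" if "z \<in> cball x0 r" for z
        using D[of z] sub that has_derivative_at_withinI by blast
    qed (use on that in auto)
    then show ?thesis by simp
  qed
  with L show ?thesis by blast
qed

lemma metric_lipschitz:
  fixes X :: "('a::{t2_space, second_countable_topology}, 'v::euclidean_space) spacetime_data"
  assumes X: "spacetime X" and c: "c \<in> atlas X" and sub: "cball x0 r \<subseteq> snd c ` fst c"
  obtains L where "L \<ge> 0" "\<And>x y u v. x \<in> cball x0 r \<Longrightarrow> y \<in> cball x0 r \<Longrightarrow>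
    \<bar>metric X c y u v - metric X c x u v\<bar> \<le> L * norm (y - x) * norm u * norm v"
proof -
  let ?B = "(Basis :: 'v set) \<times> (Basis :: 'v set)"
  have "\<forall>z\<in>?B. \<exists>L. L \<ge> 0 \<and> (\<forall>x\<in>cball x0 r. \<forall>y\<in>cball x0 r.
      \<bar>metric X c y (fst z) (snd z) - metric X c x (fst z) (snd z)\<bar> \<le> L * norm (y - x))"
  proof
    fix z :: "'v \<times> 'v" assume "z \<in> ?B"
    then have "fst z \<in> Basis" "snd z \<in> Basis" by auto
    from C1_lipschitz_cball[OF metric_C1[OF X c this] sub]
    show "\<exists>L. L \<ge> 0 \<and> (\<forall>x\<in>cball x0 r. \<forall>y\<in>cball x0 r.
      \<bar>metric X c y (fst z) (snd z) - metric X c x (fst z) (snd z)\<bar> \<le> L * norm (y - x))" by blast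
  qed
  from bchoice[OF this] obtain M where M: "\<forall>z\<in>?B. M z \<ge> 0 \<and> (\<forall>x\<in>cball x0 r. \<forall>y\<in>cball x0 r.
      \<bar>metric X c y (fst z) (snd z) - metric X c x (fst z) (snd z)\<bar> \<le> M z * norm (y - x))" by blast
  define L where "L = (\<Sum>z\<in>?B. M z)"
  have L: "L \<ge> 0" unfolding L_def using M by (intro sum_nonneg) blast
  show ?thesis
  proof (rule that[OF L])
    fix x y u v :: 'v assume x: "x \<in> cball x0 r" and y: "y \<in> cball x0 r"
    have rep: "metric X c a u v = (\<Sum>z\<in>?B. (u \<bullet> fst z) * (v \<bullet> snd z) * metric X c a (fst z) (snd z))"
      if "a \<in> cball x0 r" for a
      using bilinear_Basis_sum[OF metric_bilinear(1)[OF X c], of a u v] that sub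
      by (auto simp: case_prod_unfold)
    have "\<bar>metric X c y u v - metric X c x u v\<bar> =
        \<bar>\<Sum>z\<in>?B. (u \<bullet> fst z) * (v \<bullet> snd z) * (metric X c y (fst z) (snd z) - metric X c x (fst z) (snd z))\<bar>"
      unfolding rep[OF x] rep[OF y] by (simp add: sum_subtractf right_diff_distrib)
    also have "\<dots> \<le> (\<Sum>z\<in>?B. \<bar>(u \<bullet> fst z) * (v \<bullet> snd z) * (metric X c y (fst z) (snd z) - metric X c x (fst z) (snd z))\<bar>)"
      by (rule sum_abs)
    also have "\<dots> \<le> (\<Sum>z\<in>?B. norm u * norm v * (M z * norm (y - x)))"
    proof (rule sum_mono)
      fix z assume z: "z \<in> ?B"
      then have "\<bar>u \<bullet> fst z\<bar> \<le> norm u" "\<bar>v \<bullet> snd z\<bar> \<le> norm v" by (auto intro: Basis_le_norm)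
      moreover have "\<bar>metric X c y (fst z) (snd z) - metric X c x (fst z) (snd z)\<bar> \<le> M z * norm (y - x)"
        using M z x y by blast
      ultimately show "\<bar>(u \<bullet> fst z) * (v \<bullet> snd z) * (metric X c y (fst z) (snd z) - metric X c x (fst z) (snd z))\<bar>
          \<le> norm u * norm v * (M z * norm (y - x))"
        unfolding abs_mult by (intro mult_mono) auto
    qed
    also have "\<dots> = L * norm (y - x) * norm u * norm v"
      by (simp add: L_def sum_distrib_left[symmetric] sum_distrib_right[symmetric] mult_ac)
    finally show "\<bar>metric X c y u v - metric X c x u v\<bar> \<le> L * norm (y - x) * norm u * norm v" .
  qed
qed

text \<open>The unit causal future directions over a closed ball form a compact set on which the
  product with \<open>T\<close> is negative, hence bounded away from 0; homogeneity extends the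
  bound to all causal vectors.\<close>

lemma causal_uniform_bound:
  fixes X :: "('a::{t2_space, second_countable_topology}, 'v::euclidean_space) spacetime_data"
  assumes X: "spacetime X" and c: "c \<in> atlas X" and sub: "cball x0 r \<subseteq> snd c ` fst c"
    and T: "\<And>x. x \<in> cball x0 r \<Longrightarrow> fd_timelike_vec X c x T"
  obtains \<kappa> where "\<kappa> > 0"
    "\<And>x v. x \<in> cball x0 r \<Longrightarrow> fd_causal_vec X c x v \<Longrightarrow> metric X c x v T \<le> - \<kappa> * norm v"
proof -
  let ?O = "snd c ` fst c"
  let ?K = "cball x0 r \<times> sphere (0::'v) 1"
  \<comment> \<open>Admitting equality in the orientation condition makes the set closed; equality
    is excluded afterwards, since a nonzero causal vector is never orthogonal to a timelike
    one.\<close>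
  define C where "C = ?K \<inter> ({z\<in>?K. metric X c (fst z) (snd z) (snd z) \<le> 0} \<inter>
     {z\<in>?K. metric X c (fst z) (snd z) (torient X c (fst z)) \<le> 0})"
  have im: "fst z \<in> ?O" if "z \<in> ?K" for z using that sub by auto
  have cT: "continuous_on ?K (\<lambda>z. torient X c (fst z))"
    by (rule continuous_on_compose2[OF spacetimeD(4)[OF X c] continuous_on_fst[OF continuous_on_id]]) (use sub in auto)
  have 1: "continuous_on ?K (\<lambda>z. metric X c (fst z) (snd z) (snd z))"
    by (rule continuous_on_metric[OF X c _ _ _ im]) (auto intro!: continuous_intros)
  have 2: "continuous_on ?K (\<lambda>z. metric X c (fst z) (snd z) (torient X c (fst z)))"
    by (rule continuous_on_metric[OF X c _ _ cT im]) (auto intro!: continuous_intros)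
  have 3: "continuous_on ?K (\<lambda>z. metric X c (fst z) (snd z) T)"
    by (rule continuous_on_metric[OF X c _ _ _ im]) (auto intro!: continuous_intros)
  have K: "compact ?K" by (intro compact_Times compact_cball compact_sphere)
  have clK: "closed ?K" using K by (rule compact_imp_closed)
  have "compact C" unfolding C_def
    by (intro compact_Int_closed[OF K] closed_Int
        continuous_on_closed_Collect_le[OF 1 continuous_on_const clK]
        continuous_on_closed_Collect_le[OF 2 continuous_on_const clK])
  moreover have "C \<subseteq> ?K" by (auto simp: C_def)
  moreover have neg: "metric X c (fst z) (snd z) T < 0" if "z \<in> C" for z
  proof -
    from that have z: "z \<in> ?K" and m: "metric X c (fst z) (snd z) (snd z) \<le> 0"
      "metric X c (fst z) (snd z) (torient X c (fst z)) \<le> 0" by (auto simp: C_def)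
    have x: "fst z \<in> ?O" "fst z \<in> cball x0 r" and v: "snd z \<noteq> 0" using z sub by auto
    note lf = spacetimeD(2)[OF X c x(1)] and to = spacetimeD(5)[OF X c x(1)]
    have "metric X c (fst z) (snd z) (torient X c (fst z)) \<noteq> 0"
      by (rule lorentz_causal_timelike_nonzero[OF lf to m(1) v])
    with m(2) have vt: "metric X c (fst z) (snd z) (torient X c (fst z)) < 0" by simp
    have "metric X c (fst z) T T < 0" "metric X c (fst z) T (torient X c (fst z)) < 0"
      using T[OF x(2)] by (simp_all add: fd_timelike_vec_def)
    then show ?thesis by (rule lorentz_same_cone[OF lf to _ m(1) v _ vt])
  qed
  ultimately obtain \<kappa> where \<kappa>: "\<kappa> > 0" "\<And>z. z \<in> C \<Longrightarrow> metric X c (fst z) (snd z) T \<le> - \<kappa>"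
  proof (cases "C = {}")
    case True then show ?thesis using that[of 1] by simp
  next
    case False
    obtain z0 where z0: "z0 \<in> C" "\<And>z. z \<in> C \<Longrightarrow> metric X c (fst z) (snd z) T \<le> metric X c (fst z0) (snd z0) T"
      using continuous_attains_sup[OF \<open>compact C\<close> False continuous_on_subset[OF 3 \<open>C \<subseteq> ?K\<close>]] by blast
    show ?thesis using that[of "- metric X c (fst z0) (snd z0) T"] z0 neg[OF z0(1)] by auto
  qed
  show ?thesis
  proof (rule that[OF \<kappa>(1)])
    fix x v assume x: "x \<in> cball x0 r" and v: "fd_causal_vec X c x v"
    then have v0: "v \<noteq> 0" by (simp add: fd_causal_vec_def)
    have bl: "bilinear (metric X c x)" using metric_bilinear(1)[OF X c] x sub by blast
    define w where "w = (1 / norm v) *\<^sub>R v"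
    have "(x, w) \<in> C"
      using x v v0 unfolding C_def w_def fd_causal_vec_def
      by (auto simp: bilinear_lmul[OF bl] bilinear_rmul[OF bl] divide_nonpos_nonneg)
    from \<kappa>(2)[OF this] have "metric X c x v T / norm v \<le> - \<kappa>"
      by (simp add: w_def bilinear_lmul[OF bl])
    then show "metric X c x v T \<le> - \<kappa> * norm v" using v0 by (simp add: pos_divide_le_eq)
  qed
qed

text \<open>Adding to x a multiple of a fixed timelike vector T that grows along causal curves (at a rate
  beating the Lipschitz constant of the metric) turns causal vectors into timelike ones. This
  replaces the use of geodesics in the push-up property.\<close>
lemma chart_displacement:
  assumes X: "spacetime X" and c: "c \<in> atlas X" and x0: "x0 \<in> snd c ` fst c"
  obtains T l r r' \<epsilon>0 where "r > 0" "r' > 0" "\<epsilon>0 > 0" "linear l" "ball x0 r \<subseteq> snd c ` fst c" "r' \<le> r"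
    "\<And>y. y \<in> ball x0 r \<Longrightarrow> fd_timelike_vec X c y T"
    "\<And>x. x \<in> ball x0 r' \<Longrightarrow> \<bar>l (x - x0)\<bar> \<le> 1 / 2"
    "\<And>x \<epsilon>. x \<in> ball x0 r' \<Longrightarrow> 0 < \<epsilon> \<Longrightarrow> \<epsilon> < \<epsilon>0 \<Longrightarrow> x + (\<epsilon> * (1 + l (x - x0))) *\<^sub>R T \<in> ball x0 r"
    "\<And>x v \<epsilon>. x \<in> ball x0 r' \<Longrightarrow> 0 < \<epsilon> \<Longrightarrow> \<epsilon> < \<epsilon>0 \<Longrightarrow> fd_causal_vec X c x v \<Longrightarrow>
      fd_timelike_vec X c (x + (\<epsilon> * (1 + l (x - x0))) *\<^sub>R T) (v + (\<epsilon> * l v) *\<^sub>R T)"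
proof -
  \<comment> \<open>The value of the time orientation at \<open>x0\<close>, used as a constant
    vector on the whole ball, where openness keeps it timelike and future-directed.\<close>
  define T where "T = torient X c x0"
  obtain \<rho> where \<rho>: "\<rho> > 0" "ball x0 \<rho> \<subseteq> snd c ` fst c"
    "\<And>y w. y \<in> ball x0 \<rho> \<Longrightarrow> w \<in> ball T \<rho> \<Longrightarrow> fd_timelike_vec X c y w"
    by (rule timelike_nhd[OF X c x0 fd_timelike_torient[OF X c x0], folded T_def]) (rule that)
  define r1 where "r1 = \<rho> / 2"
  have r1: "r1 > 0" and sub0: "cball x0 r1 \<subseteq> ball x0 \<rho>" using \<rho>(1) by (auto simp: r1_def)
  have sub: "cball x0 r1 \<subseteq> snd c ` fst c" using sub0 \<rho>(2) by (rule order_trans)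
  have tT: "fd_timelike_vec X c y T" if "y \<in> cball x0 r1" for y
    by (rule \<rho>(3)) (use that sub0 \<rho>(1) in auto)
  obtain L where L: "L \<ge> 0" "\<And>x y u v. x \<in> cball x0 r1 \<Longrightarrow> y \<in> cball x0 r1 \<Longrightarrow>
    \<bar>metric X c y u v - metric X c x u v\<bar> \<le> L * norm (y - x) * norm u * norm v"
    by (rule metric_lipschitz[OF X c sub]) (rule that)
  obtain k where k: "k > 0"
    "\<And>x v. x \<in> cball x0 r1 \<Longrightarrow> fd_causal_vec X c x v \<Longrightarrow> metric X c x v T \<le> - k * norm v"
    by (rule causal_uniform_bound[OF X c sub tT]) (assumption, rule that)
  \<comment> \<open>Half of the bound is sacrificed so that the metric may be evaluated at a base
    point other than that of the causal vector.\<close>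
  define \<kappa> where "\<kappa> = k / 2"
  have \<kappa>: "\<kappa> > 0" using k by (simp add: \<kappa>_def)
  define N where "N = norm T"
  have N: "N \<ge> 0" by (simp add: N_def)
  have LN: "L * N \<ge> 0" using L(1) N by simp
  \<comment> \<open>Two points of the ball are at most \<open>2 * r\<close> apart, so exchanging
    base points changes the product of \<open>v\<close> with \<open>T\<close> by at most
    \<open>\<kappa> * norm v\<close>.\<close>
  define r where "r = min r1 (\<kappa> / (2 * (L * N + 1)))"
  have r: "r > 0" using r1 \<kappa> LN by (simp add: r_def)
  have rr: "ball x0 r \<subseteq> cball x0 r1" by (auto simp: r_def)
  have rL: "L * N * (2 * r) \<le> \<kappa>"
  proof -
    have "r \<le> \<kappa> / (2 * (L * N + 1))" by (simp add: r_def)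
    then have "r * (2 * (L * N + 1)) \<le> \<kappa>" using LN by (simp add: pos_le_divide_eq)
    then show ?thesis using r by (simp add: algebra_simps)
  qed
  have lf: "metric X c y v T \<le> - \<kappa> * norm v"
    if x: "x \<in> ball x0 r" and y: "y \<in> ball x0 r" and v: "fd_causal_vec X c x v" for x y v
  proof -
    have "dist y x \<le> dist y x0 + dist x x0" by (rule dist_triangle2)
    then have "norm (y - x) \<le> 2 * r" using x y by (simp add: dist_norm norm_minus_commute)
    then have "L * norm (y - x) * norm v * N \<le> L * (2 * r) * norm v * N"
      using L(1) N by (intro mult_right_mono mult_left_mono) auto
    also have "\<dots> = (L * N * (2 * r)) * norm v" by simp
    also have "\<dots> \<le> \<kappa> * norm v" using rL by (rule mult_right_mono) simp
    finally have "metric X c y v T - metric X c x v T \<le> \<kappa> * norm v"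
      using L(2)[of x y v T] x y rr unfolding N_def by (smt (verit) subsetD)
    moreover have "metric X c x v T \<le> - k * norm v" using k(2) x rr v by blast
    ultimately show ?thesis by (simp add: \<kappa>_def)
  qed
  \<comment> \<open>Balances two effects of first order in \<open>\<epsilon>\<close>. Moving the
    base point can raise \<open>metric X c y v v\<close> by
    \<open>2 * \<epsilon> * (L * N) * n\<^sup>2\<close>, and the growing displacement contributes a
    gain of at least \<open>2 * \<epsilon> * (K * \<kappa>\<^sup>2) * n\<^sup>2\<close>; with this
    \<open>K\<close> a surplus \<open>2 * \<epsilon> * n\<^sup>2\<close> is left.\<close>
  define K where "K = (L * N + 1) / \<kappa>\<^sup>2"
  have K: "K > 0" "K * \<kappa>\<^sup>2 = L * N + 1" using LN \<kappa> by (simp_all add: K_def)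
  have bl: "bilinear (metric X c y)" if "y \<in> ball x0 r" for y
    using metric_bilinear(1)[OF X c] that rr sub by blast
  have x0r: "x0 \<in> ball x0 r" using r by simp
  \<comment> \<open>The growth rate of the displacement. Linearity makes its derivative explicit,
    and the sign makes it at least \<open>K * \<kappa> * norm v\<close> on causal vectors.\<close>
  define l where "l v = - K * metric X c x0 v T" for v
  have lin: "linear l"
    by (rule linearI) (simp_all add: l_def bilinear_ladd[OF bl[OF x0r]] bilinear_lmul[OF bl[OF x0r]] algebra_simps)
  have lK: "l v \<ge> K * (\<kappa> * norm v)" if "x \<in> ball x0 r" "fd_causal_vec X c x v" for x v
    using mult_left_mono[OF lf[OF that(1) x0r that(2)], of K] K(1) by (simp add: l_def)
  have "bounded_linear l" using lin by (rule linear_conv_bounded_linear[THEN iffD1])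
  then obtain M where M: "M > 0" "\<And>v. \<bar>l v\<bar> \<le> norm v * M"
    using bounded_linear.pos_bounded[of l] by auto
  \<comment> \<open>The second entry keeps the factor \<open>1 + l (x - x0)\<close> between 1/2 and
    3/2; the first reserves half of the larger ball for the displacement.\<close>
  define r' where "r' = min (r / 2) (1 / (2 * M))"
  have r': "r' > 0" "r' \<le> r" using r M by (auto simp: r'_def)
  have small: "\<bar>l (x - x0)\<bar> \<le> 1 / 2" if "x \<in> ball x0 r'" for x
  proof -
    have "norm (x - x0) \<le> 1 / (2 * M)" using that by (simp add: r'_def dist_norm norm_minus_commute)
    then have "norm (x - x0) * M \<le> 1 / (2 * M) * M" using M(1) by (intro mult_right_mono) auto
    also have "\<dots> = 1 / 2" using M(1) by simp
    finally show ?thesis using M(2)[of "x - x0"] by linarith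
  qed
  \<comment> \<open>The displacement has length at most \<open>2 * \<epsilon> * N\<close>, hence at
    most \<open>r / 2\<close>.\<close>
  define \<epsilon>0 where "\<epsilon>0 = r / (4 * (N + 1))"
  have e0: "\<epsilon>0 > 0" using r N by (simp add: \<epsilon>0_def)
  have h: "0 < \<epsilon> * (1 + l (x - x0))" "\<epsilon> * (1 + l (x - x0)) \<le> 2 * \<epsilon>" if "x \<in> ball x0 r'" "\<epsilon> > 0" for x \<epsilon>
  proof -
    have "0 < 1 + l (x - x0)" "1 + l (x - x0) \<le> 2" using small[OF that(1)] by linarith+
    then show "0 < \<epsilon> * (1 + l (x - x0))" "\<epsilon> * (1 + l (x - x0)) \<le> 2 * \<epsilon>" using that(2) by auto
  qed
  have ball: "x + (\<epsilon> * (1 + l (x - x0))) *\<^sub>R T \<in> ball x0 r"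
    if "x \<in> ball x0 r'" "\<epsilon> > 0" "\<epsilon> < \<epsilon>0" for x \<epsilon>
  proof -
    have "norm ((\<epsilon> * (1 + l (x - x0))) *\<^sub>R T) = \<epsilon> * (1 + l (x - x0)) * N"
      using h(1)[OF that(1,2)] by (simp add: N_def)
    also have "\<dots> \<le> 2 * \<epsilon> * N" using h(2)[OF that(1,2)] N by (rule mult_right_mono)
    also have "\<dots> \<le> 2 * \<epsilon>0 * (N + 1)" using that(2,3) N by (intro mult_mono) auto
    also have "\<dots> = r / 2" using N by (simp add: \<epsilon>0_def field_simps)
    finally have 1: "norm ((\<epsilon> * (1 + l (x - x0))) *\<^sub>R T) \<le> r / 2" .
    have "norm (x - x0) < r / 2" using that(1) by (simp add: r'_def dist_norm norm_minus_commute)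
    with 1 norm_triangle_ineq[of "x - x0" "(\<epsilon> * (1 + l (x - x0))) *\<^sub>R T"]
    have "norm ((x - x0) + (\<epsilon> * (1 + l (x - x0))) *\<^sub>R T) < r" by linarith
    then show ?thesis by (simp add: dist_norm norm_minus_commute[of x0] algebra_simps)
  qed
  show ?thesis
  proof (rule that[of r r' \<epsilon>0 l T])
    show "r > 0" "r' > 0" "\<epsilon>0 > 0" "linear l" "r' \<le> r" by fact+
    show "ball x0 r \<subseteq> snd c ` fst c" using rr sub by (rule order_trans)
    show "fd_timelike_vec X c y T" if "y \<in> ball x0 r" for y using tT that rr by blast
    show "\<bar>l (x - x0)\<bar> \<le> 1 / 2" if "x \<in> ball x0 r'" for x by (rule small[OF that])
    show "x + (\<epsilon> * (1 + l (x - x0))) *\<^sub>R T \<in> ball x0 r"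
      if "x \<in> ball x0 r'" "\<epsilon> > 0" "\<epsilon> < \<epsilon>0" for x \<epsilon> by (rule ball[OF that])
    fix x v \<epsilon> assume x: "x \<in> ball x0 r'" and e: "0 < \<epsilon>" "\<epsilon> < \<epsilon>0" and v: "fd_causal_vec X c x v"
    define H where "H = \<epsilon> * (1 + l (x - x0))"
    define y where "y = x + H *\<^sub>R T"
    define m where "m = \<epsilon> * l v"
    define w where "w = v + m *\<^sub>R T"
    define n where "n = norm v"
    have H: "H > 0" "H \<le> 2 * \<epsilon>" using h[OF x e(1)] by (simp_all add: H_def)
    have y: "y \<in> ball x0 r" using ball[OF x e] by (simp add: y_def H_def)
    have x': "x \<in> ball x0 r" using x r'(2) by auto
    have v0: "v \<noteq> 0" using v by (simp add: fd_causal_vec_def)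
    then have n: "n > 0" by (simp add: n_def)
    note B = bl[OF y]
    have yO: "y \<in> snd c ` fst c" "y \<in> cball x0 r1" using y rr sub by blast+
    have m: "m \<ge> \<epsilon> * (K * (\<kappa> * n))" using lK[OF x' v] e(1) by (simp add: m_def n_def)
    have "\<epsilon> * (K * (\<kappa> * n)) > 0" using e(1) K(1) \<kappa> n by simp
    with m have m0: "m > 0" by linarith
    have vT: "metric X c y v T \<le> - \<kappa> * n" using lf[OF x' y v] by (simp add: n_def)
    have vT0: "metric X c y v T < 0" using vT mult_pos_pos[OF \<kappa> n] by linarith
    have TT: "metric X c y T T < 0" and TU: "metric X c y T (torient X c y) < 0"
      using tT[OF yO(2)] by (auto simp: fd_timelike_vec_def)
    have vv: "metric X c y v v \<le> 2 * \<epsilon> * (L * N) * n\<^sup>2"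
    proof -
      have "metric X c y v v \<le> metric X c x v v + L * norm (y - x) * norm v * norm v"
        using L(2)[of x y v v] x' y rr by (smt (verit) subsetD)
      also have "\<dots> \<le> L * norm (y - x) * norm v * norm v" using v by (simp add: fd_causal_vec_def)
      also have "\<dots> = (L * N) * H * n\<^sup>2" using H(1) by (simp add: y_def N_def n_def power2_eq_square)
      also have "\<dots> \<le> (L * N) * (2 * \<epsilon>) * n\<^sup>2"
        using LN H(2) by (intro mult_right_mono mult_left_mono) auto
      finally show ?thesis by (simp add: mult_ac)
    qed
    \<comment> \<open>Of the three terms, the first is the loss from moving the base point, the
      second the gain from growth, and the third is not positive because \<open>T\<close> is
      timelike.\<close>
    have "metric X c y w w = metric X c y v v + 2 * m * metric X c y v T + m\<^sup>2 * metric X c y T T"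
      unfolding w_def using metric_bilinear(2)[OF X c yO(1), of T v]
      by (simp add: bilinear_ladd[OF B] bilinear_radd[OF B] bilinear_lmul[OF B] bilinear_rmul[OF B]
          power2_eq_square algebra_simps)
    also have "\<dots> \<le> 2 * \<epsilon> * (L * N) * n\<^sup>2 - 2 * (\<epsilon> * (K * \<kappa>\<^sup>2) * n\<^sup>2)"
    proof -
      have "m\<^sup>2 * metric X c y T T \<le> 0" using TT by (simp add: mult_nonneg_nonpos)
      moreover have "(\<epsilon> * (K * (\<kappa> * n))) * (\<kappa> * n) \<le> m * (- metric X c y v T)"
        using m vT m0 \<kappa> n by (intro mult_mono) auto
      then have "\<epsilon> * (K * \<kappa>\<^sup>2) * n\<^sup>2 \<le> - (m * metric X c y v T)" by (simp add: power2_eq_square mult_ac)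
      ultimately show ?thesis using vv by linarith
    qed
    also have "\<dots> = - 2 * (\<epsilon> * n\<^sup>2)" unfolding K(2) by (simp add: algebra_simps)
    also have "\<dots> < 0" using e(1) n by simp
    finally have ww: "metric X c y w w < 0" .
    have wT: "metric X c y w T < 0"
      unfolding w_def bilinear_ladd[OF B] bilinear_lmul[OF B]
      using vT0 mult_pos_neg[OF m0 TT] by simp
    have "w \<noteq> 0" using ww by (auto simp: bilinear_lzero[OF B])
    \<comment> \<open>The orientation of \<open>w\<close> is known relative to \<open>T\<close>;
      \<open>T\<close> and the time orientation at \<open>y\<close> share a cone, so the sign
      carries over.\<close>
    then have "metric X c y w (torient X c y) < 0"
      using lorentz_same_cone[OF spacetimeD(2)[OF X c yO(1)] TT spacetimeD(5)[OF X c yO(1)] less_imp_le[OF ww] _ _ wT]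
        TU metric_bilinear(2)[OF X c yO(1), of T] by auto
    with ww show "fd_timelike_vec X c (x + (\<epsilon> * (1 + l (x - x0))) *\<^sub>R T) (v + (\<epsilon> * l v) *\<^sub>R T)"
      by (simp add: fd_timelike_vec_def y_def w_def H_def m_def)
  qed
qed

section \<open>Local causal structure\<close>

text \<open>The coordinate-free extract of the chart computation: a family of maps moving points
  arbitrarily little into their own futures, and carrying causal curves to curves that witness a
  chronological relation.\<close>

lemma displacement:
  fixes X :: "('a::{t2_space, second_countable_topology}, 'v::euclidean_space) spacetime_data"
  assumes X: "spacetime X"
  obtains W :: "'a set" and \<Psi> :: "real \<Rightarrow> 'a \<Rightarrow> 'a" and \<epsilon>0 :: real
  where "open W" "p \<in> W" "\<epsilon>0 > 0"
    "\<And>\<epsilon>. 0 < \<epsilon> \<Longrightarrow> \<epsilon> < \<epsilon>0 \<Longrightarrow> continuous_on W (\<Psi> \<epsilon>)"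
    "\<And>x \<epsilon>. x \<in> W \<Longrightarrow> 0 < \<epsilon> \<Longrightarrow> \<epsilon> < \<epsilon>0 \<Longrightarrow> \<Psi> \<epsilon> x \<in> Ifut X x"
    "\<And>x U. x \<in> W \<Longrightarrow> open U \<Longrightarrow> x \<in> U \<Longrightarrow> \<exists>\<epsilon>. 0 < \<epsilon> \<and> \<epsilon> < \<epsilon>0 \<and> \<Psi> \<epsilon> x \<in> U"
    "\<And>\<gamma> a b \<epsilon>. fd_causal_curve X \<gamma> {a..b} \<Longrightarrow> \<gamma> ` {a..b} \<subseteq> W \<Longrightarrow> 0 < \<epsilon> \<Longrightarrow> \<epsilon> < \<epsilon>0 \<Longrightarrow>
      \<Psi> \<epsilon> (\<gamma> b) \<in> Ifut X (\<Psi> \<epsilon> (\<gamma> a))"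
proof -
  obtain c where c: "c \<in> atlas X" "p \<in> fst c" using spacetime_cover[OF X] .
  note ch = spacetimeD(1)[OF X c(1)]
  define x0 where "x0 = snd c p"
  have x0: "x0 \<in> snd c ` fst c" using c by (simp add: x0_def)
  obtain T l r r' \<epsilon>0 where r: "r > 0" "r' > 0" "\<epsilon>0 > 0" and lin: "linear l"
    and sub: "ball x0 r \<subseteq> snd c ` fst c" "r' \<le> r"
    and T: "\<And>y. y \<in> ball x0 r \<Longrightarrow> fd_timelike_vec X c y T"
    and small: "\<And>x. x \<in> ball x0 r' \<Longrightarrow> \<bar>l (x - x0)\<bar> \<le> 1 / 2"
    and bl: "\<And>x \<epsilon>. x \<in> ball x0 r' \<Longrightarrow> 0 < \<epsilon> \<Longrightarrow> \<epsilon> < \<epsilon>0 \<Longrightarrow> x + (\<epsilon> * (1 + l (x - x0))) *\<^sub>R T \<in> ball x0 r"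
    and vec: "\<And>x v \<epsilon>. x \<in> ball x0 r' \<Longrightarrow> 0 < \<epsilon> \<Longrightarrow> \<epsilon> < \<epsilon>0 \<Longrightarrow> fd_causal_vec X c x v \<Longrightarrow>
      fd_timelike_vec X c (x + (\<epsilon> * (1 + l (x - x0))) *\<^sub>R T) (v + (\<epsilon> * l v) *\<^sub>R T)"
    by (rule chart_displacement[OF X c(1) x0]) (rule that)
  define A where "A \<epsilon> x = x + (\<epsilon> * (1 + l (x - x0))) *\<^sub>R T" for \<epsilon> x
  define W where "W = {q \<in> fst c. snd c q \<in> ball x0 r'}"
  define \<Psi> where "\<Psi> \<epsilon> q = unchart c (A \<epsilon> (snd c q))" for \<epsilon> q
  have bll: "bounded_linear l" using lin by (rule linear_conv_bounded_linear[THEN iffD1])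
  have cl: "continuous_on S l" for S by (rule linear_continuous_on[OF bll])
  have cA: "continuous_on S (A \<epsilon>)" for S \<epsilon>
    unfolding A_def by (intro continuous_intros continuous_on_compose2[OF cl[of UNIV]]) auto
  have Ain: "A \<epsilon> x \<in> ball x0 r" "A \<epsilon> x \<in> snd c ` fst c" if "x \<in> ball x0 r'" "0 < \<epsilon>" "\<epsilon> < \<epsilon>0" for x \<epsilon>
    using bl[OF that] sub by (auto simp: A_def)
  have Wf: "q \<in> fst c" "snd c q \<in> ball x0 r'" if "q \<in> W" for q using that by (simp_all add: W_def)
  have P: "\<Psi> \<epsilon> q \<in> fst c" "snd c (\<Psi> \<epsilon> q) = A \<epsilon> (snd c q)" if "q \<in> W" "0 < \<epsilon>" "\<epsilon> < \<epsilon>0" for q \<epsilon>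
    using unchart(2,3)[OF ch Ain(2)[OF Wf(2)[OF that(1)] that(2,3)]] by (simp_all add: \<Psi>_def)
  have cP: "continuous_on W (\<Psi> \<epsilon>)" if "0 < \<epsilon>" "\<epsilon> < \<epsilon>0" for \<epsilon>
  proof -
    have 1: "continuous_on W (snd c)"
      by (rule continuous_on_subset[OF chart_facts(4)[OF ch]]) (use Wf in blast)
    have 2: "continuous_on W (\<lambda>q. A \<epsilon> (snd c q))"
      by (rule continuous_on_compose2[OF cA[of UNIV] 1]) simp
    show ?thesis unfolding \<Psi>_def
      by (rule continuous_on_compose2[OF chart_facts(5)[OF ch] 2]) (use Ain(2)[OF Wf(2) that] in blast)
  qed
  show ?thesis
  proof (rule that[of W \<epsilon>0 \<Psi>])
    show "open W" unfolding W_def by (rule open_chart_preimage[OF ch open_ball])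
    show "p \<in> W" using c r by (simp add: W_def x0_def)
    show "\<epsilon>0 > 0" by (rule r(3))
    show "continuous_on W (\<Psi> \<epsilon>)" if "0 < \<epsilon>" "\<epsilon> < \<epsilon>0" for \<epsilon> by (rule cP[OF that])
  next
    fix x \<epsilon> assume x: "x \<in> W" and e: "0 < \<epsilon>" "\<epsilon> < \<epsilon>0"
    define h where "h = \<epsilon> * (1 + l (snd c x - x0))"
    have "\<bar>l (snd c x - x0)\<bar> \<le> 1 / 2" by (rule small[OF Wf(2)[OF x]])
    then have "1 + l (snd c x - x0) > 0" by linarith
    then have h: "h > 0" unfolding h_def using e(1) by simp
    have "unchart c (snd c x + h *\<^sub>R T) \<in> Ifut X (unchart c (snd c x))"
    proof (rule line_timelike[OF X c(1) h convex_ball sub(1)])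
      show "snd c x \<in> ball x0 r" using Wf(2)[OF x] sub(2) by simp
      show "snd c x + h *\<^sub>R T \<in> ball x0 r" using Ain(1)[OF Wf(2)[OF x] e] by (simp add: A_def h_def)
    qed (rule T)
    then show "\<Psi> \<epsilon> x \<in> Ifut X x" using unchart(1)[OF ch Wf(1)[OF x]] by (simp add: \<Psi>_def A_def h_def)
  next
    fix x U assume x: "x \<in> W" and U: "open U" "x \<in> U"
    have "open (snd c ` (U \<inter> fst c))" using chart_facts(1,6)[OF ch] U by auto
    moreover have "snd c x \<in> snd c ` (U \<inter> fst c)" using U Wf(1)[OF x] by blast
    \<comment> \<open>As \<open>\<epsilon>\<close> decreases to 0, the displacement tends to the
      identity.\<close>
    moreover have "((\<lambda>\<epsilon>. A \<epsilon> (snd c x)) \<longlongrightarrow> A 0 (snd c x)) (at_right 0)"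
      unfolding A_def by (intro tendsto_intros)
    then have "((\<lambda>\<epsilon>. A \<epsilon> (snd c x)) \<longlongrightarrow> snd c x) (at_right 0)" by (simp add: A_def)
    ultimately have "eventually (\<lambda>\<epsilon>. A \<epsilon> (snd c x) \<in> snd c ` (U \<inter> fst c)) (at_right 0)"
      by (metis topological_tendstoD)
    moreover have "eventually (\<lambda>\<epsilon>. \<epsilon> < \<epsilon>0 \<and> 0 < \<epsilon>) (at_right (0::real))"
      using eventually_at_right_less[of "0::real"] eventually_at_right_real[OF r(3)]
      by (auto elim: eventually_elim2)
    ultimately have "eventually (\<lambda>\<epsilon>. A \<epsilon> (snd c x) \<in> snd c ` (U \<inter> fst c) \<and> \<epsilon> < \<epsilon>0 \<and> 0 < \<epsilon>) (at_right 0)"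
      by (rule eventually_conj)
    then obtain \<epsilon> where e: "A \<epsilon> (snd c x) \<in> snd c ` (U \<inter> fst c)" "\<epsilon> < \<epsilon>0" "0 < \<epsilon>"
      using eventually_happens'[OF trivial_limit_at_right_real] by blast
    then obtain z where "z \<in> U" "z \<in> fst c" "A \<epsilon> (snd c x) = snd c z" by blast
    then have "\<Psi> \<epsilon> x \<in> U" using unchart(1)[OF ch] by (simp add: \<Psi>_def)
    with e show "\<exists>\<epsilon>. 0 < \<epsilon> \<and> \<epsilon> < \<epsilon>0 \<and> \<Psi> \<epsilon> x \<in> U" by blast
  next
    fix \<gamma> a b \<epsilon> assume g: "fd_causal_curve X \<gamma> {a..b}" "\<gamma> ` {a..b} \<subseteq> W" and e: "0 < \<epsilon>" "\<epsilon> < \<epsilon>0"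
    note C = g(1)[unfolded fd_causal_curve_def]
    have gW: "\<gamma> t \<in> W" if "t \<in> {a..b}" for t using g(2) that by blast
    have ab: "a < b" using fd_curveD(2)[OF C] by force
    have "fd_curve X (fd_timelike_vec X) (\<lambda>t. \<Psi> \<epsilon> (\<gamma> t)) {a..b}"
      unfolding fd_curve_iff_piece
    proof (intro conjI ballI)
      show "\<exists>u\<in>{a..b}. \<exists>v\<in>{a..b}. u < v" by (rule fd_curveD(2)[OF C])
      show "continuous_on {a..b} (\<lambda>t. \<Psi> \<epsilon> (\<gamma> t))"
        by (rule continuous_on_compose2[OF cP[OF e] fd_curveD(3)[OF C] g(2)])
      fix t assume t: "t \<in> {a..b}"
      obtain \<delta> where d: "\<delta> > 0" "piece (fd_causal_vec X c) c \<gamma> ({a..b} \<inter> {t-\<delta>..t+\<delta>})"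
        by (rule fd_curve_in_chart[OF X chart_invariant_causal[OF X] C c(1) t Wf(1)[OF gW[OF t]]])
      have "piece (fd_timelike_vec X c) c (\<lambda>t. \<Psi> \<epsilon> (\<gamma> t)) {max a (t-\<delta>)..min b (t+\<delta>)}"
      proof (rule piece_map[where U = "ball x0 r'" and \<Psi> = "A \<epsilon>" and \<Psi>' = "\<lambda>x v. v + (\<epsilon> * l v) *\<^sub>R T"])
        show "piece (fd_causal_vec X c) c \<gamma> {max a (t-\<delta>)..min b (t+\<delta>)}"
          using d(2) by (simp only: Int_atLeastAtMost)
        show "continuous_on (ball x0 r') (\<lambda>x. v + (\<epsilon> * l v) *\<^sub>R T)" for v by (rule continuous_on_const)
        have lD: "(l has_derivative l) F" for F by (rule bounded_linear_imp_has_derivative[OF bll])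
        show "(A \<epsilon> has_derivative (\<lambda>v. v + (\<epsilon> * l v) *\<^sub>R T)) (at x)" for x
        proof -
          have "((\<lambda>x. l (x - x0)) has_derivative (\<lambda>v. l v)) (at x)"
            using lD by (rule has_derivative_compose[of "\<lambda>x. x - x0" "\<lambda>v. v", rotated])
              (auto intro!: derivative_eq_intros)
          then show ?thesis unfolding A_def by (auto intro!: derivative_eq_intros)
        qed
        fix s assume "s \<in> {max a (t-\<delta>)..min b (t+\<delta>)}"
        then have "s \<in> {a..b}" by simp
        note s = gW[OF this]
        show "snd c (\<gamma> s) \<in> ball x0 r'" by (rule Wf(2)[OF s])
        show "\<Psi> \<epsilon> (\<gamma> s) \<in> fst c" "snd c (\<Psi> \<epsilon> (\<gamma> s)) = A \<epsilon> (snd c (\<gamma> s))" by (rule P[OF s e])+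
        show "fd_timelike_vec X c (A \<epsilon> (snd c (\<gamma> s))) (v + (\<epsilon> * l v) *\<^sub>R T)"
          if "fd_causal_vec X c (snd c (\<gamma> s)) v" for v
          unfolding A_def by (rule vec[OF Wf(2)[OF s] e that])
      qed
      then have "piece (fd_timelike_vec X c) c (\<lambda>t. \<Psi> \<epsilon> (\<gamma> t)) ({a..b} \<inter> {t-\<delta>..t+\<delta>})"
        by (simp only: Int_atLeastAtMost)
      then show "\<exists>c\<in>atlas X. \<exists>\<epsilon>'>0. piece (fd_timelike_vec X c) c (\<lambda>t. \<Psi> \<epsilon> (\<gamma> t)) ({a..b} \<inter> {t-\<epsilon>'..t+\<epsilon>'})"
        using c(1) d(1) by blast
    qed (simp add: is_interval_cc)
    then show "\<Psi> \<epsilon> (\<gamma> b) \<in> Ifut X (\<Psi> \<epsilon> (\<gamma> a))"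
      unfolding Ifut_def fd_timelike_curve_def using ab by blast
  qed
qed

text \<open>Inside V, limits of points in the past of r behave like points causally below r.\<close>
lemma strongly_causal_nhd:
  assumes X: "spacetime X" and S: "strongly_causal X" and U: "open U" "p \<in> U"
  obtains V where "open V" "p \<in> V" "V \<subseteq> U"
    "\<And>x y z. x \<in> V \<Longrightarrow> z \<in> V \<Longrightarrow> y \<in> Ifut X x \<Longrightarrow> z \<in> Ifut X y \<Longrightarrow> y \<in> V"
    "\<And>z r q. z \<in> V \<Longrightarrow> r \<in> V \<Longrightarrow> z \<in> closure (Ipast X r) \<Longrightarrow> q \<in> Ifut X r \<Longrightarrow> q \<in> Ifut X z"
proof -
  obtain W :: "'a set" and \<Psi> :: "real \<Rightarrow> 'a \<Rightarrow> 'a" and \<epsilon>0 :: real where W: "open W" "p \<in> W" "\<epsilon>0 > 0"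
    and cont: "\<And>\<epsilon>. 0 < \<epsilon> \<Longrightarrow> \<epsilon> < \<epsilon>0 \<Longrightarrow> continuous_on W (\<Psi> \<epsilon>)"
    and fut: "\<And>x \<epsilon>. x \<in> W \<Longrightarrow> 0 < \<epsilon> \<Longrightarrow> \<epsilon> < \<epsilon>0 \<Longrightarrow> \<Psi> \<epsilon> x \<in> Ifut X x"
    and near: "\<And>x U. x \<in> W \<Longrightarrow> open U \<Longrightarrow> x \<in> U \<Longrightarrow> \<exists>\<epsilon>. 0 < \<epsilon> \<and> \<epsilon> < \<epsilon>0 \<and> \<Psi> \<epsilon> x \<in> U"
    and curve: "\<And>\<gamma> a b \<epsilon>. fd_causal_curve X \<gamma> {a..b} \<Longrightarrow> \<gamma> ` {a..b} \<subseteq> W \<Longrightarrow> 0 < \<epsilon> \<Longrightarrow> \<epsilon> < \<epsilon>0 \<Longrightarrow>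
      \<Psi> \<epsilon> (\<gamma> b) \<in> Ifut X (\<Psi> \<epsilon> (\<gamma> a))"
    by (rule displacement[OF X, of p]) (rule that)
  have "open (U \<inter> W)" "p \<in> U \<inter> W" using U W by auto
  then obtain V where V: "open V" "p \<in> V" "V \<subseteq> U \<inter> W"
    and cc: "\<And>\<gamma> a b t. fd_timelike_curve X \<gamma> {a..b} \<Longrightarrow> \<gamma> a \<in> V \<Longrightarrow> \<gamma> b \<in> V \<Longrightarrow> t \<in> {a..b} \<Longrightarrow> \<gamma> t \<in> V"
    and cv: "\<And>x y z. x \<in> V \<Longrightarrow> z \<in> V \<Longrightarrow> y \<in> Ifut X x \<Longrightarrow> z \<in> Ifut X y \<Longrightarrow> y \<in> V"
    by (rule strongly_causal_chron[OF X S]) (rule that)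
  have lim: "q \<in> Ifut X z"
    if z: "z \<in> V" and r: "r \<in> V" and zr: "z \<in> closure (Ipast X r)" and q: "q \<in> Ifut X r" for z r q
  proof -
    have VW: "V \<subseteq> W" using V by blast
    have "r \<in> W" "r \<in> Ipast X q" using r VW q by (auto simp: Ipast_iff)
    \<comment> \<open>Openness of the past of \<open>q\<close> leaves room to displace
      \<open>r\<close>. The goal is the chain \<open>z\<close>, \<open>\<Psi> \<epsilon> x\<close>,
      \<open>\<Psi> \<epsilon> r\<close>, \<open>q\<close>, in which \<open>x\<close> is a point of
      the past of \<open>r\<close> so close to \<open>z\<close> that its displacement is still above
      \<open>z\<close>.\<close>
    then obtain \<epsilon> where e: "0 < \<epsilon>" "\<epsilon> < \<epsilon>0" and q': "q \<in> Ifut X (\<Psi> \<epsilon> r)"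
      using near[OF _ open_Ipast[OF X]] by (metis Ipast_iff)
    have "continuous_on V (\<Psi> \<epsilon>)" using cont[OF e] VW by (rule continuous_on_subset)
    then have "open (V \<inter> \<Psi> \<epsilon> -` Ifut X z)"
      using V(1) open_Ifut[OF X] by (rule continuous_open_preimage)
    moreover have "z \<in> V \<inter> \<Psi> \<epsilon> -` Ifut X z" using z fut[OF _ e] VW by auto
    ultimately obtain x where x: "x \<in> V" "\<Psi> \<epsilon> x \<in> Ifut X z" "x \<in> Ipast X r"
      using zr unfolding closure_iff_nhds_not_empty by blast
    then obtain \<gamma> a b where g: "a < b" "fd_timelike_curve X \<gamma> {a..b}" "\<gamma> a = x" "\<gamma> b = r"
      unfolding Ipast_def by blast
    \<comment> \<open>Causal convexity enters here: a timelike curve between two points of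
      \<open>V\<close> cannot leave the domain of the displacement.\<close>
    have "\<gamma> ` {a..b} \<subseteq> W" using cc[OF g(2)] x(1) r VW g(3,4) by blast
    from curve[OF fd_timelike_imp_causal_curve[OF X g(2)] this e]
    have "\<Psi> \<epsilon> r \<in> Ifut X (\<Psi> \<epsilon> x)" unfolding g(3,4) .
    from Ifut_trans[OF X Ifut_trans[OF X x(2) this] q'] show ?thesis .
  qed
  show ?thesis
  proof (rule that[OF V(1,2) _ cv lim])
    show "V \<subseteq> U" using V(3) by blast
  qed
qed

section \<open>Monotonicity of futures and pasts along causal curves\<close>

text \<open>The push-up property. Displacements exist only locally, so short subintervals are
  treated first, and Bolzano bisection assembles them.\<close>

lemma Ifut_antimono_causal:
  assumes X: "spacetime X" and C: "fd_causal_curve X \<gamma> I" and st: "s \<in> I" "t \<in> I" "s \<le> t"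
  shows "Ifut X (\<gamma> t) \<subseteq> Ifut X (\<gamma> s)"
proof -
  note C' = C[unfolded fd_causal_curve_def]
  have int: "u \<in> I" if "s \<le> u" "u \<le> t" for u
    by (rule mem_is_interval_1_I[OF fd_curveD(1)[OF C'] st(1,2) that])
  \<comment> \<open>Bisection refers to arbitrary pairs of reals, so the property carries its own
    domain conditions; confining it further to the interval from \<open>s\<close> to
    \<open>t\<close> puts the middle point of the transitivity step into \<open>I\<close>.\<close>
  define P where "P a b \<longleftrightarrow> (a \<in> I \<longrightarrow> b \<in> I \<longrightarrow> a \<le> b \<longrightarrow> Ifut X (\<gamma> b) \<subseteq> Ifut X (\<gamma> a))" for a b
  have "P' s t" if P': "P' = (\<lambda>a b. s \<le> a \<longrightarrow> b \<le> t \<longrightarrow> P a b)" for P'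
    using st(3)
  proof (induction rule: Bolzano)
    case (trans a b d)
    then show ?case unfolding P' P_def using int by (smt (verit) order_trans)
  next
    case (local x)
    obtain W :: "'a set" and \<Psi> :: "real \<Rightarrow> 'a \<Rightarrow> 'a" and \<epsilon>0 :: real where W: "open W" "\<gamma> x \<in> W" "\<epsilon>0 > 0"
      and cont: "\<And>\<epsilon>. 0 < \<epsilon> \<Longrightarrow> \<epsilon> < \<epsilon>0 \<Longrightarrow> continuous_on W (\<Psi> \<epsilon>)"
      and fut: "\<And>x \<epsilon>. x \<in> W \<Longrightarrow> 0 < \<epsilon> \<Longrightarrow> \<epsilon> < \<epsilon>0 \<Longrightarrow> \<Psi> \<epsilon> x \<in> Ifut X x"
      and near: "\<And>x U. x \<in> W \<Longrightarrow> open U \<Longrightarrow> x \<in> U \<Longrightarrow> \<exists>\<epsilon>. 0 < \<epsilon> \<and> \<epsilon> < \<epsilon>0 \<and> \<Psi> \<epsilon> x \<in> U"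
      and curve: "\<And>\<gamma> a b \<epsilon>. fd_causal_curve X \<gamma> {a..b} \<Longrightarrow> \<gamma> ` {a..b} \<subseteq> W \<Longrightarrow> 0 < \<epsilon> \<Longrightarrow> \<epsilon> < \<epsilon>0 \<Longrightarrow>
        \<Psi> \<epsilon> (\<gamma> b) \<in> Ifut X (\<Psi> \<epsilon> (\<gamma> a))"
      by (rule displacement[OF X, of "\<gamma> x"]) (rule that)
    have xI: "x \<in> I" by (rule int[OF local])
    have "\<exists>A. open A \<and> x \<in> A \<and> (\<forall>y\<in>I. y \<in> A \<longrightarrow> \<gamma> y \<in> W)"
      using fd_curveD(3)[OF C'] xI W(1,2) unfolding continuous_on_topological by metis
    then obtain A where A: "open A" "x \<in> A" "\<And>y. y \<in> I \<Longrightarrow> y \<in> A \<Longrightarrow> \<gamma> y \<in> W" by blast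
    then obtain d where d: "d > 0" "ball x d \<subseteq> A" using open_contains_ball by blast
    have "P' a b" if ab: "a \<le> x" "x \<le> b" "b - a < d" for a b
      unfolding P' P_def
    proof (intro impI subsetI)
      fix q assume I: "a \<in> I" "b \<in> I" "a \<le> b" and q: "q \<in> Ifut X (\<gamma> b)"
      show "q \<in> Ifut X (\<gamma> a)"
      proof (cases "a = b")
        case False
        then have lt: "a < b" using I by simp
        have sub: "\<gamma> y \<in> W" if y: "y \<in> {a..b}" for y
        proof (rule A(3))
          show "y \<in> I" by (rule mem_is_interval_1_I[OF fd_curveD(1)[OF C'] I(1,2)]) (use y in auto)
          have "y \<in> ball x d" using y ab by (simp add: dist_real_def) linarith
          then show "y \<in> A" using d(2) by blast
        qed
        \<comment> \<open>With \<open>\<epsilon>\<close> small enough for \<open>q\<close>, the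
          chain is \<open>\<gamma> a\<close>, \<open>\<Psi> \<epsilon> (\<gamma> a)\<close>,
          \<open>\<Psi> \<epsilon> (\<gamma> b)\<close>, \<open>q\<close>.\<close>
        have "\<gamma> b \<in> W" "\<gamma> b \<in> Ipast X q" using sub[of b] lt q by (auto simp: Ipast_iff)
        then obtain \<epsilon> where e: "0 < \<epsilon>" "\<epsilon> < \<epsilon>0" and q': "q \<in> Ifut X (\<Psi> \<epsilon> (\<gamma> b))"
          using near[OF _ open_Ipast[OF X]] by (metis Ipast_iff)
        have "fd_causal_curve X \<gamma> {a..b}"
          unfolding fd_causal_curve_def by (rule fd_curve_restrict[OF C' I(1,2) lt])
        from curve[OF this _ e] sub have "\<Psi> \<epsilon> (\<gamma> b) \<in> Ifut X (\<Psi> \<epsilon> (\<gamma> a))" by blast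
        moreover have "\<Psi> \<epsilon> (\<gamma> a) \<in> Ifut X (\<gamma> a)" using fut[OF sub e] lt by simp
        ultimately show ?thesis using q' Ifut_trans[OF X] by blast
      qed (use q in simp)
    qed
    with d(1) show ?case by blast
  qed
  then show ?thesis using st by (simp add: P_def)
qed

lemma Ipast_mono_causal:
  assumes X: "spacetime X" and C: "fd_causal_curve X \<gamma> I" and st: "s \<in> I" "t \<in> I" "s \<le> t"
  shows "Ipast X (\<gamma> s) \<subseteq> Ipast X (\<gamma> t)"
  using Ifut_antimono_causal[OF spacetime_time_reverse[OF X] time_reverse_curve(2)[OF X C], of "- t" "- s"] st
  by (simp add: Ifut_time_reverse[OF X])

text \<open>A connected curve from outside into \<open>U\<close> meets the frontier. Neither end
  lies on it, so both parts of the curve are nondegenerate and both relations remain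
  chronological.\<close>

lemma Ifut_frontier:
  assumes X: "spacetime X" and y: "y \<in> Ifut X x" and O: "open U" "y \<in> U" "x \<notin> closure U"
  obtains z where "z \<in> frontier U" "z \<in> Ifut X x" "y \<in> Ifut X z"
proof -
  obtain \<gamma> a b where g: "a < b" "fd_timelike_curve X \<gamma> {a..b}" "\<gamma> a = x" "\<gamma> b = y"
    using y unfolding Ifut_def by blast
  note C = g(2)[unfolded fd_timelike_curve_def]
  have "connected (\<gamma> ` {a..b})"
    by (rule connected_continuous_image[OF fd_curveD(3)[OF C] connected_Icc])
  moreover have "\<gamma> ` {a..b} \<inter> U \<noteq> {}" using g O by force
  moreover have "x \<in> \<gamma> ` {a..b} - U" using g O closure_subset[of U] by force
  ultimately have "\<gamma> ` {a..b} \<inter> frontier U \<noteq> {}" by (intro connected_Int_frontier) auto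
  then obtain t where t: "t \<in> {a..b}" "\<gamma> t \<in> frontier U" by blast
  have "t \<noteq> a" using t(2) O(3) g(3) by (auto simp: frontier_def)
  moreover have "t \<noteq> b" using t(2) O(1,2) g(4) by (auto simp: frontier_def interior_open)
  ultimately have t': "a < t" "t < b" using t(1) by auto
  have "fd_timelike_curve X \<gamma> {a..t}" "fd_timelike_curve X \<gamma> {t..b}"
    unfolding fd_timelike_curve_def by (rule fd_curve_restrict[OF C]; use t t' in auto)+
  then have "\<gamma> t \<in> Ifut X x" "y \<in> Ifut X (\<gamma> t)" unfolding Ifut_def using g t' by blast+
  with t(2) show ?thesis by (rule that)
qed

lemma relatively_compact_nhd:
  fixes X :: "('a::{t2_space, second_countable_topology}, 'v::euclidean_space) spacetime_data" and p :: 'a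
  assumes X: "spacetime X" and U: "open U" "p \<in> U"
  obtains N where "open N" "p \<in> N" "compact (closure N)" "closure N \<subseteq> U"
proof -
  obtain c where c: "c \<in> atlas X" "p \<in> fst c" using spacetime_cover[OF X] .
  note ch = spacetimeD(1)[OF X c(1)]
  have "open (snd c ` (U \<inter> fst c))" using chart_facts(1,6)[OF ch] U by auto
  moreover have "snd c p \<in> snd c ` (U \<inter> fst c)" using U c by blast
  ultimately obtain r where r: "r > 0" "cball (snd c p) r \<subseteq> snd c ` (U \<inter> fst c)"
    using open_contains_cball by blast
  define K where "K = unchart c ` cball (snd c p) r"
  define N where "N = {q \<in> fst c. snd c q \<in> ball (snd c p) r}"
  have "cball (snd c p) r \<subseteq> snd c ` fst c" using r(2) by blast
  then have K: "compact K" unfolding K_def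
    by (rule compact_continuous_image[OF continuous_on_subset[OF chart_facts(5)[OF ch]] compact_cball])
  have KU: "K \<subseteq> U"
  proof
    fix q assume "q \<in> K"
    then obtain y where y: "y \<in> cball (snd c p) r" "q = unchart c y" unfolding K_def by blast
    then obtain z where "z \<in> U" "z \<in> fst c" "y = snd c z" using r(2) by blast
    then show "q \<in> U" using y(2) unchart(1)[OF ch] by simp
  qed
  have "N \<subseteq> K"
  proof
    fix q assume "q \<in> N"
    then have "q \<in> fst c" "snd c q \<in> cball (snd c p) r" by (auto simp: N_def)
    then show "q \<in> K" unfolding K_def using unchart(1)[OF ch] by (metis imageI)
  qed
  then have NK: "closure N \<subseteq> K" by (rule closure_minimal[OF _ compact_imp_closed[OF K]])
  show ?thesis
  proof (rule that[of N])
    show "open N" unfolding N_def by (rule open_chart_preimage[OF ch open_ball])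
    show "p \<in> N" using c r(1) by (simp add: N_def)
    show "compact (closure N)" using compact_Int_closed[OF K closed_closure[of N]] NK
      by (simp add: Int_absorb1)
    show "closure N \<subseteq> U" using NK KU by (rule order_trans)
  qed
qed

section \<open>Indecomposable sets and the causal completion\<close>

lemma Ipast_trans: "spacetime X \<Longrightarrow> x \<in> Ipast X y \<Longrightarrow> y \<in> Ipast X z \<Longrightarrow> x \<in> Ipast X z"
  unfolding Ipast_iff by (rule Ifut_trans)

lemma Ifut_interpolate:
  assumes X: "spacetime X" and "y \<in> Ifut X x"
  obtains z where "z \<in> Ifut X x" "y \<in> Ifut X z"
  using Ifut_near[OF X open_Ipast[OF X], of x y] assms(2) by (auto simp: Ipast_iff)

lemma past_set_downward: "spacetime X \<Longrightarrow> past_set X P \<Longrightarrow> x \<in> P \<Longrightarrow> y \<in> Ipast X x \<Longrightarrow> y \<in> P"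
  unfolding past_set_def IpastS_def using Ipast_trans by blast

lemma past_set_no_max:
  assumes X: "spacetime X" and "past_set X P" "x \<in> P"
  obtains z where "z \<in> P" "z \<in> Ifut X x"
proof -
  obtain S s where S: "P = IpastS X S" "s \<in> S" "x \<in> Ipast X s"
    using assms(2,3) unfolding past_set_def IpastS_def by blast
  then obtain z where "z \<in> Ifut X x" "s \<in> Ifut X z"
    using Ifut_interpolate[OF X] by (metis Ipast_iff)
  moreover from this have "z \<in> P" using S unfolding IpastS_def Ipast_iff[symmetric] by blast
  ultimately show ?thesis using that by blast
qed

lemma IpastS_past_set:
  assumes X: "spacetime X" and "past_set X P"
  shows "IpastS X P = P"
proof
  show "IpastS X P \<subseteq> P" unfolding IpastS_def using past_set_downward[OF assms] by blast
  show "P \<subseteq> IpastS X P"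
    unfolding IpastS_def using past_set_no_max[OF assms] by (metis Ipast_iff UN_I subsetI)
qed

text \<open>The splitting is by membership in the future of \<open>x\<close>. The past of the part
  outside that future cannot contain \<open>x\<close>, so indecomposability makes the past of the
  other part all of \<open>P\<close>, and it contains \<open>y\<close>. This is one direction of the
  Geroch-Kronheimer-Penrose characterisation.\<close>

lemma IP_directed:
  assumes X: "spacetime X" and P: "IP X P" and xy: "x \<in> P" "y \<in> P"
  obtains z where "z \<in> P" "z \<in> Ifut X x" "z \<in> Ifut X y"
proof -
  have ps: "past_set X P" using P by (simp add: IP_def)
  define A B where "A = IpastS X (P \<inter> Ifut X x)" and "B = IpastS X (P - Ifut X x)"
  have "past_set X A" "past_set X B" unfolding A_def B_def past_set_def by blast+
  moreover have AB: "A \<union> B = P"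
  proof -
    have "A \<union> B = IpastS X P" unfolding A_def B_def IpastS_def by blast
    then show ?thesis by (simp add: IpastS_past_set[OF X ps])
  qed
  ultimately have "\<not> (A \<subset> P \<and> B \<subset> P)" using P unfolding IP_def by blast
  then have "A = P \<or> B = P" using AB by blast
  moreover have "B \<noteq> P"
  proof
    assume "B = P"
    then obtain z where "z \<in> P - Ifut X x" "x \<in> Ipast X z" using xy unfolding B_def IpastS_def by blast
    then show False by (simp add: Ipast_iff)
  qed
  ultimately have "y \<in> A" using xy by simp
  then obtain z where "z \<in> P \<inter> Ifut X x" "y \<in> Ipast X z" unfolding A_def IpastS_def by blast
  then show ?thesis using that[of z] by (simp add: Ipast_iff)
qed

text \<open>If the two parts missed \<open>a\<close> and \<open>b\<close> respectively, a point
  \<open>z\<close> of the past of \<open>p\<close> above both \<open>a\<close> and \<open>b\<close>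
  could lie in neither part.\<close>

lemma IP_Ipast:
  assumes X: "spacetime X" shows "IP X (Ipast X p)"
  unfolding IP_def
proof (intro conjI notI)
  show "Ipast X p = {} \<Longrightarrow> False" using Ipast_near[OF X open_UNIV UNIV_I] by blast
  show "past_set X (Ipast X p)" unfolding past_set_def IpastS_def by (rule exI[of _ "{p}"]) simp
  assume "\<exists>A B. past_set X A \<and> past_set X B \<and> A \<subset> Ipast X p \<and> B \<subset> Ipast X p \<and> Ipast X p = A \<union> B"
  then obtain A B a b where AB: "past_set X A" "past_set X B" "Ipast X p = A \<union> B"
    and a: "a \<in> Ipast X p" "a \<notin> A" and b: "b \<in> Ipast X p" "b \<notin> B" by blast
  have "open (Ifut X a \<inter> Ifut X b)" "p \<in> Ifut X a \<inter> Ifut X b"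
    using open_Ifut[OF X] a b by (auto simp: Ipast_iff)
  from Ipast_near[OF X this] obtain z where z: "z \<in> Ipast X p" "a \<in> Ipast X z" "b \<in> Ipast X z"
    by (auto simp: Ipast_iff)
  then show False using AB past_set_downward[OF X AB(1) _ z(2)] past_set_downward[OF X AB(2) _ z(3)] a b by blast
qed

section \<open>Duality between IPs and IFs\<close>

lemma IpastS_time_reverse: "spacetime X \<Longrightarrow> IpastS (time_reverse X) = IfutS X"
  and IfutS_time_reverse: "spacetime X \<Longrightarrow> IfutS (time_reverse X) = IpastS X"
  by (simp_all add: IpastS_def IfutS_def fun_eq_iff Ifut_time_reverse)

lemma past_set_time_reverse: "spacetime X \<Longrightarrow> past_set (time_reverse X) = future_set X"
  and future_set_time_reverse: "spacetime X \<Longrightarrow> future_set (time_reverse X) = past_set X"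
  by (simp_all add: past_set_def future_set_def fun_eq_iff IpastS_time_reverse IfutS_time_reverse)

lemma IP_time_reverse: "spacetime X \<Longrightarrow> IP (time_reverse X) = IF X"
  and IF_time_reverse: "spacetime X \<Longrightarrow> IF (time_reverse X) = IP X"
  by (simp_all add: IP_def IF_def fun_eq_iff past_set_time_reverse future_set_time_reverse)

lemma fut_of_time_reverse: "spacetime X \<Longrightarrow> fut_of (time_reverse X) = past_of X"
  by (simp add: fut_of_def past_of_def fun_eq_iff IfutS_time_reverse Ifut_time_reverse)

lemma future_set_upward: "spacetime X \<Longrightarrow> future_set X P \<Longrightarrow> x \<in> P \<Longrightarrow> y \<in> Ifut X x \<Longrightarrow> y \<in> P"
  using past_set_downward[OF spacetime_time_reverse, of X P x y]
  by (simp add: past_set_time_reverse Ifut_time_reverse)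

lemma IF_directed:
  assumes X: "spacetime X" and P: "IF X P" and xy: "x \<in> P" "y \<in> P"
  obtains z where "z \<in> P" "x \<in> Ifut X z" "y \<in> Ifut X z"
  using IP_directed[OF spacetime_time_reverse[OF X], of P x y] assms
  by (auto simp: IP_time_reverse Ifut_time_reverse Ipast_iff)

lemma IF_Ifut: "spacetime X \<Longrightarrow> IF X (Ifut X p)"
  using IP_Ipast[OF spacetime_time_reverse, of X p] by (simp add: IP_time_reverse Ifut_time_reverse)

text \<open>Given \<open>q\<close> in \<open>Q\<close> and a point \<open>a\<close> above and near
  \<open>p\<close>, directedness yields \<open>r\<close> in \<open>Q\<close> below both. The past of
  \<open>r\<close> contains that of \<open>p\<close>, so \<open>r\<close> is caught between two
  points of a convex neighbourhood and \<open>p\<close> is a limit of points below \<open>r\<close>;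
  the local limit property then puts \<open>q\<close> above \<open>p\<close>.\<close>

lemma Ifut_maximal:
  assumes X: "spacetime X" and S: "strongly_causal X"
    and Q: "IF X Q" "Q \<subseteq> fut_of X (Ipast X p)" "Ifut X p \<subseteq> Q"
  shows "Q = Ifut X p"
proof
  show "Q \<subseteq> Ifut X p"
  proof
    fix q assume q: "q \<in> Q"
    obtain V where V: "open V" "p \<in> V" "V \<subseteq> UNIV"
      and conv: "\<And>x y z. x \<in> V \<Longrightarrow> z \<in> V \<Longrightarrow> y \<in> Ifut X x \<Longrightarrow> z \<in> Ifut X y \<Longrightarrow> y \<in> V"
      and lim: "\<And>z r q. z \<in> V \<Longrightarrow> r \<in> V \<Longrightarrow> z \<in> closure (Ipast X r) \<Longrightarrow> q \<in> Ifut X r \<Longrightarrow> q \<in> Ifut X z"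
      by (rule strongly_causal_nhd[OF X S open_UNIV UNIV_I, of p]) (rule that)
    obtain a where a: "a \<in> Ifut X p" "a \<in> V" using Ifut_near[OF X V(1,2)] by blast
    obtain b where b: "b \<in> Ipast X p" "b \<in> V" using Ipast_near[OF X V(1,2)] by blast
    have "a \<in> Q" using a Q(3) by blast
    then obtain r where r: "r \<in> Q" "a \<in> Ifut X r" "q \<in> Ifut X r" by (rule IF_directed[OF X Q(1) _ q])
    then obtain x where x: "Ipast X p \<subseteq> Ipast X x" "x \<in> Ipast X r"
      using Q(2) unfolding fut_of_def IfutS_def Ipast_iff by blast
    have pr: "Ipast X p \<subseteq> Ipast X r" using x Ipast_trans[OF X] by blast
    have "r \<in> V" using conv[OF b(2) a(2) _ r(2)] pr b(1) unfolding Ipast_iff[symmetric] by blast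
    moreover have "p \<in> closure (Ipast X r)"
      unfolding closure_iff_nhds_not_empty using Ipast_near[OF X, of _ p] pr by blast
    ultimately show "q \<in> Ifut X p" using lim V(2) r(3) by blast
  qed
qed (rule Q(3))

lemma Ipast_maximal:
  assumes X: "spacetime X" and S: "strongly_causal X"
    and P: "IP X P" "P \<subseteq> past_of X (Ifut X p)" "Ipast X p \<subseteq> P"
  shows "P = Ipast X p"
  using Ifut_maximal[OF spacetime_time_reverse[OF X] strongly_causal_time_reverse[OF X S], of P p] P
  by (simp add: IF_time_reverse[OF X] fut_of_time_reverse[OF X] Ifut_time_reverse[OF X])

lemma Phi_Mbar:
  assumes X: "spacetime X" and S: "strongly_causal X"
  shows "Phi X p \<in> Mbar X"
proof -
  have "Ifut X p \<subseteq> fut_of X (Ipast X p)" unfolding fut_of_def IfutS_def by blast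
  moreover have "Ipast X p \<subseteq> past_of X (Ifut X p)" unfolding past_of_def IpastS_def by blast
  ultimately have "(Ipast X p, Ifut X p) \<in> Rpf X"
    unfolding Rpf_def using IP_Ipast[OF X] IF_Ifut[OF X] Ifut_maximal[OF X S] Ipast_maximal[OF X S] by simp
  then show ?thesis by (simp add: Mbar_def Phi_def)
qed

section \<open>Cluster points and limits of future components\<close>

text \<open>The cluster point of a filter base in a compact set. Stated for directed families, it
  applies directly to sets indexed by pairs, with no sequences to extract.\<close>

lemma compact_directed_cluster_point:
  assumes K: "compact K" and ne: "\<A> \<noteq> {}"
    and sub: "\<And>A. A \<in> \<A> \<Longrightarrow> A \<noteq> {} \<and> A \<subseteq> K"
    and dir: "\<And>A B. A \<in> \<A> \<Longrightarrow> B \<in> \<A> \<Longrightarrow> \<exists>C\<in>\<A>. C \<subseteq> A \<and> C \<subseteq> B"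
  obtains z where "z \<in> K" "\<And>A. A \<in> \<A> \<Longrightarrow> z \<in> closure A"
proof -
  have "K \<inter> \<Inter> (closure ` \<A>) \<noteq> {}"
  proof (rule compact_imp_fip[OF K])
    show "closed T" if "T \<in> closure ` \<A>" for T using that by blast
    fix F' assume "finite F'" "F' \<subseteq> closure ` \<A>"
    then obtain G where G: "finite G" "G \<subseteq> \<A>" "F' = closure ` G" by (meson finite_subset_image)
    have "\<exists>A\<in>\<A>. \<forall>B\<in>G. A \<subseteq> B" using G(1,2)
    proof (induction G)
      case empty
      then show ?case using ne by blast
    next
      case (insert B G)
      then obtain A where A: "A \<in> \<A>" "\<forall>B\<in>G. A \<subseteq> B" by blast
      obtain C where C: "C \<in> \<A>" "C \<subseteq> A" "C \<subseteq> B" using dir[OF A(1), of B] insert.prems by blast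
      then show ?case using A(2) by (intro bexI[OF _ C(1)]) auto
    qed
    then obtain A where A: "A \<in> \<A>" "\<forall>B\<in>G. A \<subseteq> B" by blast
    then obtain a where a: "a \<in> A" "a \<in> K" using sub by blast
    have "a \<in> closure B" if "B \<in> G" for B using A(2) a(1) that closure_subset[of B] by blast
    with a(2) show "K \<inter> \<Inter> F' \<noteq> {}" unfolding G(3) by blast
  qed
  then show ?thesis using that by blast
qed

lemma compact_frontier:
  fixes N :: "'a::topological_space set"
  assumes "compact (closure N)" shows "compact (frontier N)"
proof -
  have "closure N \<inter> frontier N = frontier N" by (auto simp: frontier_def)
  then show ?thesis using compact_Int_closed[OF assms frontier_closed[of N]] by simp
qed

text \<open>If P stays away from N, curves from P to points of F in N enter N through its frontier; a
  cluster point z of the points of entry has its future inside f(P), so the maximality of F applies.\<close>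
lemma Rpf_frontier_point:
  assumes X: "spacetime X" and R: "(P, F) \<in> Rpf X"
    and lim: "\<And>z r q. z \<in> V \<Longrightarrow> r \<in> V \<Longrightarrow> z \<in> closure (Ipast X r) \<Longrightarrow> q \<in> Ifut X r \<Longrightarrow> q \<in> Ifut X z"
    and N: "open N" "compact (closure N)" "closure N \<subseteq> V" "P \<inter> closure N = {}"
    and w0: "w0 \<in> F" "w0 \<in> N"
  obtains z where "z \<in> frontier N" "w0 \<in> Ifut X z" "Ifut X z \<subseteq> F"
proof -
  have P: "IP X P" and F: "IF X F" and PF: "P \<subseteq> past_of X F"
    and max: "\<And>Q. IF X Q \<Longrightarrow> Q \<subseteq> fut_of X P \<Longrightarrow> F \<subseteq> Q \<Longrightarrow> Q = F"
    using R unfolding Rpf_def by auto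
  have Fs: "future_set X F" using F by (simp add: IF_def)
  have fr: "frontier N = closure N - N" using N(1) by (simp add: frontier_def interior_open)
  have NV: "N \<subseteq> V" using N(3) closure_subset[of N] by blast
  have frV: "frontier N \<subseteq> V" using N(3) fr by blast
  \<comment> \<open>If \<open>F\<close> already leaves \<open>N\<close> below \<open>w0\<close>, a
    frontier point can be found inside \<open>F\<close>. Maximality enters in the opposite case,
    where the part of \<open>F\<close> below \<open>w0\<close> is trapped in
    \<open>N\<close>.\<close>
  show ?thesis
  proof (cases "\<exists>w\<in>F. w0 \<in> Ifut X w \<and> w \<notin> N")
    case True
    then obtain w where w: "w \<in> F" "w0 \<in> Ifut X w" "w \<notin> N" by blast
    show ?thesis
    proof (cases "w \<in> closure N")
      case True
      then show ?thesis using w fr future_set_upward[OF X Fs w(1)] that by blast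
    next
      case False
      obtain z where z: "z \<in> frontier N" "z \<in> Ifut X w" "w0 \<in> Ifut X z"
        by (rule Ifut_frontier[OF X w(2) N(1) w0(2) False])
      have "z \<in> F" by (rule future_set_upward[OF X Fs w(1) z(2)])
      then show ?thesis using z future_set_upward[OF X Fs] that by blast
    qed
  next
    case False
    then have inN: "w \<in> N" if "w \<in> F" "w0 \<in> Ifut X w" for w using that by blast
    \<comment> \<open>Possible entry points between \<open>x\<close> and \<open>w\<close>. They
      shrink as \<open>x\<close> rises in \<open>P\<close> and \<open>w\<close> descends in
      \<open>F\<close>, and directedness of \<open>P\<close> and \<open>F\<close> makes the family a
      filter base.\<close>
    define Z where "Z x w = {z \<in> frontier N. z \<in> Ifut X x \<and> w \<in> Ifut X z}" for x w
    define \<A> where "\<A> = {Z x w |x w. x \<in> P \<and> w \<in> F \<and> w0 \<in> Ifut X w}"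
    have xw: "w \<in> Ifut X x" if "x \<in> P" "w \<in> F" for x w
    proof -
      obtain x' where "F \<subseteq> Ifut X x'" "x \<in> Ipast X x'"
        using PF \<open>x \<in> P\<close> unfolding past_of_def IpastS_def by blast
      then show ?thesis using that(2) Ifut_trans[OF X] by (metis Ipast_iff subsetD)
    qed
    have Zne: "Z x w \<noteq> {}" if x: "x \<in> P" and w: "w \<in> F" "w0 \<in> Ifut X w" for x w
    proof -
      have "x \<notin> closure N" using x N(4) by blast
      then obtain z where "z \<in> frontier N" "z \<in> Ifut X x" "w \<in> Ifut X z"
        by (rule Ifut_frontier[OF X xw[OF x w(1)] N(1) inN[OF w]])
      then show ?thesis unfolding Z_def by blast
    qed
    obtain w1 where w1: "w1 \<in> F" "w0 \<in> Ifut X w1" by (rule IF_directed[OF X F w0(1) w0(1)])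
    obtain x1 where x1: "x1 \<in> P" using P unfolding IP_def by blast
    obtain z where z: "z \<in> frontier N" and cl: "\<And>A. A \<in> \<A> \<Longrightarrow> z \<in> closure A"
    proof (rule compact_directed_cluster_point[OF compact_frontier[OF N(2)], of \<A>])
      show "\<A> \<noteq> {}" unfolding \<A>_def using w1 x1 by blast
      show "A \<noteq> {} \<and> A \<subseteq> frontier N" if A: "A \<in> \<A>" for A
      proof -
        obtain x w where "A = Z x w" "x \<in> P" "w \<in> F" "w0 \<in> Ifut X w" using A unfolding \<A>_def by blast
        then show ?thesis using Zne unfolding Z_def by blast
      qed
      fix A B assume "A \<in> \<A>" "B \<in> \<A>"
      then obtain x w x' w' where A: "A = Z x w" "x \<in> P" "w \<in> F" "w0 \<in> Ifut X w"
        and B: "B = Z x' w'" "x' \<in> P" "w' \<in> F" "w0 \<in> Ifut X w'" unfolding \<A>_def by blast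
      obtain y where y: "y \<in> P" "y \<in> Ifut X x" "y \<in> Ifut X x'" by (rule IP_directed[OF X P A(2) B(2)])
      obtain v where v: "v \<in> F" "w \<in> Ifut X v" "w' \<in> Ifut X v" by (rule IF_directed[OF X F A(3) B(3)])
      have "w0 \<in> Ifut X v" by (rule Ifut_trans[OF X v(2) A(4)])
      then have "Z y v \<in> \<A>" unfolding \<A>_def using y(1) v(1) by blast
      moreover have "Z y v \<subseteq> A" "Z y v \<subseteq> B"
        unfolding A(1) B(1) Z_def using y v Ifut_trans[OF X] by blast+
      ultimately show "\<exists>C\<in>\<A>. C \<subseteq> A \<and> C \<subseteq> B" by blast
    qed (rule that)
    have clZ: "z \<in> closure (Z x w)" if "x \<in> P" "w \<in> F" "w0 \<in> Ifut X w" for x w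
      using cl that unfolding \<A>_def by blast
    \<comment> \<open>For \<open>w\<close> in \<open>F\<close> a lower \<open>v\<close> in
      \<open>F\<close> inside \<open>N\<close> is inserted: \<open>z\<close> is only a limit of
      points below \<open>v\<close>, but the local limit property turns this into a chronological
      relation to \<open>w\<close>.\<close>
    have FI: "F \<subseteq> Ifut X z"
    proof
      fix w assume w: "w \<in> F"
      obtain v where v: "v \<in> F" "w \<in> Ifut X v" "w0 \<in> Ifut X v" by (rule IF_directed[OF X F w w0(1)])
      have "Z x1 v \<subseteq> Ipast X v" by (auto simp: Z_def Ipast_iff)
      then have "z \<in> closure (Ipast X v)" using clZ[OF x1 v(1,3)] closure_mono by blast
      moreover have "z \<in> V" "v \<in> V" using z frV inN[OF v(1,3)] NV by blast+
      ultimately show "w \<in> Ifut X z" using lim v(2) by blast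
    qed
    \<comment> \<open>A point \<open>u\<close> is inserted above \<open>z\<close>: its past is open
      around \<open>z\<close> and hence meets every set of entry points, so all of \<open>P\<close>
      lies below \<open>u\<close>.\<close>
    have "Ifut X z \<subseteq> fut_of X P"
    proof
      fix v assume "v \<in> Ifut X z"
      then obtain u where u: "u \<in> Ifut X z" "v \<in> Ifut X u" by (rule Ifut_interpolate[OF X])
      have "P \<subseteq> Ipast X u"
      proof
        fix x assume x: "x \<in> P"
        have "z \<in> Ipast X u" using u(1) by (simp add: Ipast_iff)
        then have "Z x w1 \<inter> Ipast X u \<noteq> {}"
          using clZ[OF x w1] open_Ipast[OF X, of u] unfolding closure_iff_nhds_not_empty by blast
        then obtain z' where "z' \<in> Ifut X x" "u \<in> Ifut X z'" by (auto simp: Z_def Ipast_iff)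
        then show "x \<in> Ipast X u" unfolding Ipast_iff by (rule Ifut_trans[OF X])
      qed
      then show "v \<in> fut_of X P" unfolding fut_of_def IfutS_def using u(2) by blast
    qed
    from max[OF IF_Ifut[OF X] this FI] have "Ifut X z = F" .
    then show ?thesis using that[OF z] w0(1) by blast
  qed
qed

lemma Mbar_cases:
  assumes "R \<in> Mbar X"
  shows "fst R \<noteq> {} \<Longrightarrow> snd R \<noteq> {} \<Longrightarrow> R \<in> Rpf X" "fst R \<noteq> {} \<Longrightarrow> IP X (fst R)" "past_set X (fst R)"
proof -
  show "fst R \<noteq> {} \<Longrightarrow> snd R \<noteq> {} \<Longrightarrow> R \<in> Rpf X" and 1: "fst R \<noteq> {} \<Longrightarrow> IP X (fst R)"
    using assms by (auto simp: Mbar_def Rpf_def)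
  have "past_set X {}" unfolding past_set_def IpastS_def by (rule exI[of _ "{}"]) simp
  then show "past_set X (fst R)" using 1 by (cases "fst R = {}") (auto simp: IP_def)
qed

text \<open>A missing point \<open>y\<close> is exploited by working inside its future: a past-set
  without \<open>y\<close> avoids that region altogether. Having nonempty past components, the pairs
  with a given \<open>w\<close> in their future component lie in \<open>Rpf\<close>, so their future
  components must contain futures of frontier points of \<open>N\<close>.\<close>

lemma lim_fut_Ifut_imp_Ipast_subset:
  fixes R :: "nat \<Rightarrow> 'a::{t2_space, second_countable_topology} set \<times> 'a set"
  assumes X: "spacetime X" and S: "strongly_causal X"
    and R: "\<And>n. R n \<in> Mbar X" "\<And>n. fst (R n) \<noteq> {}"
    and L: "lim_fut X (Ifut X p) (\<lambda>n. snd (R n))"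
  shows "Ipast X p \<subseteq> (\<Union>n. fst (R n))"
proof (rule subsetI, rule ccontr)
  fix y assume y: "y \<in> Ipast X p" and no: "y \<notin> (\<Union>n. fst (R n))"
  have "p \<in> Ifut X y" using y by (simp add: Ipast_iff)
  then obtain V where V: "open V" "p \<in> V" "V \<subseteq> Ifut X y"
    and lim: "\<And>z r q. z \<in> V \<Longrightarrow> r \<in> V \<Longrightarrow> z \<in> closure (Ipast X r) \<Longrightarrow> q \<in> Ifut X r \<Longrightarrow> q \<in> Ifut X z"
    by (rule strongly_causal_nhd[OF X S open_Ifut[OF X]]) (rule that)
  obtain N where N: "open N" "p \<in> N" "compact (closure N)" "closure N \<subseteq> V"
    by (rule relatively_compact_nhd[OF X V(1,2)])
  have disj: "fst (R n) \<inter> closure N = {}" for n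
  proof -
    have "y \<in> fst (R n)" if "x \<in> fst (R n)" "x \<in> closure N" for x
      using past_set_downward[OF X Mbar_cases(3)[OF R(1)] that(1), of y] that(2) N(4) V(3)
      unfolding Ipast_iff by blast
    then show ?thesis using no by blast
  qed
  \<comment> \<open>Increasing \<open>m\<close> forces late indices, and lowering \<open>w\<close>
    towards \<open>p\<close> forces the points below \<open>p\<close> in the limit. Both refinements
    are needed, one for each clause of the final comparison of \<open>z\<close> with
    \<open>p\<close>.\<close>
  define B where "B m w = {z \<in> frontier N. w \<in> Ifut X z \<and> (\<exists>n\<ge>m. Ifut X z \<subseteq> snd (R n))}" for m w
  define \<A> where "\<A> = {B m w |m w. w \<in> Ifut X p \<inter> N}"
  have Bne: "B m w \<noteq> {}" if w: "w \<in> Ifut X p \<inter> N" for m w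
  proof -
    have "eventually (\<lambda>n. w \<in> snd (R n)) sequentially" using L w unfolding lim_fut_def by blast
    then obtain n where n: "n \<ge> m" "w \<in> snd (R n)" unfolding eventually_sequentially by (meson nat_le_linear)
    then have "(fst (R n), snd (R n)) \<in> Rpf X" using Mbar_cases(1)[OF R] by auto
    then obtain z where "z \<in> frontier N" "w \<in> Ifut X z" "Ifut X z \<subseteq> snd (R n)"
      by (rule Rpf_frontier_point[OF X _ lim N(1,3,4) disj n(2)]) (use w in auto)
    then show ?thesis unfolding B_def using n(1) by blast
  qed
  obtain w1 where w1: "w1 \<in> Ifut X p \<inter> N" using Ifut_near[OF X N(1,2)] by blast
  obtain z where z: "z \<in> frontier N" and cl: "\<And>A. A \<in> \<A> \<Longrightarrow> z \<in> closure A"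
  proof (rule compact_directed_cluster_point[OF compact_frontier[OF N(3)], of \<A>])
    show "\<A> \<noteq> {}" unfolding \<A>_def using w1 by blast
    show "A \<noteq> {} \<and> A \<subseteq> frontier N" if A: "A \<in> \<A>" for A
    proof -
      obtain m w where "A = B m w" "w \<in> Ifut X p \<inter> N" using A unfolding \<A>_def by blast
      then show ?thesis using Bne unfolding B_def by blast
    qed
    fix A C assume "A \<in> \<A>" "C \<in> \<A>"
    then obtain m w m' w' where A: "A = B m w" "w \<in> Ifut X p \<inter> N" and C: "C = B m' w'" "w' \<in> Ifut X p \<inter> N"
      unfolding \<A>_def by blast
    have "open (N \<inter> (Ipast X w \<inter> Ipast X w'))" by (intro open_Int N(1) open_Ipast[OF X])
    moreover have "p \<in> N \<inter> (Ipast X w \<inter> Ipast X w')" using A(2) C(2) N(2) by (simp add: Ipast_iff)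
    ultimately obtain v where v: "v \<in> Ifut X p \<inter> N" "v \<in> Ipast X w" "v \<in> Ipast X w'"
      using Ifut_near[OF X] by blast
    then have "B (max m m') v \<in> \<A>" unfolding \<A>_def by blast
    moreover have "B (max m m') v \<subseteq> A" "B (max m m') v \<subseteq> C"
      unfolding A(1) C(1) B_def using v(2,3) Ifut_trans[OF X] unfolding Ipast_iff by auto
    ultimately show "\<exists>D\<in>\<A>. D \<subseteq> A \<and> D \<subseteq> C" by blast
  qed (rule that)
  have clB: "B m w \<inter> U \<noteq> {}" if "w \<in> Ifut X p \<inter> N" "open U" "z \<in> U" for m w U
  proof -
    have "z \<in> closure (B m w)" using cl that(1) unfolding \<A>_def by blast
    then show ?thesis using that(2,3) unfolding closure_iff_nhds_not_empty by blast
  qed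
  \<comment> \<open>The second clause of convergence, used contrapositively: \<open>u\<close> lies
    above points of \<open>B m w1\<close> for every \<open>m\<close>, so \<open>Ifut X u\<close> is
    contained in arbitrarily late future components. In effect \<open>p\<close> is causally below
    \<open>z\<close>.\<close>
  have fut: "Ifut X u \<subseteq> Ifut X p" if u: "u \<in> Ifut X z" for u
  proof (rule ccontr)
    assume "\<not> Ifut X u \<subseteq> Ifut X p"
    then have "eventually (\<lambda>n. \<not> Ifut X u \<subseteq> snd (R n)) sequentially" using L unfolding lim_fut_def by blast
    then obtain m where m: "\<And>n. n \<ge> m \<Longrightarrow> \<not> Ifut X u \<subseteq> snd (R n)" unfolding eventually_sequentially by blast
    have "B m w1 \<inter> Ipast X u \<noteq> {}" by (rule clB[OF w1 open_Ipast[OF X]]) (use u in \<open>simp add: Ipast_iff\<close>)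
    then obtain z' n where z': "u \<in> Ifut X z'" "n \<ge> m" "Ifut X z' \<subseteq> snd (R n)"
      by (auto simp: B_def Ipast_iff)
    then have "Ifut X u \<subseteq> snd (R n)" using Ifut_trans[OF X] by blast
    then show False using m z'(2) by blast
  qed
  \<comment> \<open>Conversely \<open>z\<close> is a limit of points below every \<open>w\<close>,
    with \<open>w\<close> as close to \<open>p\<close> as desired. Two disjoint neighbourhoods and a
    convex one around \<open>z\<close> make the resulting almost closed curve contradictory.\<close>
  have "z \<noteq> p" using z N(1,2) by (auto simp: frontier_def interior_open)
  then obtain N0 N1 where H: "open N0" "open N1" "z \<in> N0" "p \<in> N1" "N0 \<inter> N1 = {}"
    by (rule separation_t2[THEN iffD1, elim_format]) blast
  obtain W where W: "open W" "z \<in> W" "W \<subseteq> N0"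
    and conv: "\<And>x y z. x \<in> W \<Longrightarrow> z \<in> W \<Longrightarrow> y \<in> Ifut X x \<Longrightarrow> z \<in> Ifut X y \<Longrightarrow> y \<in> W"
    by (rule strongly_causal_nhd[OF X S H(1,3)]) (rule that)
  obtain u' where u': "u' \<in> Ifut X z" "u' \<in> W" using Ifut_near[OF X W(1,2)] by blast
  obtain u where u: "u \<in> Ifut X z" "u' \<in> Ifut X u" by (rule Ifut_interpolate[OF X u'(1)])
  have pu': "p \<in> Ipast X u'" using fut[OF u(1)] u(2) by (auto simp: Ipast_iff)
  have "open (N \<inter> (N1 \<inter> Ipast X u'))" by (intro open_Int N(1) H(2) open_Ipast[OF X])
  moreover have "p \<in> N \<inter> (N1 \<inter> Ipast X u')" using N(2) H(4) pu' by blast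
  ultimately obtain w where w: "w \<in> Ifut X p \<inter> N" "w \<in> N1" "w \<in> Ipast X u'" using Ifut_near[OF X] by blast
  \<comment> \<open>The index 0 suffices, since closeness of \<open>z'\<close> to \<open>z\<close>
    is all that is wanted. Now \<open>w\<close> lies between \<open>z'\<close> and
    \<open>u'\<close>, both in \<open>W\<close>, and yet near \<open>p\<close>.\<close>
  obtain z' where z': "z' \<in> W" "w \<in> Ifut X z'" using clB[OF w(1) W(1,2), of 0] unfolding B_def by blast
  have "w \<in> W" using conv[OF z'(1) u'(2) z'(2)] w(3) by (simp add: Ipast_iff)
  then show False using w(2) W(3) H(5) by blast
qed

section \<open>Sequential limits of past-sets along a curve\<close>

text \<open>A limit of limits must be realised by a single sequence. The index \<open>f k\<close>
  respects both clauses of convergence for the first test points of a countable dense set, and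
  openness of chronological sets places a test point wherever the clauses for an arbitrary
  \<open>x\<close> need one.\<close>

lemma lim_past_diagonal:
  fixes P :: "'a::{t2_space, second_countable_topology} set"
  assumes X: "spacetime X" and P: "past_set X P" and R: "\<And>k n. past_set X (R k n)"
    and Q: "\<And>k. lim_past X (Q k) (R k)" and PQ: "lim_past X P Q"
  obtains f where "lim_past X P (\<lambda>k. R k (f k))"
proof -
  obtain D :: "'a set" where D: "countable D" "\<And>A. open A \<Longrightarrow> A \<noteq> {} \<Longrightarrow> \<exists>d\<in>D. d \<in> A"
    by (rule countable_dense_setE) blast
  have "D \<noteq> {}" using D(2)[OF open_UNIV UNIV_not_empty] by blast
  then have rD: "range (from_nat_into D) = D" using D(1) by (rule range_from_nat_into)
  define d where "d = from_nat_into D"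
  have d: "\<exists>i. d i \<in> A" if A: "open A" "A \<noteq> {}" for A
  proof -
    obtain x where "x \<in> range d" "x \<in> A" using D(2)[OF A] unfolding d_def rD by blast
    then show ?thesis by blast
  qed
  \<comment> \<open>For each \<open>k\<close> only finitely many eventual conditions are imposed, so
    one index meets them all.\<close>
  have "\<exists>n. \<forall>i\<le>k. (d i \<in> Q k \<longrightarrow> d i \<in> R k n) \<and>
      (\<not> Ipast X (d i) \<subseteq> Q k \<longrightarrow> \<not> Ipast X (d i) \<subseteq> R k n)" for k
  proof -
    have "eventually (\<lambda>n. (d i \<in> Q k \<longrightarrow> d i \<in> R k n) \<and>
      (\<not> Ipast X (d i) \<subseteq> Q k \<longrightarrow> \<not> Ipast X (d i) \<subseteq> R k n)) sequentially" for i
    proof (intro eventually_conj)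
      show "eventually (\<lambda>n. d i \<in> Q k \<longrightarrow> d i \<in> R k n) sequentially"
        using Q[of k] unfolding lim_past_def by (cases "d i \<in> Q k") simp_all
      show "eventually (\<lambda>n. \<not> Ipast X (d i) \<subseteq> Q k \<longrightarrow> \<not> Ipast X (d i) \<subseteq> R k n) sequentially"
        using Q[of k] unfolding lim_past_def by (cases "Ipast X (d i) \<subseteq> Q k") simp_all
    qed
    then have "eventually (\<lambda>n. \<forall>i\<in>{..k}. (d i \<in> Q k \<longrightarrow> d i \<in> R k n) \<and>
      (\<not> Ipast X (d i) \<subseteq> Q k \<longrightarrow> \<not> Ipast X (d i) \<subseteq> R k n)) sequentially"
      by (intro eventually_ball_finite) auto
    from eventually_happens'[OF sequentially_bot this] show ?thesis by (simp only: Ball_def atMost_iff)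
  qed
  then obtain f where f: "\<And>k i. i \<le> k \<Longrightarrow> d i \<in> Q k \<Longrightarrow> d i \<in> R k (f k)"
    "\<And>k i. i \<le> k \<Longrightarrow> \<not> Ipast X (d i) \<subseteq> Q k \<Longrightarrow> \<not> Ipast X (d i) \<subseteq> R k (f k)"
    by metis
  have "lim_past X P (\<lambda>k. R k (f k))"
    unfolding lim_past_def
  proof (intro conjI ballI allI impI)
    fix x assume "x \<in> P"
    then obtain z where z: "z \<in> P" "z \<in> Ifut X x" by (rule past_set_no_max[OF X P])
    \<comment> \<open>The point \<open>z\<close> shows that the open set between \<open>x\<close>
      and \<open>z'\<close> is nonempty; a test point there belongs to \<open>P\<close> and carries
      \<open>x\<close> with it.\<close>
    obtain z' where z': "z' \<in> P" "z' \<in> Ifut X z" by (rule past_set_no_max[OF X P z(1)])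
    have "open (Ifut X x \<inter> Ipast X z')" by (intro open_Int open_Ifut[OF X] open_Ipast[OF X])
    moreover have "Ifut X x \<inter> Ipast X z' \<noteq> {}" using z z' by (auto simp: Ipast_iff)
    ultimately obtain i where i: "d i \<in> Ifut X x" "d i \<in> Ipast X z'" using d by blast
    have "d i \<in> P" by (rule past_set_downward[OF X P z'(1) i(2)])
    then have "eventually (\<lambda>k. d i \<in> Q k) sequentially" using PQ unfolding lim_past_def by blast
    then show "eventually (\<lambda>k. x \<in> R k (f k)) sequentially" using eventually_ge_at_top[of i]
    proof eventually_elim
      case (elim k)
      then have "d i \<in> R k (f k)" using f(1) by blast
      then show ?case by (rule past_set_downward[OF X R]) (use i(1) in \<open>simp add: Ipast_iff\<close>)
    qed
  next
    fix x assume "\<not> Ipast X x \<subseteq> P"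
    then obtain y where y: "y \<in> Ipast X x" "y \<notin> P" by blast
    have "x \<in> Ifut X y" using y(1) by (simp add: Ipast_iff)
    then obtain z where "z \<in> Ifut X y" "x \<in> Ifut X z" by (rule Ifut_interpolate[OF X])
    then have "Ifut X y \<inter> Ipast X x \<noteq> {}" by (auto simp: Ipast_iff)
    moreover have "open (Ifut X y \<inter> Ipast X x)" by (intro open_Int open_Ifut[OF X] open_Ipast[OF X])
    ultimately obtain i where i: "d i \<in> Ifut X y" "d i \<in> Ipast X x" using d by blast
    \<comment> \<open>The test point lies above the missing \<open>y\<close> and below
      \<open>x\<close>: its past already fails to be inside \<open>P\<close>, and its failure passes
      up to the past of \<open>x\<close>.\<close>
    have "\<not> Ipast X (d i) \<subseteq> P" using i(1) y(2) by (auto simp: Ipast_iff)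
    then have "eventually (\<lambda>k. \<not> Ipast X (d i) \<subseteq> Q k) sequentially" using PQ unfolding lim_past_def by blast
    then show "eventually (\<lambda>k. \<not> Ipast X x \<subseteq> R k (f k)) sequentially" using eventually_ge_at_top[of i]
    proof eventually_elim
      case (elim k)
      then have "\<not> Ipast X (d i) \<subseteq> R k (f k)" using f(2) by blast
      moreover have "Ipast X (d i) \<subseteq> Ipast X x" using i(2) Ipast_trans[OF X] by blast
      ultimately show ?case by blast
    qed
  qed
  then show ?thesis by (rule that)
qed

text \<open>The parameter interval may be unbounded above, contain its supremum or omit it; in the
  second case the curve has a last point and the sequence is constant there.\<close>

lemma cofinal_sequence:
  fixes I :: "real set"
  assumes "I \<noteq> {}"
  obtains s :: "nat \<Rightarrow> real" where "\<And>n. s n \<in> I" "\<And>t. t \<in> I \<Longrightarrow> eventually (\<lambda>n. t \<le> s n) sequentially"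
proof (cases "bdd_above I")
  case False
  have "\<exists>s\<in>I. real n \<le> s" for n using False unfolding bdd_above_def by (meson linear)
  then obtain s where s: "\<And>n. s n \<in> I" "\<And>n. real n \<le> s n" by metis
  have "eventually (\<lambda>n. t \<le> s n) sequentially" for t
    using eventually_ge_at_top[of "nat \<lceil>t\<rceil>"]
  proof eventually_elim
    case (elim n)
    then show ?case using s(2)[of n] by linarith
  qed
  with s(1) show ?thesis using that by blast
next
  case True
  show ?thesis
  proof (cases "Sup I \<in> I")
    case True': True
    then show ?thesis using cSup_upper[OF _ True] by (intro that[of "\<lambda>_. Sup I"]) auto
  next
    case False
    have "\<exists>s\<in>I. Sup I - 1 / real (Suc n) < s" for n
      using less_cSup_iff[OF assms True, of "Sup I - 1 / real (Suc n)"] by simp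
    then obtain s where s: "\<And>n. s n \<in> I" "\<And>n. Sup I - 1 / real (Suc n) < s n" by metis
    have "eventually (\<lambda>n. t \<le> s n) sequentially" if t: "t \<in> I" for t
    proof -
      have "t < Sup I" using cSup_upper[OF t True] False t by (metis less_eq_real_def)
      then have "0 < Sup I - t" by simp
      then have "eventually (\<lambda>n. inverse (real (Suc n)) < Sup I - t) sequentially"
        by (rule order_tendstoD(2)[OF LIMSEQ_inverse_real_of_nat])
      then show ?thesis
      proof eventually_elim
        case (elim n)
        then show ?case using s(2)[of n] by (simp add: inverse_eq_divide)
      qed
    qed
    with s(1) show ?thesis using that by blast
  qed
qed

lemma L_IF_Mbar: "L_IF X S \<subseteq> Mbar X" and L_IP_Mbar: "L_IP X S \<subseteq> Mbar X"
  unfolding L_IF_def L_IP_def by blast+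

text \<open>The assumption \<open>bad\<close> is the negation of finally staying outside. The set
  \<open>A\<close> is left general because the closure of \<open>L_IF\<close> and one half of
  \<open>L_alt\<close> are both of this form.\<close>

lemma Cl_plus_endpoint:
  assumes X: "spacetime X" and C: "fd_causal_curve X \<gamma> I"
    and P: "P \<in> Mbar X" "fst P = IpastS X (\<gamma> ` I)" and A: "A \<subseteq> Mbar X"
    and bad: "\<And>t0. t0 \<in> I \<Longrightarrow> \<exists>t\<in>I. t0 \<le> t \<and> Phi X (\<gamma> t) \<in> Cl_plus X A"
  shows "P \<in> Cl_plus X A"
proof -
  note ne = fd_curveD(2)[OF C[unfolded fd_causal_curve_def]]
  have "I \<noteq> {}" using ne by blast
  then obtain s where s: "\<And>n. s n \<in> I" "\<And>t. t \<in> I \<Longrightarrow> eventually (\<lambda>n. t \<le> s n) sequentially"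
    by (rule cofinal_sequence) (rule that)
  obtain t where t: "\<And>k. t k \<in> I" "\<And>k. s k \<le> t k" "\<And>k. Phi X (\<gamma> (t k)) \<in> Cl_plus X A"
    using bad[OF s(1)] by metis
  have "\<exists>R. (\<forall>n. R n \<in> A) \<and> lim_past X (Ipast X (\<gamma> (t k))) (\<lambda>n. fst (R n))" for k
    using t(3)[of k] unfolding Cl_plus_def
  proof (elim UnE)
    \<comment> \<open>Members of \<open>A\<close> are limits of constant sequences, so every term of
      the outer sequence is a limit from \<open>A\<close>.\<close>
    assume "Phi X (\<gamma> (t k)) \<in> A"
    then show ?thesis by (intro exI[of _ "\<lambda>_. Phi X (\<gamma> (t k))"]) (simp add: lim_past_def Phi_def)
  qed (simp add: Phi_def)
  then obtain R where R: "\<And>k n. R k n \<in> A" "\<And>k. lim_past X (Ipast X (\<gamma> (t k))) (\<lambda>n. fst (R k n))"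
    by metis
  have P_eq: "fst P = (\<Union>u\<in>I. Ipast X (\<gamma> u))" unfolding P(2) IpastS_def by simp
  have lim: "lim_past X (fst P) (\<lambda>k. Ipast X (\<gamma> (t k)))"
    unfolding lim_past_def
  proof (intro conjI ballI allI impI)
    fix x assume "x \<in> fst P"
    then obtain u where u: "u \<in> I" "x \<in> Ipast X (\<gamma> u)" unfolding P_eq by blast
    show "eventually (\<lambda>k. x \<in> Ipast X (\<gamma> (t k))) sequentially"
      using s(2)[OF u(1)]
    proof eventually_elim
      case (elim k)
      then have "u \<le> t k" using t(2)[of k] by simp
      then show ?case using Ipast_mono_causal[OF X C u(1) t(1)] u(2) by blast
    qed
  next
    fix x assume x: "\<not> Ipast X x \<subseteq> fst P"
    have "Ipast X (\<gamma> (t k)) \<subseteq> fst P" for k unfolding P_eq using t(1) by blast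
    then show "eventually (\<lambda>k. \<not> Ipast X x \<subseteq> Ipast X (\<gamma> (t k))) sequentially"
      using x by (intro always_eventually) blast
  qed
  have "past_set X (fst (R k n))" for k n using R(1) A Mbar_cases(3) by blast
  then obtain f where f: "lim_past X (fst P) (\<lambda>k. fst (R k (f k)))"
    by (rule lim_past_diagonal[OF X Mbar_cases(3)[OF P(1)] _ R(2) lim])
  obtain u where "u \<in> I" using ne by blast
  then have "fst P \<noteq> {}" using Ipast_near[OF X open_UNIV UNIV_I, of "\<gamma> u"] unfolding P_eq by blast
  then show ?thesis unfolding Cl_plus_def
    using P(1) R(1) f by (intro UnI2 CollectI conjI exI[of _ "\<lambda>k. R k (f k)"]) auto
qed

text \<open>Membership in a closure defined by future components becomes an inclusion of pasts, the
  kind of information that passes to the union along the curve.\<close>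

lemma Phi_Cl_minus_Ipast_subset:
  assumes X: "spacetime X" and S: "strongly_causal X" and A: "A \<subseteq> L_IP X S1"
    and "Phi X p \<in> Cl_minus X A"
  shows "Ipast X p \<subseteq> (\<Union>R\<in>S1. fst R)"
  using assms(4) unfolding Cl_minus_def
proof (elim UnE)
  assume "Phi X p \<in> A"
  then have "fst (Phi X p) \<subseteq> (\<Union>R\<in>S1. fst R)" using A unfolding L_IP_def by blast
  then show ?thesis by (simp add: Phi_def)
next
  assume "Phi X p \<in> {Q \<in> Mbar X. snd Q \<noteq> {} \<and> (\<exists>R. (\<forall>n. R n \<in> A) \<and> lim_fut X (snd Q) (\<lambda>n. snd (R n)))}"
  then obtain R where R: "\<And>n. R n \<in> A" and L: "lim_fut X (Ifut X p) (\<lambda>n. snd (R n))"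
    by (auto simp: Phi_def)
  have "R n \<in> Mbar X" "fst (R n) \<noteq> {}" "fst (R n) \<subseteq> (\<Union>R\<in>S1. fst R)" for n
    using R[of n] A unfolding L_IP_def by blast+
  then show ?thesis using lim_fut_Ifut_imp_Ipast_subset[OF X S, of R p] L by blast
qed

theorem theorem15:
  fixes X :: "('a::{t2_space, second_countable_topology}, 'v::euclidean_space) spacetime_data"
    and \<gamma> :: "real \<Rightarrow> 'a" and I :: "real set" and Pbar :: "'a set \<times> 'a set"
  assumes "spacetime X" and "strongly_causal X"
    and "fd_causal_curve X \<gamma> I"
    and "Pbar \<in> Mbar X" and "fst Pbar = IpastS X (\<gamma> ` I)"
  shows "\<forall>U. openin (T_alt X) U \<and> Pbar \<in> U \<longrightarrow>
           (\<exists>t0\<in>I. \<forall>t\<in>I. t0 \<le> t \<longrightarrow> Phi X (\<gamma> t) \<in> U)"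
proof (intro allI impI, elim conjE)
  note X = assms(1) and S = assms(2) and C = assms(3) and P = assms(4,5)
  note ne = fd_curveD(2)[OF C[unfolded fd_causal_curve_def]]
  have Mb: "Phi X q \<in> Mbar X" for q by (rule Phi_Mbar[OF X S])
  have P_eq: "fst Pbar = (\<Union>u\<in>I. Ipast X (\<gamma> u))" unfolding P(2) IpastS_def by simp
  obtain u0 where u0: "u0 \<in> I" using ne by blast
  then have Pne: "fst Pbar \<noteq> {}" using Ipast_near[OF X open_UNIV UNIV_I, of "\<gamma> u0"] unfolding P_eq by blast
  define final where "final U \<longleftrightarrow> (\<exists>t0\<in>I. \<forall>t\<in>I. t0 \<le> t \<longrightarrow> Phi X (\<gamma> t) \<in> U)" for U
  have final_compl: "final (Mbar X - L)"
    if "\<not> (\<forall>t0\<in>I. \<exists>t\<in>I. t0 \<le> t \<and> Phi X (\<gamma> t) \<in> L)" for L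
    using that Mb unfolding final_def by blast
  have plus: "final (Mbar X - Cl_plus X A)" if "Pbar \<notin> Cl_plus X A" "A \<subseteq> Mbar X" for A
    using Cl_plus_endpoint[OF X C P that(2)] that(1) by (intro final_compl) blast
  \<comment> \<open>The inclusions of pasts combine over the curve and place the endpoint in
    \<open>L_IP X S1\<close> itself, before any closure is taken.\<close>
  have minus: "final (Mbar X - L_minus_alt X S1)" if no: "Pbar \<notin> L_minus_alt X S1" for S1 :: "('a set \<times> 'a set) set"
  proof (rule final_compl, rule notI)
    assume bad: "\<forall>t0\<in>I. \<exists>t\<in>I. t0 \<le> t \<and> Phi X (\<gamma> t) \<in> L_minus_alt X S1"
    have "Ipast X (\<gamma> u) \<subseteq> (\<Union>R\<in>S1. fst R)" if u: "u \<in> I" for u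
    proof -
      obtain t where t: "t \<in> I" "u \<le> t" "Phi X (\<gamma> t) \<in> Cl_minus X (L_IP X S1)"
        using bad u unfolding L_minus_alt_def by blast
      show ?thesis
        using Ipast_mono_causal[OF X C u t(1,2)] Phi_Cl_minus_Ipast_subset[OF X S order_refl t(3)] by blast
    qed
    then have "fst Pbar \<subseteq> (\<Union>R\<in>S1. fst R)" unfolding P_eq by (rule UN_least)
    then have "Pbar \<in> L_IP X S1" unfolding L_IP_def by (intro CollectI conjI P(1) Pne)
    then show False using no unfolding L_minus_alt_def Cl_minus_def by blast
  qed
  \<comment> \<open>For images of points, \<open>Cl_minus X A\<close> collapses to \<open>A\<close>:
    the past is covered by the preceding lemma, and the future by the pointwise clause of
    convergence. Hence returning to \<open>L_alt\<close> means returning to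
    \<open>Cl_plus X A\<close>.\<close>
  have both: "final (Mbar X - L_alt X S1 S2)" if no: "Pbar \<notin> L_alt X S1 S2" for S1 S2 :: "('a set \<times> 'a set) set"
  proof -
    define A where "A = L_IP X S1 \<inter> L_IF X S2"
    have AM: "A \<subseteq> Mbar X" unfolding A_def using L_IP_Mbar by blast
    have A1: "A \<subseteq> L_IP X S1" unfolding A_def by blast
    have "Phi X p \<in> Cl_plus X A" if p: "Phi X p \<in> Cl_minus X A" for p
    proof -
      have "Ipast X p \<subseteq> (\<Union>R\<in>S1. fst R)" by (rule Phi_Cl_minus_Ipast_subset[OF X S A1 p])
      moreover have "Ifut X p \<subseteq> (\<Union>R\<in>S2. snd R)"
        using p unfolding Cl_minus_def
      proof (elim UnE)
        assume "Phi X p \<in> A"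
        then have "snd (Phi X p) \<subseteq> (\<Union>R\<in>S2. snd R)" unfolding A_def L_IF_def by blast
        then show ?thesis by (simp add: Phi_def)
      next
        assume "Phi X p \<in> {Q \<in> Mbar X. snd Q \<noteq> {} \<and> (\<exists>R. (\<forall>n. R n \<in> A) \<and> lim_fut X (snd Q) (\<lambda>n. snd (R n)))}"
        then obtain R where R: "\<And>n. R n \<in> A" and L: "lim_fut X (Ifut X p) (\<lambda>n. snd (R n))"
          by (auto simp: Phi_def)
        show ?thesis
        proof
          fix x assume "x \<in> Ifut X p"
          then have "eventually (\<lambda>n. x \<in> snd (R n)) sequentially" using L unfolding lim_fut_def by blast
          then obtain n where "x \<in> snd (R n)" unfolding eventually_sequentially by blast
          then show "x \<in> (\<Union>R\<in>S2. snd R)" using R[of n] unfolding A_def L_IF_def by blast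
        qed
      qed
      moreover have "Ipast X p \<noteq> {}" "Ifut X p \<noteq> {}"
        using Ipast_near[OF X open_UNIV UNIV_I] Ifut_near[OF X open_UNIV UNIV_I] by blast+
      ultimately have "Phi X p \<in> A" using Mb[of p] unfolding A_def L_IP_def L_IF_def Phi_def by simp
      then show ?thesis unfolding Cl_plus_def by blast
    qed
    moreover have "L_alt X S1 S2 = Cl_plus X A \<union> Cl_minus X A" by (simp add: L_alt_def A_def)
    ultimately show ?thesis using plus[OF _ AM] no unfolding final_def by blast
  qed
  fix U assume U: "openin (T_alt X) U" "Pbar \<in> U"
  let ?B = "{Mbar X - L_plus_alt X S | S. S \<subseteq> Mbar X} \<union> {Mbar X - L_minus_alt X S | S. S \<subseteq> Mbar X} \<union>
      {Mbar X - L_alt X S1 S2 | S1 S2. S1 \<subseteq> Mbar X \<and> S2 \<subseteq> Mbar X}"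
  have "generate_topology_on ?B U" using U(1) unfolding T_alt_def openin_topology_generated_by_iff .
  \<comment> \<open>Finality passes to a finite intersection by taking the later parameter, and to a
    union through a member containing the endpoint, so only the generating sets have to be
    checked.\<close>
  then have "Pbar \<in> U \<longrightarrow> final U"
  proof (induction rule: generate_topology_on.induct)
    case (Int a b)
    show ?case
    proof
      assume "Pbar \<in> a \<inter> b"
      then obtain t1 t2 where t: "t1 \<in> I" "t2 \<in> I" "\<forall>t\<in>I. t1 \<le> t \<longrightarrow> Phi X (\<gamma> t) \<in> a"
        "\<forall>t\<in>I. t2 \<le> t \<longrightarrow> Phi X (\<gamma> t) \<in> b" using Int.IH unfolding final_def by blast
      then show "final (a \<inter> b)" unfolding final_def by (intro bexI[of _ "max t1 t2"]) (auto simp: max_def)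
    qed
  next
    case (UN K)
    then show ?case unfolding final_def by (meson UnionE UnionI)
  next
    case (Basis s)
    then consider S' :: "('a set \<times> 'a set) set" where "s = Mbar X - L_plus_alt X S'"
      | S' :: "('a set \<times> 'a set) set" where "s = Mbar X - L_minus_alt X S'"
      | S1 S2 :: "('a set \<times> 'a set) set" where "s = Mbar X - L_alt X S1 S2" by blast
    then show ?case
      by cases (auto simp: L_plus_alt_def intro!: plus L_IF_Mbar minus both)
  qed simp
  then show "\<exists>t0\<in>I. \<forall>t\<in>I. t0 \<le> t \<longrightarrow> Phi X (\<gamma> t) \<in> U" using U(2) unfolding final_def by blast
qed

end
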